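(* Under the standing assumptions on $\Omega,Y,\Gamma_R,\Gamma_N,A,D,R,p_F,\kappa,\rho_I,f,g$ listed in the context, the weak solution $(\pi,\rho)$ of the two-scale elliptic-parabolic problem $(P_1)$ (as defined in the context) is unique.
   Context: Setting. $d_1,d_2\in\{1,2,3\}$, $T>0$, $S=(0,T)$; $\Omega\subset\mathbb{R}^{d_1}$ and $Y\subset\mathbb{R}^{d_2}$ are convex polygons (bounded convex polytopal domains); $\partial Y=\Gamma_R\cup\Gamma_N$ with $\Gamma_R\cap\Gamma_N=\emptyset$; $d\sigma_y$ is surface measure on $\partial Y$. $\mathcal{C}_\Omega$ denotes the constant in Poincaré's inequality $\|u\|^2_{L^2(\Omega)}\le\mathcal{C}_\Omega\|\nabla_x u\|^2_{L^2(\Omega)}$, $u\in H_0^1(\Omega)$. Standing assumptions. $A,D,R,p_F,\kappa$ are positive constants and $2\mathcal{C}_\Omega/A<1$. The initial datum satisfies $\rho_I\in L^2(\Omega;H^1(Y))$. The function $f:\mathbb{R}^2\to\mathbb{R}$ satisfies: (i) its weak partial derivatives $D_1f,D_2f$ belong to $L^\infty(\mathbb{R}^2)$ with $\|D_1f\|_{L^\infty}\le\theta$, $\|D_2f\|_{L^\infty}\le\theta$, where $\theta<2\mathcal{C}_\Omega/A$, $\theta<1/\mathcal{C}_\Omega$, $1+4\theta^2<3/2$; (ii) $f(0,s)=0$ for all $s\in\mathbb{R}$; (iii) $|f(r,s)|\le C_f\min(|r|,|r|^\alpha)$ for some constants $C_f>0$, $\alpha\in(0,1)$ and all $r,s\in\mathbb{R}$.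 $g$ is a linear map from $L^2(\Omega;H^1(Y))$ to $L^2(\Omega)$ (applied at each time) with $\int_\Omega g(\rho)^2dx\le C_g\|\rho\|^2_{L^2(\Omega;H^1(Y))}$ for some constant $C_g>0$. Problem $(P_1)$ is: $-A\Delta_x\pi=f(\pi,g(\rho))$ in $S\times\Omega$; $\partial_t\rho-D\Delta_y\rho=0$ in $S\times\Omega\times Y$; $D\nabla_y\rho\cdot n_y=\kappa(\pi+p_F-R\rho)$ on $S\times\Omega\times\Gamma_R$; $D\nabla_y\rho\cdot n_y=0$ on $S\times\Omega\times\Gamma_N$; $\pi=0$ on $S\times\partial\Omega$; $\rho(t=0)=\rho_I$. Weak solution. A weak solution of $(P_1)$ is a pair $(\pi,\rho)\in L^2(S;H_0^1(\Omega))\times L^2(S;L^2(\Omega;H^1(Y)))$ with $\partial_t\rho\in L^2(S\times\Omega\times Y)$ such that for all $(\varphi,\psi)\in H_0^1(\Omega)\times L^2(\Omega;H^1(Y))$ and almost every $t\in S$ $$A\int_\Omega\nabla_x\pi\cdot\nabla_x\varphi\,dx=\int_\Omega f(\pi,g(\rho))\varphi\,dx,$$ $$\int_\Omega\int_Y\partial_t\rho\,\psi\,dy\,dx+D\int_\Omega\int_Y\nabla_y\rho\cdot\nabla_y\psi\,dy\,dx=\kappa\int_\Omega\int_{\Gamma_R}(\pi+p_F-R\rho)\psi\,d\sigma_y\,dx,$$ with $\rho(0)=\rho_I$ and $\pi(0)=\pi_I$, where $\pi_I\in H_0^1(\Omega)$ is the weak solution of $-A\Delta_x\pi_I=f(\pi_I,g(\rho_I))$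 in $\Omega$, $\pi_I=0$ on $\partial\Omega$.
   Formalization: The function f is additionally assumed continuous (the Lipschitz representative of its class), since altering f on the null set {s=0} with g=0 can destroy uniqueness; Γ_R is assumed Borel so that the boundary integral makes sense. *)

theory Defs
  imports "HOL-Analysis.Analysis"
begin

definition convex_polytopal_domain :: "'a::euclidean_space set \<Rightarrow> bool" where
  "convex_polytopal_domain U \<longleftrightarrow> open U \<and> convex U \<and> U \<noteq> {} \<and> polytope (closure U)"

abbreviation lborel_on :: "'a::euclidean_space set \<Rightarrow> 'a measure" where
  "lborel_on U \<equiv> restrict_space lborel U"

definition L2 :: "'a measure \<Rightarrow> ('a \<Rightarrow> 'b::euclidean_space) \<Rightarrow> bool" where
  "L2 M u \<longleftrightarrow> u \<in> borel_measurable M \<and> integrable M (\<lambda>x. (norm (u x))\<^sup>2)"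


section \<open>Weak derivatives and Sobolev spaces\<close>

abbreviation partial :: "('a::euclidean_space \<Rightarrow> real) \<Rightarrow> 'a \<Rightarrow> 'a \<Rightarrow> real" where
  "partial \<phi> i x \<equiv> frechet_derivative \<phi> (at x) i"

definition grad :: "('a::euclidean_space \<Rightarrow> real) \<Rightarrow> 'a \<Rightarrow> 'a" where
  "grad \<phi> x = (\<Sum>i\<in>Basis. partial \<phi> i x *\<^sub>R i)"

primrec Ck :: "nat \<Rightarrow> ('a::euclidean_space \<Rightarrow> real) \<Rightarrow> bool" where
  "Ck 0 \<phi> \<longleftrightarrow> continuous_on UNIV \<phi>"
| "Ck (Suc k) \<phi> \<longleftrightarrow> (\<forall>x. \<phi> differentiable (at x)) \<and> (\<forall>i\<in>Basis. Ck k (partial \<phi> i))"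

definition smooth :: "('a::euclidean_space \<Rightarrow> real) \<Rightarrow> bool" where
  "smooth \<phi> \<longleftrightarrow> (\<forall>k. Ck k \<phi>)"

definition test_fun :: "'a::euclidean_space set \<Rightarrow> ('a \<Rightarrow> real) \<Rightarrow> bool" where
  "test_fun U \<phi> \<longleftrightarrow>
     smooth \<phi> \<and> compact (closure {x. \<phi> x \<noteq> 0}) \<and> closure {x. \<phi> x \<noteq> 0} \<subseteq> U"

definition locally_integrable :: "'a::euclidean_space set \<Rightarrow> ('a \<Rightarrow> real) \<Rightarrow> bool" where
  "locally_integrable U u \<longleftrightarrow> (\<forall>K. compact K \<and> K \<subseteq> U \<longrightarrow> set_integrable lborel K u)"

definition weak_partial ::
  "'a::euclidean_space set \<Rightarrow> ('a \<Rightarrow> real) \<Rightarrow> 'a \<Rightarrow> ('a \<Rightarrow> real) \<Rightarrow> bool" where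
  "weak_partial U u i v \<longleftrightarrow>
     locally_integrable U u \<and> locally_integrable U v \<and>
     (\<forall>\<phi>. test_fun U \<phi> \<longrightarrow>
        (LINT x|lborel_on U. u x * partial \<phi> i x) = - (LINT x|lborel_on U. v x * \<phi> x))"

text \<open>
  Elements of function spaces are represented by functions, to be read up to equality almost
  everywhere.  Weak gradients (and, below, traces) are carried along as explicit relational
  arguments; they are determined up to null sets.  So \<open>H1 U u Du\<close> says that \<open>u\<close> is in
  \<open>H\<^sup>1(U)\<close> and that \<open>Du\<close> is its weak gradient.
\<close>

definition H1 :: "'a::euclidean_space set \<Rightarrow> ('a \<Rightarrow> real) \<Rightarrow> ('a \<Rightarrow> 'a) \<Rightarrow> bool" where
  "H1 U u Du \<longleftrightarrow>
     L2 (lborel_on U) u \<and> L2 (lborel_on U) Du \<and>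
     (\<forall>i\<in>Basis. weak_partial U u i (\<lambda>x. Du x \<bullet> i))"

definition H1_tendsto ::
  "'a::euclidean_space set \<Rightarrow> (nat \<Rightarrow> 'a \<Rightarrow> real) \<Rightarrow> ('a \<Rightarrow> real) \<Rightarrow> ('a \<Rightarrow> 'a) \<Rightarrow> bool" where
  "H1_tendsto U \<phi> u Du \<longleftrightarrow>
     (\<lambda>n. LINT x|lborel_on U. (\<phi> n x - u x)\<^sup>2 + (norm (grad (\<phi> n) x - Du x))\<^sup>2) \<longlonglongrightarrow> 0"

text \<open>\<open>H\<^sub>0\<^sup>1(U)\<close> is the closure of the test functions in \<open>H\<^sup>1(U)\<close>.\<close>

definition H10 :: "'a::euclidean_space set \<Rightarrow> ('a \<Rightarrow> real) \<Rightarrow> ('a \<Rightarrow> 'a) \<Rightarrow> bool" where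
  "H10 U u Du \<longleftrightarrow> H1 U u Du \<and> (\<exists>\<phi>. (\<forall>n. test_fun U (\<phi> n)) \<and> H1_tendsto U \<phi> u Du)"

definition poincare_constant :: "'a::euclidean_space set \<Rightarrow> real \<Rightarrow> bool" where
  "poincare_constant U C \<longleftrightarrow>
     (\<forall>u Du. H10 U u Du \<longrightarrow>
        (LINT x|lborel_on U. (u x)\<^sup>2) \<le> C * (LINT x|lborel_on U. (norm (Du x))\<^sup>2))"

text \<open>
  \<open>L2_into M U V u Du\<close>: the map \<open>a \<mapsto> u a\<close> belongs to the Bochner space \<open>L\<^sup>2(M; V)\<close>, for \<open>V\<close> one
  of \<open>H\<^sup>1(U)\<close>, \<open>H\<^sub>0\<^sup>1(U)\<close>.  Strong measurability into these separable spaces is joint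
  measurability of the function and of its gradient in the variable of \<open>U\<close>.
\<close>

definition L2_into ::
  "'m measure \<Rightarrow> 'a::euclidean_space set \<Rightarrow>
   ('a set \<Rightarrow> ('a \<Rightarrow> real) \<Rightarrow> ('a \<Rightarrow> 'a) \<Rightarrow> bool) \<Rightarrow>
   ('m \<Rightarrow> 'a \<Rightarrow> real) \<Rightarrow> ('m \<Rightarrow> 'a \<Rightarrow> 'a) \<Rightarrow> bool" where
  "L2_into M U V u Du \<longleftrightarrow>
     L2 (M \<Otimes>\<^sub>M lborel_on U) (\<lambda>(a, x). u a x) \<and>
     L2 (M \<Otimes>\<^sub>M lborel_on U) (\<lambda>(a, x). Du a x) \<and>
     (AE a in M. V U (u a) (Du a))"


section \<open>Surface measure and traces\<close>

text \<open>
  The normal of a facet is unique up to sign.  The \<open>(d - 1)\<close>-dimensional measure of a subset of a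
  facet is the \<open>d\<close>-dimensional volume of the right prism of height 1 over it; for \<open>d = 1\<close> every
  end point of the interval gets mass 1.  The sum over all facets is the surface measure.
\<close>

definition facet_normal :: "'a::euclidean_space set \<Rightarrow> 'a" where
  "facet_normal F = (SOME n. norm n = 1 \<and> (\<forall>p\<in>F. \<forall>q\<in>F. (p - q) \<bullet> n = 0))"

definition prism :: "'a::euclidean_space set \<Rightarrow> 'a set \<Rightarrow> 'a set" where
  "prism F B = {b + s *\<^sub>R facet_normal F |b s. b \<in> B \<inter> F \<and> 0 \<le> s \<and> s \<le> 1}"

definition surface_measure :: "'a::euclidean_space set \<Rightarrow> 'a measure" where
  "surface_measure U = measure_of UNIV (sets borel)
     (\<lambda>B. \<Sum>F | F facet_of closure U. emeasure lborel (prism F B))"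

text \<open>The defining set function is countably additive, so \<open>measure_of\<close> does not collapse to 0.\<close>

lemma facet_normal:
  fixes F :: "'a::euclidean_space set"
  assumes "F facet_of S"
  shows "norm (facet_normal F) = 1" "\<And>p q. p \<in> F \<Longrightarrow> q \<in> F \<Longrightarrow> (p - q) \<bullet> facet_normal F = 0"
proof -
  have "aff_dim F < int DIM('a)"
    using assms aff_dim_le_DIM[of S] by (auto simp: facet_of_def)
  then obtain a b where ab: "a \<noteq> 0" and F: "F \<subseteq> {x. a \<bullet> x = b}"
    using aff_lowdim_subset_hyperplane by blast
  have "norm (a /\<^sub>R norm a) = 1 \<and> (\<forall>p\<in>F. \<forall>q\<in>F. (p - q) \<bullet> (a /\<^sub>R norm a) = 0)"
    using ab F by (auto simp: inner_diff_right inner_commute[of _ a] subset_iff)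
  then have "norm (facet_normal F) = 1 \<and> (\<forall>p\<in>F. \<forall>q\<in>F. (p - q) \<bullet> facet_normal F = 0)"
    unfolding facet_normal_def by (rule someI)
  then show "norm (facet_normal F) = 1"
    "\<And>p q. p \<in> F \<Longrightarrow> q \<in> F \<Longrightarrow> (p - q) \<bullet> facet_normal F = 0" by auto
qed

lemma prism_sets:
  fixes F :: "'a::euclidean_space set"
  assumes "F facet_of S" "closed F" "B \<in> sets borel"
  shows "prism F B \<in> sets borel"
proof -
  let ?n = "facet_normal F"
  obtain p where p: "p \<in> F"
    using assms(1) by (auto simp: facet_of_def)
  have n: "?n \<bullet> ?n = 1"
    using facet_normal(1)[OF assms(1)] by (simp add: norm_eq_1)
  have "prism F B = {z. 0 \<le> (z - p) \<bullet> ?n \<and> (z - p) \<bullet> ?n \<le> 1}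
      \<inter> (\<lambda>z. z - ((z - p) \<bullet> ?n) *\<^sub>R ?n) -` (B \<inter> F)" (is "_ = ?R")
  proof (intro equalityI subsetI)
    fix z assume "z \<in> prism F B"
    then obtain b s where z: "z = b + s *\<^sub>R ?n" "b \<in> B" "b \<in> F" "0 \<le> s" "s \<le> 1"
      by (auto simp: prism_def)
    have "(z - p) \<bullet> ?n = s"
      using facet_normal(2)[OF assms(1) z(3) p] n
      by (simp add: z(1) inner_add_left inner_diff_left)
    then show "z \<in> ?R" using z by simp
  next
    fix z assume z: "z \<in> ?R"
    then show "z \<in> prism F B"
      unfolding prism_def
      by (intro CollectI exI[of _ "z - ((z - p) \<bullet> ?n) *\<^sub>R ?n"] exI[of _ "(z - p) \<bullet> ?n"]) auto
  qed
  also have "\<dots> \<in> sets borel"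
  proof (intro sets.Int)
    show "{z. 0 \<le> (z - p) \<bullet> ?n \<and> (z - p) \<bullet> ?n \<le> 1} \<in> sets borel" by measurable
    have "(\<lambda>z. z - ((z - p) \<bullet> ?n) *\<^sub>R ?n) \<in> borel_measurable borel" by measurable
    moreover have "B \<inter> F \<in> sets borel" using assms by auto
    ultimately show "(\<lambda>z. z - ((z - p) \<bullet> ?n) *\<^sub>R ?n) -` (B \<inter> F) \<in> sets borel"
      using measurable_sets[of _ borel borel] by fastforce
  qed
  finally show ?thesis .
qed

lemma prism_disjoint:
  assumes "F facet_of S" "B \<inter> C = {}"
  shows "prism F B \<inter> prism F C = {}"
proof -
  let ?n = "facet_normal F"
  have n: "?n \<bullet> ?n = 1"
    using facet_normal(1)[OF assms(1)] by (simp add: norm_eq_1)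
  have "b = c" if "b \<in> F" "c \<in> F" "b + s *\<^sub>R ?n = c + t *\<^sub>R ?n" for b c s t
  proof -
    have "b \<bullet> ?n + s = c \<bullet> ?n + t"
      using arg_cong[OF that(3), of "\<lambda>z. z \<bullet> ?n"] n by (simp add: inner_add_left)
    then have "s = t"
      using facet_normal(2)[OF assms(1) that(1,2)] by (simp add: inner_diff_left)
    then show ?thesis using that by simp
  qed
  then show ?thesis using assms(2) unfolding prism_def by blast
qed

lemma sets_surface_measure [measurable_cong, simp]: "sets (surface_measure U) = sets borel"
  and space_surface_measure [simp]: "space (surface_measure U) = UNIV"
  using sets.sigma_sets_eq[of borel]
  by (simp_all add: surface_measure_def)

lemma emeasure_surface_measure:
  assumes "convex U" "B \<in> sets borel"
  shows "emeasure (surface_measure U) B =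
    (\<Sum>F | F facet_of closure U. emeasure lborel (prism F B))"
  unfolding surface_measure_def
proof (subst emeasure_measure_of_sigma)
  have cl: "closed F" if "F facet_of closure U" for F
  proof (rule face_of_imp_closed)
    show "F face_of closure U" using that by (rule facet_of_imp_face_of)
  qed (use assms(1) in \<open>simp_all add: convex_closure\<close>)
  show "sigma_algebra UNIV (sets (borel :: 'a measure))"
    using sets.sigma_algebra_axioms[of "borel :: 'a measure"] by simp
  show "positive (sets borel) (\<lambda>B. \<Sum>F | F facet_of closure U. emeasure lborel (prism F B))"
    by (simp add: positive_def prism_def)
  show "countably_additive (sets borel)
      (\<lambda>B. \<Sum>F | F facet_of closure U. emeasure lborel (prism F B))"
  proof (rule countably_additiveI)
    fix B :: "nat \<Rightarrow> 'a set"
    assume B: "range B \<subseteq> sets borel" "disjoint_family B"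
    have eq: "(\<Sum>i. emeasure lborel (prism F (B i))) = emeasure lborel (prism F (\<Union>i. B i))"
      if F: "F facet_of closure U" for F
    proof -
      have "(\<Sum>i. emeasure lborel (prism F (B i))) = emeasure lborel (\<Union>i. prism F (B i))"
      proof (rule suminf_emeasure)
        show "range (\<lambda>i. prism F (B i)) \<subseteq> sets lborel"
          using B(1) prism_sets[OF F cl[OF F]] by auto
        show "disjoint_family (\<lambda>i. prism F (B i))"
          using B(2) prism_disjoint[OF F] by (simp add: disjoint_family_on_def)
      qed
      also have "(\<Union>i. prism F (B i)) = prism F (\<Union>i. B i)"
        by (auto simp: prism_def)
      finally show ?thesis .
    qed
    have "(\<Sum>i. \<Sum>F | F facet_of closure U. emeasure lborel (prism F (B i))) =
        (\<Sum>F | F facet_of closure U. \<Sum>i. emeasure lborel (prism F (B i)))"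
      by (rule suminf_sum) auto
    also have "\<dots> = (\<Sum>F | F facet_of closure U. emeasure lborel (prism F (\<Union>i. B i)))"
      by (rule sum.cong) (auto simp: eq)
    finally show "(\<Sum>i. \<Sum>F | F facet_of closure U. emeasure lborel (prism F (B i))) =
        (\<Sum>F | F facet_of closure U. emeasure lborel (prism F (\<Union>i. B i)))" .
  qed
qed (use assms in auto)

text \<open>
  The trace on the boundary is the continuous extension to \<open>H\<^sup>1(U)\<close> of the restriction of functions
  that are smooth up to the boundary: \<open>w\<close> is the trace of \<open>u\<close>.
\<close>

definition is_trace ::
  "'a::euclidean_space set \<Rightarrow> ('a \<Rightarrow> real) \<Rightarrow> ('a \<Rightarrow> 'a) \<Rightarrow> ('a \<Rightarrow> real) \<Rightarrow> bool" where
  "is_trace U u Du w \<longleftrightarrow>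
     H1 U u Du \<and> L2 (surface_measure U) w \<and>
     (\<exists>\<phi>. (\<forall>n. smooth (\<phi> n)) \<and> H1_tendsto U \<phi> u Du \<and>
          (\<lambda>n. LINT y|surface_measure U. (\<phi> n y - w y)\<^sup>2) \<longlonglongrightarrow> 0)"

definition is_trace_L2 ::
  "'m measure \<Rightarrow> 'a::euclidean_space set \<Rightarrow>
   ('m \<Rightarrow> 'a \<Rightarrow> real) \<Rightarrow> ('m \<Rightarrow> 'a \<Rightarrow> 'a) \<Rightarrow> ('m \<Rightarrow> 'a \<Rightarrow> real) \<Rightarrow> bool" where
  "is_trace_L2 M U u Du w \<longleftrightarrow>
     L2 (M \<Otimes>\<^sub>M surface_measure U) (\<lambda>(a, y). w a y) \<and>
     (AE a in M. is_trace U (u a) (Du a) (w a))"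


section \<open>Time derivative and initial value\<close>

definition weak_time_deriv ::
  "real set \<Rightarrow> 'm measure \<Rightarrow> (real \<Rightarrow> 'm \<Rightarrow> real) \<Rightarrow> (real \<Rightarrow> 'm \<Rightarrow> real) \<Rightarrow> bool" where
  "weak_time_deriv S M u u' \<longleftrightarrow>
     (\<forall>\<eta>. test_fun S \<eta> \<longrightarrow>
        (AE z in M. (LINT t|lborel_on S. u t z * deriv \<eta> t) =
                   - (LINT t|lborel_on S. u' t z * \<eta> t)))"

text \<open>
  \<open>u(0) = u\<^sub>0\<close> for a function \<open>u\<close> on \<open>(0,T)\<close> with a continuous \<open>L\<^sup>2(M)\<close>-valued representative
  \<open>r\<close> on \<open>[0,T]\<close>, as is the case if \<open>u\<close> and its weak time derivative are square integrable.
\<close>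

definition has_initial_value ::
  "real \<Rightarrow> 'm measure \<Rightarrow> (real \<Rightarrow> 'm \<Rightarrow> real) \<Rightarrow> ('m \<Rightarrow> real) \<Rightarrow> bool" where
  "has_initial_value T M u u0 \<longleftrightarrow>
     (\<exists>r. (\<forall>t\<in>{0..T}. L2 M (r t)) \<and>
          (\<forall>s\<in>{0..T}. ((\<lambda>t. LINT z|M. (r t z - r s z)\<^sup>2) \<longlongrightarrow> 0) (at s within {0..T})) \<and>
          (AE t in lborel_on {0<..<T}. AE z in M. r t z = u t z) \<and>
          (AE z in M. r 0 z = u0 z))"


section \<open>The coupled problem\<close>

definition linear_L2H1_L2 ::
  "'x::euclidean_space set \<Rightarrow> 'y::euclidean_space set \<Rightarrow>
   (('x \<Rightarrow> 'y \<Rightarrow> real) \<Rightarrow> 'x \<Rightarrow> real) \<Rightarrow> bool" where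
  "linear_L2H1_L2 \<Omega> Y g \<longleftrightarrow>
     (\<forall>u Du. L2_into (lborel_on \<Omega>) Y H1 u Du \<longrightarrow> L2 (lborel_on \<Omega>) (g u)) \<and>
     (\<forall>u Du v Dv.
        L2_into (lborel_on \<Omega>) Y H1 u Du \<and> L2_into (lborel_on \<Omega>) Y H1 v Dv \<longrightarrow>
          ((AE (x, y) in lborel_on \<Omega> \<Otimes>\<^sub>M lborel_on Y. u x y = v x y) \<longrightarrow>
             (AE x in lborel_on \<Omega>. g u x = g v x)) \<and>
          (\<forall>a b. AE x in lborel_on \<Omega>.
             g (\<lambda>x y. a * u x y + b * v x y) x = a * g u x + b * g v x))"

definition elliptic_weak_solution ::
  "'x::euclidean_space set \<Rightarrow> real \<Rightarrow> (real \<Rightarrow> real \<Rightarrow> real) \<Rightarrow> ('x \<Rightarrow> real) \<Rightarrow>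
   ('x \<Rightarrow> real) \<Rightarrow> bool" where
  "elliptic_weak_solution \<Omega> A f h p \<longleftrightarrow>
     (\<exists>Dp. H10 \<Omega> p Dp \<and>
        (\<forall>\<phi> D\<phi>. H10 \<Omega> \<phi> D\<phi> \<longrightarrow>
           A * (LINT x|lborel_on \<Omega>. Dp x \<bullet> D\<phi> x) =
             (LINT x|lborel_on \<Omega>. f (p x) (h x) * \<phi> x)))"

text \<open>
  In \<open>weak_solution\<close>, \<open>D\<pi>\<close>, \<open>D\<rho>\<close> are the weak gradients of \<open>\<pi>\<close>, \<open>\<rho>\<close> in \<open>x\<close> and in \<open>y\<close>, \<open>\<rho>'\<close> is
  the weak time derivative of \<open>\<rho>\<close>, and \<open>w\<close>, \<open>v\<close> are the traces of \<open>\<rho>\<close>, \<open>\<psi>\<close> on the boundary of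
  \<open>Y\<close>; by the trace theorem these traces always exist.  As \<open>\<pi>\<close> is only
  square integrable in time, \<open>\<pi>(0)\<close> is the value at 0 of the given representative
  \<open>\<pi> :: real \<Rightarrow> 'x \<Rightarrow> real\<close>.
\<close>

definition weak_solution ::
  "real \<Rightarrow> 'x::euclidean_space set \<Rightarrow> 'y::euclidean_space set \<Rightarrow> 'y set \<Rightarrow>
   real \<Rightarrow> real \<Rightarrow> real \<Rightarrow> real \<Rightarrow> real \<Rightarrow>
   (real \<Rightarrow> real \<Rightarrow> real) \<Rightarrow> (('x \<Rightarrow> 'y \<Rightarrow> real) \<Rightarrow> 'x \<Rightarrow> real) \<Rightarrow> ('x \<Rightarrow> 'y \<Rightarrow> real) \<Rightarrow>
   (real \<Rightarrow> 'x \<Rightarrow> real) \<Rightarrow> (real \<Rightarrow> 'x \<Rightarrow> 'y \<Rightarrow> real) \<Rightarrow> bool" where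
  "weak_solution T \<Omega> Y \<Gamma>\<^sub>R A D R p\<^sub>F \<kappa> f g \<rho>\<^sub>I \<pi> \<rho> \<longleftrightarrow>
     (\<exists>D\<pi> D\<rho> \<rho>' w.
        L2_into (lborel_on {0<..<T}) \<Omega> H10 \<pi> D\<pi> \<and>
        L2_into (lborel_on {0<..<T} \<Otimes>\<^sub>M lborel_on \<Omega>) Y H1
          (\<lambda>(t, x). \<rho> t x) (\<lambda>(t, x). D\<rho> t x) \<and>
        is_trace_L2 (lborel_on {0<..<T} \<Otimes>\<^sub>M lborel_on \<Omega>) Y
          (\<lambda>(t, x). \<rho> t x) (\<lambda>(t, x). D\<rho> t x) (\<lambda>(t, x). w t x) \<and>
        L2 ((lborel_on {0<..<T} \<Otimes>\<^sub>M lborel_on \<Omega>) \<Otimes>\<^sub>M lborel_on Y)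
          (\<lambda>((t, x), y). \<rho>' t x y) \<and>
        weak_time_deriv {0<..<T} (lborel_on \<Omega> \<Otimes>\<^sub>M lborel_on Y)
          (\<lambda>t (x, y). \<rho> t x y) (\<lambda>t (x, y). \<rho>' t x y) \<and>
        (\<forall>\<phi> D\<phi> \<psi> D\<psi> v.
           H10 \<Omega> \<phi> D\<phi> \<and> L2_into (lborel_on \<Omega>) Y H1 \<psi> D\<psi> \<and>
           is_trace_L2 (lborel_on \<Omega>) Y \<psi> D\<psi> v \<longrightarrow>
           (AE t in lborel_on {0<..<T}.
              A * (LINT x|lborel_on \<Omega>. D\<pi> t x \<bullet> D\<phi> x) =
                (LINT x|lborel_on \<Omega>. f (\<pi> t x) (g (\<rho> t) x) * \<phi> x) \<and>
              (LINT x|lborel_on \<Omega>. LINT y|lborel_on Y. \<rho>' t x y * \<psi> x y) +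
                D * (LINT x|lborel_on \<Omega>. LINT y|lborel_on Y. D\<rho> t x y \<bullet> D\<psi> x y) =
                \<kappa> * (LINT x|lborel_on \<Omega>. (LINT y:\<Gamma>\<^sub>R|surface_measure Y.
                        (\<pi> t x + p\<^sub>F - R * w t x y) * v x y))))) \<and>
     has_initial_value T (lborel_on \<Omega> \<Otimes>\<^sub>M lborel_on Y)
       (\<lambda>t (x, y). \<rho> t x y) (\<lambda>(x, y). \<rho>\<^sub>I x y) \<and>
     (\<exists>\<pi>\<^sub>I. elliptic_weak_solution \<Omega> A f (g \<rho>\<^sub>I) \<pi>\<^sub>I \<and> (AE x in lborel_on \<Omega>. \<pi> 0 x = \<pi>\<^sub>I x))"

end

theory Submission
  imports Defs "HOL-Computational_Algebra.Polynomial"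
begin

text \<open>
  The two equations decouple.  Since \<open>f(0, s) = 0\<close> and \<open>\<bar>D\<^sub>1f\<bar> \<le> \<theta>\<close>, one has \<open>\<bar>f(r, s)\<bar> \<le> \<theta> \<bar>r\<bar>\<close>.  Testing
  the elliptic equation at time \<open>t\<close> with \<open>\<pi>(t)\<close> and using Poincare's inequality with constant \<open>C\<close> gives
  \<open>A \<parallel>\<nabla>\<pi>\<parallel>\<^sup>2 \<le> \<theta> \<parallel>\<pi>\<parallel>\<^sup>2 \<le> \<theta> C \<parallel>\<nabla>\<pi>\<parallel>\<^sup>2\<close>.  The smallness conditions force \<open>\<theta> C < A\<close>, so that \<open>\<pi> = 0\<close> for every
  weak solution (\<open>elliptic_solution_vanishes\<close>).  Therefore the difference of two solutions
  \<open>\<delta> = \<rho>\<^sub>1 - \<rho>\<^sub>2\<close> solves the linear heat equation with a homogeneous Robin condition, and testing with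
  \<open>\<delta>(t)\<close> gives \<open>\<integral> \<partial>\<^sub>t\<delta> \<delta> = - D \<parallel>\<nabla>\<delta>\<parallel>\<^sup>2 - \<kappa> R \<parallel>\<delta>\<parallel>\<^sup>2 \<le> 0\<close>, the last norm being taken on
  \<open>\<Omega> \<times> \<Gamma>\<^sub>R\<close> (\<open>energy_inequality\<close>).  As \<open>\<delta>(0) = 0\<close>, the norm of \<open>\<delta>(t)\<close> stays 0
  (\<open>dissipative_difference_vanishes\<close>).

  Three steps of this argument use facts about weak formulations.

  The bound on \<open>f\<close> has to be drawn from a bound on a weak derivative.  Testing with a smooth plateau
  in \<open>r\<close> times an approximate identity in \<open>s\<close> shows that a continuous function with a bounded weak
  partial derivative is Lipschitz in this direction (\<open>weak_partial_bound_imp_lipschitz\<close>).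

  The test functions \<open>\<pi>(t)\<close> and \<open>\<delta>(t)\<close> depend on time, but the weak formulation provides for each
  fixed test function its own null set of exceptional times.  The functionals are continuous in
  \<open>L\<^sup>2\<close>, and \<open>L\<^sup>2\<close> of a finite, countably generated measure is separable
  (\<open>L2_countable_dense\<close>); so are the sets of test functions, and a countable union of null sets
  suffices (\<open>AE_uniform_in_test_function\<close>).

  The energy argument needs \<open>\<parallel>\<delta>(t)\<parallel>\<^sup>2 = 2 \<integral>\<^sub>0\<^sup>t \<integral> \<partial>\<^sub>t\<delta> \<delta>\<close>.  The weak time derivative and the continuous
  representative with the prescribed initial value yield \<open>\<delta>(t) = \<integral>\<^sub>0\<^sup>t \<partial>\<^sub>t\<delta>\<close> almost everywhere
  (\<open>weak_time_deriv_imp_integral\<close>), and the square of a primitive is computed by Fubini's theorem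
  (\<open>square_of_primitive\<close>).
\<close>

section \<open>Smooth step functions\<close>

lemma Ck_Suc_imp_Ck: "Ck (Suc k) \<phi> \<Longrightarrow> Ck k \<phi>"
proof (induction k arbitrary: \<phi>)
  case 0
  then show ?case
    by (auto intro!: differentiable_imp_continuous_on simp: differentiable_on_def
        differentiable_at_withinI)
qed auto

lemma Ck_imp_continuous: "Ck k \<phi> \<Longrightarrow> continuous_on UNIV \<phi>"
  by (induction k) (use Ck_Suc_imp_Ck in auto)

lemma Ck_add:
  fixes \<phi> \<psi> :: "'a::euclidean_space \<Rightarrow> real"
  shows "Ck k \<phi> \<Longrightarrow> Ck k \<psi> \<Longrightarrow> Ck k (\<lambda>x. \<phi> x + \<psi> x)"
proof (induction k arbitrary: \<phi> \<psi>)
  case (Suc k)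
  have "partial (\<lambda>x. \<phi> x + \<psi> x) i = (\<lambda>x. partial \<phi> i x + partial \<psi> i x)" for i
  proof
    fix x
    have "((\<lambda>x. \<phi> x + \<psi> x) has_derivative
        (\<lambda>h. frechet_derivative \<phi> (at x) h + frechet_derivative \<psi> (at x) h)) (at x)"
      using Suc.prems by (intro has_derivative_add) (simp_all flip: frechet_derivative_works)
    from fun_cong[OF frechet_derivative_at[OF this], of i]
    show "partial (\<lambda>x. \<phi> x + \<psi> x) i x = partial \<phi> i x + partial \<psi> i x"
      by simp
  qed
  then show ?case using Suc by simp
qed (simp add: continuous_on_add)

lemma Ck_mult:
  fixes \<phi> \<psi> :: "'a::euclidean_space \<Rightarrow> real"
  shows "Ck k \<phi> \<Longrightarrow> Ck k \<psi> \<Longrightarrow> Ck k (\<lambda>x. \<phi> x * \<psi> x)"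
proof (induction k arbitrary: \<phi> \<psi>)
  case (Suc k)
  have "partial (\<lambda>x. \<phi> x * \<psi> x) i = (\<lambda>x. \<phi> x * partial \<psi> i x + partial \<phi> i x * \<psi> x)" for i
  proof
    fix x
    have "((\<lambda>x. \<phi> x * \<psi> x) has_derivative
        (\<lambda>h. \<phi> x * frechet_derivative \<psi> (at x) h + frechet_derivative \<phi> (at x) h * \<psi> x)) (at x)"
      using Suc.prems by (intro has_derivative_mult) (simp_all flip: frechet_derivative_works)
    from fun_cong[OF frechet_derivative_at[OF this], of i]
    show "partial (\<lambda>x. \<phi> x * \<psi> x) i x = \<phi> x * partial \<psi> i x + partial \<phi> i x * \<psi> x"
      by simp
  qed
  moreover have "Ck k (\<lambda>x. \<phi> x * partial \<psi> i x + partial \<phi> i x * \<psi> x)" if "i \<in> Basis" for i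
    using Suc.prems that Ck_Suc_imp_Ck[OF Suc.prems(1)] Ck_Suc_imp_Ck[OF Suc.prems(2)]
    by (intro Ck_add Suc.IH) auto
  ultimately show ?case using Suc.prems by simp
qed (simp add: continuous_on_mult)

lemma Ck_const: "Ck k (\<lambda>x::'a::euclidean_space. c)"
proof (induction k arbitrary: c)
  case (Suc k)
  have "partial (\<lambda>x::'a. c) i = (\<lambda>x. 0)" for i
    by (simp add: frechet_derivative_const)
  then show ?case using Suc by auto
qed auto

lemma partial_real: "(\<phi> has_real_derivative D) (at x) \<Longrightarrow> partial \<phi> 1 x = D"
  by (metis frechet_derivative_at has_field_derivative_def mult.right_neutral)

text \<open>Stated for a linear form \<open>l\<close> so as to cover translations and dilations of the line as well
  as the coordinate projections of the plane.\<close>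

lemma Ck_affine:
  fixes \<phi> :: "real \<Rightarrow> real" and l :: "'a::euclidean_space \<Rightarrow> real"
  assumes l: "bounded_linear l"
  shows "Ck k \<phi> \<Longrightarrow> Ck k (\<lambda>x. \<phi> (l x + c))"
proof (induction k arbitrary: \<phi>)
  case 0
  have "continuous_on UNIV (\<lambda>x. l x + c)"
    by (intro continuous_on_add continuous_on_const linear_continuous_on l)
  with 0 show ?case
    using continuous_on_compose2[of UNIV \<phi> UNIV "\<lambda>x. l x + c"] by simp
next
  case (Suc k)
  have der: "((\<lambda>x. \<phi> (l x + c)) has_derivative (\<lambda>h. l h * deriv \<phi> (l x + c))) (at x)" for x
  proof -
    have "(\<phi> has_derivative (\<lambda>h. deriv \<phi> (l x + c) * h)) (at (l x + c))"
      using Suc.prems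
      by (simp add: DERIV_deriv_iff_real_differentiable flip: has_field_derivative_def)
    moreover have "((\<lambda>x. l x + c) has_derivative l) (at x)"
      using has_derivative_add[OF bounded_linear_imp_has_derivative[OF l] has_derivative_const] by simp
    ultimately show ?thesis
      using has_derivative_compose[of "\<lambda>x. l x + c" l x UNIV \<phi>] by (simp add: mult.commute)
  qed
  have d: "deriv \<phi> = partial \<phi> 1"
  proof
    fix x show "deriv \<phi> x = partial \<phi> 1 x"
      using Suc.prems partial_real[of \<phi> "deriv \<phi> x" x]
      by (simp add: DERIV_deriv_iff_real_differentiable)
  qed
  have "partial (\<lambda>x. \<phi> (l x + c)) i = (\<lambda>x. l i * deriv \<phi> (l x + c))" for i
  proof
    fix x show "partial (\<lambda>x. \<phi> (l x + c)) i x = l i * deriv \<phi> (l x + c)"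
      using fun_cong[OF frechet_derivative_at[OF der[of x]], of i] by simp
  qed
  moreover have "Ck k (\<lambda>x. l i * deriv \<phi> (l x + c))" for i
    unfolding d using Suc by (intro Ck_mult Ck_const Suc.IH) auto
  moreover have "(\<lambda>x. \<phi> (l x + c)) differentiable (at x)" for x
    using der[of x] by (auto simp: differentiable_def)
  ultimately show ?case by auto
qed

lemma Ck_Suc_real:
  assumes "\<And>x. (\<phi> has_real_derivative \<phi>' x) (at x)" "Ck k \<phi>'"
  shows "Ck (Suc k) \<phi>"
proof -
  have "partial \<phi> 1 = \<phi>'" using assms(1) by (auto intro: partial_real)
  then show ?thesis
    using assms by (auto simp: real_differentiable_def)
qed

text \<open>For every polynomial \<open>P\<close> the function equal to \<open>P (1 / x) exp (-1 / x)\<close> for \<open>x > 0\<close> and to 0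
  elsewhere is smooth, because the derivative is a function of the same form.\<close>

definition flat_exp :: "real poly \<Rightarrow> real \<Rightarrow> real" where
  "flat_exp P x = (if x > 0 then poly P (1 / x) * exp (- (1 / x)) else 0)"

lemma poly_exp_tendsto_0: "((\<lambda>y. poly P y * exp (- y)) \<longlongrightarrow> 0) (at_top :: real filter)"
proof -
  have "((\<lambda>y. \<Sum>i\<le>degree P. coeff P i * (y ^ i / exp y)) \<longlongrightarrow> (\<Sum>i\<le>degree P. coeff P i * 0)) at_top"
    by (intro tendsto_sum tendsto_mult tendsto_const tendsto_power_div_exp_0)
  then show ?thesis
    by (simp add: poly_altdef exp_minus field_simps sum_distrib_right sum_divide_distrib)
qed

lemma flat_exp_deriv:
  "(flat_exp P has_real_derivative flat_exp ([:0, 0, 1:] * (P - pderiv P)) x) (at x)"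
proof -
  consider "x > 0" | "x < 0" | "x = 0" by linarith
  then show ?thesis
  proof cases
    case 1
    have "((\<lambda>x. poly P (1 / x) * exp (- (1 / x))) has_real_derivative
        flat_exp ([:0, 0, 1:] * (P - pderiv P)) x) (at x)"
      using 1 unfolding flat_exp_def
      by (auto intro!: derivative_eq_intros DERIV_chain2[OF poly_DERIV]
          simp: field_simps power2_eq_square)
    then show ?thesis
      by (rule has_field_derivative_transform_within_open[of _ _ _ "{0<..}"])
        (use 1 in \<open>auto simp: flat_exp_def\<close>)
  next
    case 2
    have "((\<lambda>x. 0) has_real_derivative flat_exp ([:0, 0, 1:] * (P - pderiv P)) x) (at x)"
      using 2 by (simp add: flat_exp_def)
    then show ?thesis
      by (rule has_field_derivative_transform_within_open[of _ _ _ "{..<0}"])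
        (use 2 in \<open>auto simp: flat_exp_def\<close>)
  next
    case 3
    have "((\<lambda>h. flat_exp P h / h) \<longlongrightarrow> 0) (at 0)"
    proof (rule filterlim_split_at_real)
      show "((\<lambda>h. flat_exp P h / h) \<longlongrightarrow> 0) (at_left 0)"
        by (rule Lim_transform_eventually[OF tendsto_const])
          (auto simp: flat_exp_def eventually_at_filter)
      have "((\<lambda>h. poly ([:0, 1:] * P) (inverse h) * exp (- inverse h)) \<longlongrightarrow> 0) (at_right (0::real))"
        by (rule filterlim_compose[OF poly_exp_tendsto_0 filterlim_inverse_at_top_right])
      then show "((\<lambda>h. flat_exp P h / h) \<longlongrightarrow> 0) (at_right 0)"
        by (rule Lim_transform_eventually)
          (auto simp: flat_exp_def eventually_at_filter field_simps)
    qed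
    then show ?thesis
      using 3 by (simp add: DERIV_def flat_exp_def)
  qed
qed

lemma Ck_flat_exp: "Ck k (flat_exp P)"
proof (induction k arbitrary: P)
  case 0
  show ?case
    by (auto intro!: DERIV_continuous_on DERIV_subset[OF flat_exp_deriv])
next
  case (Suc k)
  then show ?case using Ck_Suc_real[OF flat_exp_deriv] by blast
qed

text \<open>A smooth step \<open>K\<close> from 0 to 1 and its derivative \<open>k\<close>.  All test functions below are built from
  dilations and translations of \<open>K\<close> and \<open>k\<close>.\<close>

locale smooth_step =
  fixes K k :: "real \<Rightarrow> real"
  assumes smooth_K: "smooth K" and smooth_k: "smooth k"
    and K_deriv: "(K has_real_derivative k x) (at x)"
    and k_nonneg: "k x \<ge> 0"
    and K_0: "x \<le> 0 \<Longrightarrow> K x = 0" and K_1: "x \<ge> 1 \<Longrightarrow> K x = 1"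
    and k_0: "x \<le> 0 \<or> x \<ge> 1 \<Longrightarrow> k x = 0"

text \<open>Normalised antiderivative of the bump \<open>exp (-1 / x) exp (-1 / (1 - x))\<close> on \<open>(0, 1)\<close>.\<close>

lemma smooth_step_exists: "\<exists>K k. smooth_step K k"
proof -
  define b where "b x = flat_exp 1 x * flat_exp 1 ((- 1) * x + 1)" for x
  have Ckb: "Ck n b" for n
    unfolding b_def by (intro Ck_mult Ck_affine Ck_flat_exp bounded_linear_mult_right)
  have "isCont b x" for x
    using Ck_imp_continuous[OF Ckb] by (simp add: continuous_on_eq_continuous_at)
  then obtain B where B: "\<And>x. (B has_real_derivative b x) (at x)"
    using einterval_antiderivative[of "-\<infinity>" \<infinity> b]
    by (auto simp: has_real_derivative_iff_has_vector_derivative)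
  have b0: "b x \<ge> 0" "x \<le> 0 \<or> x \<ge> 1 \<Longrightarrow> b x = 0" "0 < x \<Longrightarrow> x < 1 \<Longrightarrow> b x > 0" for x
    by (auto simp: b_def flat_exp_def)
  have const: "B x = B y" if "x < y" "y \<le> 0 \<or> x \<ge> 1" for x y
  proof -
    obtain z where "z > x" "z < y" "B y - B x = (y - x) * b z"
      using MVT2[OF \<open>x < y\<close>, of B b] B by blast
    then show ?thesis using b0(2)[of z] that by auto
  qed
  define m where "m = B 1 - B 0"
  have m: "m > 0"
  proof -
    obtain z where "z > 0" "z < 1" "B 1 - B 0 = (1 - 0) * b z"
      using MVT2[of 0 1 B b] B by auto
    then show ?thesis using b0(3)[of z] by (auto simp: m_def)
  qed
  define K k where "K x = (B x - B 0) / m" and "k x = b x / m" for x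
  have k: "Ck n k" for n
    unfolding k_def divide_inverse by (intro Ck_mult Ck_const Ckb)
  have Kk: "(K has_real_derivative k x) (at x)" for x
    unfolding K_def k_def using m by (auto intro!: derivative_eq_intros B)
  have "smooth_step K k"
  proof
    show "smooth k" using k by (simp add: smooth_def)
    show "smooth K"
      unfolding smooth_def
    proof
      fix n show "Ck n K" using Ck_Suc_imp_Ck[OF Ck_Suc_real[OF Kk k]] .
    qed
    show "K x = 0" if "x \<le> 0" for x
      using const[of x 0] that by (cases "x = 0") (auto simp: K_def)
    show "K x = 1" if "x \<ge> 1" for x
      using const[of 1 x] that m by (cases "x = 1") (auto simp: K_def m_def)
  qed (use Kk b0 m in \<open>auto simp: k_def\<close>)
  then show ?thesis by blast
qed


section \<open>Continuous functions with integrable or bounded weak derivatives\<close>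

lemma inverse_Suc_less:
  assumes "e > 0" shows "\<forall>\<^sub>F n in sequentially. 1 / real (Suc n) < e"
  using order_tendstoD(2)[OF LIMSEQ_inverse_real_of_nat assms] by (simp add: inverse_eq_divide)

lemma integrable_le:
  fixes f :: "'a \<Rightarrow> 'b::{banach, second_countable_topology}"
  assumes "integrable M w" "f \<in> borel_measurable M" "AE x in M. norm (f x) \<le> w x"
  shows "integrable M f"
  using assms(3) by (intro Bochner_Integration.integrable_bound[OF assms(1,2)]) auto

text \<open>Against probability densities concentrating at \<open>x0\<close> only the values of \<open>C\<close> near \<open>x0\<close> count, and
  these differ arbitrarily little from \<open>C x0\<close>.  Stated for metric spaces because it serves on the
  line and in the plane.\<close>

lemma mollifier_tendsto:
  fixes C :: "'a::metric_space \<Rightarrow> real"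
  assumes [measurable_cong]: "sets M = sets borel"
    and [measurable]: "C \<in> borel_measurable borel" and cont: "isCont C x0"
    and \<kappa>: "\<And>n. integrable M (\<kappa> n)" "\<And>n x. \<kappa> n x \<ge> 0" "\<And>n. integral\<^sup>L M (\<kappa> n) = 1"
    and supp: "\<And>e. e > 0 \<Longrightarrow> \<forall>\<^sub>F n in sequentially. \<forall>x. \<kappa> n x \<noteq> 0 \<longrightarrow> dist x x0 < e"
  shows "(\<lambda>n. LINT x|M. C x * \<kappa> n x) \<longlonglongrightarrow> C x0"
    and "\<forall>\<^sub>F n in sequentially. integrable M (\<lambda>x. C x * \<kappa> n x)"
proof -
  have ev: "\<forall>\<^sub>F n in sequentially. integrable M (\<lambda>x. C x * \<kappa> n x) \<and>
      dist (LINT x|M. C x * \<kappa> n x) (C x0) < e" if e: "e > 0" for e :: real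
  proof -
    from e obtain d where d: "d > 0" "\<And>x. dist x x0 < d \<Longrightarrow> dist (C x) (C x0) < e / 2"
      using cont unfolding continuous_at_eps_delta by (metis half_gt_zero)
    show ?thesis
      using supp[OF d(1)]
    proof eventually_elim
      case (elim n)
      have [measurable]: "\<kappa> n \<in> borel_measurable M" using \<kappa>(1) by auto
      have le: "\<bar>(C x - C x0) * \<kappa> n x\<bar> \<le> e / 2 * \<kappa> n x" for x
      proof (cases "\<kappa> n x = 0")
        case False
        then have "\<bar>C x - C x0\<bar> \<le> e / 2" using d(2)[of x] elim by (auto simp: dist_real_def)
        then show ?thesis
          using mult_right_mono[OF _ \<kappa>(2)[of n x], of "\<bar>C x - C x0\<bar>" "e / 2"] \<kappa>(2)[of n x]
          by (simp add: abs_mult)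
      qed simp
      have int: "integrable M (\<lambda>x. (C x - C x0) * \<kappa> n x)"
        by (rule integrable_le[of M "\<lambda>x. e / 2 * \<kappa> n x"]) (use \<kappa>(1) le in auto)
      have "(LINT x|M. C x * \<kappa> n x) = (LINT x|M. (C x - C x0) * \<kappa> n x + C x0 * \<kappa> n x)"
        by (simp add: algebra_simps)
      also have "\<dots> = (LINT x|M. (C x - C x0) * \<kappa> n x) + C x0"
        using int \<kappa> by simp
      finally have "dist (LINT x|M. C x * \<kappa> n x) (C x0) = \<bar>LINT x|M. (C x - C x0) * \<kappa> n x\<bar>"
        by (simp add: dist_real_def)
      also have "\<dots> \<le> (LINT x|M. \<bar>(C x - C x0) * \<kappa> n x\<bar>)" by (rule integral_abs_bound)
      also have "\<dots> \<le> (LINT x|M. e / 2 * \<kappa> n x)"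
        by (intro integral_mono le integrable_abs int integrable_mult_right \<kappa>)
      also have "\<dots> < e" using \<kappa> e by simp
      finally have "dist (LINT x|M. C x * \<kappa> n x) (C x0) < e" .
      moreover have "integrable M (\<lambda>x. (C x - C x0) * \<kappa> n x + C x0 * \<kappa> n x)"
        using int \<kappa> by simp
      ultimately show ?case by (simp add: algebra_simps)
    qed
  qed
  show "(\<lambda>n. LINT x|M. C x * \<kappa> n x) \<longlonglongrightarrow> C x0"
  proof (rule tendstoI)
    fix e :: real assume "e > 0"
    from ev[OF this] show "\<forall>\<^sub>F n in sequentially. dist (LINT x|M. C x * \<kappa> n x) (C x0) < e"
      by (rule eventually_mono) blast
  qed
  show "\<forall>\<^sub>F n in sequentially. integrable M (\<lambda>x. C x * \<kappa> n x)"
    using ev[OF zero_less_one] by (rule eventually_mono) blast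
qed

context smooth_step
begin

lemma K_smooth: "Ck n K" "Ck n k"
  using smooth_K smooth_k by (auto simp: smooth_def)

lemma K_mono: "x \<le> y \<Longrightarrow> K x \<le> K y"
  by (rule DERIV_nonneg_imp_nondecreasing) (use K_deriv k_nonneg in auto)

lemma K_bounds: "0 \<le> K x" "K x \<le> 1"
proof -
  show "0 \<le> K x" using K_mono[of "min x 0" x] K_0[of "min x 0"] by simp
  show "K x \<le> 1" using K_mono[of x "max x 1"] K_1[of "max x 1"] by simp
qed

lemma K_cont: "continuous_on UNIV K" "continuous_on UNIV k"
  using K_smooth Ck_imp_continuous by blast+

lemma K_measurable [measurable]: "K \<in> borel_measurable borel" "k \<in> borel_measurable borel"
  using K_cont by (auto intro: borel_measurable_continuous_onI)

text \<open>Probability density supported in \<open>[t, t + 1 / (n + 1)]\<close>.\<close>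

definition kern :: "nat \<Rightarrow> real \<Rightarrow> real \<Rightarrow> real" where
  "kern n t s = real (Suc n) * k (real (Suc n) * (s - t))"

lemma kern_measurable [measurable]: "kern n t \<in> borel_measurable borel"
  unfolding kern_def by measurable

lemma kern_nonneg: "kern n t s \<ge> 0"
  by (simp add: kern_def k_nonneg)

lemma kern_nonzero: "kern n t s \<noteq> 0 \<Longrightarrow> t < s \<and> s < t + 1 / real (Suc n)"
proof -
  assume "kern n t s \<noteq> 0"
  then have "0 < real (Suc n) * (s - t)" "real (Suc n) * (s - t) < 1"
    using k_0[of "real (Suc n) * (s - t)"] unfolding kern_def by force+
  then have "0 < s - t" "s - t < 1 / real (Suc n)"
    by (simp_all add: zero_less_mult_iff pos_less_divide_eq mult.commute del: of_nat_Suc)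
  then show ?thesis by simp
qed

lemma kern_integral: "integrable lborel (kern n t)" "integral\<^sup>L lborel (kern n t) = 1"
proof -
  have "has_bochner_integral lborel (\<lambda>x. k x * indicator {0..1} x) (K 1 - K 0)"
    by (rule has_bochner_integral_FTC_Icc_nonneg) (auto simp: k_nonneg K_deriv)
  also have "(\<lambda>x. k x * indicator {0..1} x) = k"
  proof
    fix x show "k x * indicator {0..1} x = k x"
      using k_0[of x] by (cases "x \<in> {0..1}") auto
  qed
  finally have "has_bochner_integral lborel k 1" by (simp add: K_0 K_1)
  then have k1: "integrable lborel k" "integral\<^sup>L lborel k = 1"
    by (auto simp: has_bochner_integral_iff)
  have eq: "kern n t = (\<lambda>s. real (Suc n) * k (- (real (Suc n) * t) + real (Suc n) * s))"
    by (auto simp: kern_def algebra_simps fun_eq_iff)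
  show "integrable lborel (kern n t)"
    unfolding eq using k1(1)
    by (intro integrable_mult_right lborel_integrable_real_affine) auto
  show "integral\<^sup>L lborel (kern n t) = 1"
    using lborel_integral_real_affine[of "real (Suc n)" k "- (real (Suc n) * t)"] k1
    unfolding eq by simp
qed

text \<open>Smooth approximation of the indicator function of \<open>(a, b]\<close>, with derivative
  \<open>kern n a - kern n b\<close>.\<close>

definition plateau :: "nat \<Rightarrow> real \<Rightarrow> real \<Rightarrow> real \<Rightarrow> real" where
  "plateau n a b s = K (real (Suc n) * (s - a)) - K (real (Suc n) * (s - b))"

lemma Ck_dilation: "Ck j \<phi> \<Longrightarrow> Ck j (\<lambda>s. \<phi> (c * (s - a)))" for \<phi> :: "real \<Rightarrow> real"
  using Ck_affine[of "(*) c" j \<phi> "- (c * a)"] by (simp add: bounded_linear_mult_right algebra_simps)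

lemma smooth_kern: "smooth (kern n t)"
  unfolding smooth_def kern_def by (intro allI Ck_mult Ck_const Ck_dilation K_smooth)

lemma smooth_plateau: "smooth (plateau n a b)"
proof -
  have "plateau n a b = (\<lambda>s. K (real (Suc n) * (s - a)) + (- 1) * K (real (Suc n) * (s - b)))"
    by (simp add: plateau_def fun_eq_iff)
  then show ?thesis
    unfolding smooth_def by (simp only:) (intro allI Ck_add Ck_mult Ck_const Ck_dilation K_smooth)
qed

lemma plateau_deriv:
  "(plateau n a b has_real_derivative (kern n a s - kern n b s)) (at s)"
  unfolding plateau_def kern_def
  by (auto intro!: derivative_eq_intros DERIV_chain2[OF K_deriv])

lemma plateau_measurable [measurable]: "plateau n a b \<in> borel_measurable borel"
  unfolding plateau_def by measurable

lemma plateau_bound: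
  assumes "a \<le> b"
  shows "0 \<le> plateau n a b s" "plateau n a b s \<le> 1"
proof -
  have "real (Suc n) * (s - b) \<le> real (Suc n) * (s - a)"
    using assms by (intro mult_left_mono) auto
  from K_mono[OF this] show "0 \<le> plateau n a b s" by (simp add: plateau_def)
  show "plateau n a b s \<le> 1"
    using K_bounds(1)[of "real (Suc n) * (s - b)"] K_bounds(2)[of "real (Suc n) * (s - a)"]
    by (simp add: plateau_def)
qed

lemma plateau_nonzero:
  assumes "plateau n a b s \<noteq> 0" "a \<le> b" shows "a < s \<and> s < b + 1 / real (Suc n)"
proof (rule ccontr)
  assume "\<not> (a < s \<and> s < b + 1 / real (Suc n))"
  then consider "s \<le> a" | "s \<ge> b + 1 / real (Suc n)" by linarith
  then have "plateau n a b s = 0"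
  proof cases
    case 1
    then have "real (Suc n) * (s - a) \<le> 0" "real (Suc n) * (s - b) \<le> 0"
      using assms by (auto intro: mult_nonneg_nonpos)
    then show ?thesis by (simp add: plateau_def K_0)
  next
    case 2
    then have "real (Suc n) * (s - b) \<ge> 1" by (simp add: field_simps)
    moreover have "real (Suc n) * (s - a) \<ge> real (Suc n) * (s - b)"
      using assms by (intro mult_left_mono) auto
    ultimately have "K (real (Suc n) * (s - b)) = 1" "K (real (Suc n) * (s - a)) = 1"
      using K_1[of "real (Suc n) * (s - b)"] K_1[of "real (Suc n) * (s - a)"] order.trans by blast+
    then show ?thesis by (simp add: plateau_def del: of_nat_Suc)
  qed
  then show False using assms by simp
qed

lemma closure_support_subset:
  fixes \<phi> :: "'a::topological_space \<Rightarrow> real"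
  assumes "\<And>x. \<phi> x \<noteq> 0 \<Longrightarrow> x \<in> S" "closed S"
  shows "closure {x. \<phi> x \<noteq> 0} \<subseteq> S"
  using assms by (intro closure_minimal) auto

lemma test_fun_plateau:
  assumes "a \<le> b" "l < a" "b + 1 / real (Suc n) < u"
  shows "test_fun {l<..<u} (plateau n a b)"
proof -
  have sub: "closure {s. plateau n a b s \<noteq> 0} \<subseteq> {a..b + 1 / real (Suc n)}"
    by (rule closure_support_subset) (use plateau_nonzero[OF _ assms(1)] in force)+
  moreover have "compact (closure {s. plateau n a b s \<noteq> 0})"
    using sub compact_Icc by (metis closed_closure compact_Int_closed inf.absorb_iff2)
  ultimately show ?thesis
    using smooth_plateau assms unfolding test_fun_def by force
qed

lemma plateau_limit:
  assumes "a \<le> b"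
  shows "(\<lambda>n. plateau n a b s) \<longlonglongrightarrow> indicator {a<..b} s"
proof -
  have K: "(\<lambda>n. K (real (Suc n) * (s - c))) \<longlonglongrightarrow> indicator {c<..} s" for c
  proof (cases "s \<le> c")
    case True
    then have "K (real (Suc n) * (s - c)) = 0" for n by (intro K_0) (auto intro: mult_nonneg_nonpos)
    then show ?thesis using True by simp
  next
    case False
    then have "\<forall>\<^sub>F n in sequentially. 1 / real (Suc n) < s - c"
      by (intro inverse_Suc_less) simp
    then have "\<forall>\<^sub>F n in sequentially. K (real (Suc n) * (s - c)) = 1"
    proof eventually_elim
      case (elim n)
      then show ?case
        by (intro K_1) (simp add: pos_divide_less_eq mult.commute del: of_nat_Suc)
    qed
    then show ?thesis using False by (simp add: tendsto_eventually)
  qed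
  have "(indicator {a<..b} s :: real) = indicator {a<..} s - indicator {b<..} s"
    using assms by (auto simp: indicator_def)
  then show ?thesis unfolding plateau_def using tendsto_diff[OF K K] by simp
qed

end

text \<open>Test with a plateau over \<open>(a, b]\<close>.  Its derivative yields the difference of the averages of \<open>c\<close>
  near \<open>a\<close> and near \<open>b\<close>, and the plateau itself tends boundedly to the indicator function of
  \<open>(a, b]\<close>.\<close>

lemma weak_derivative_imp_increment:
  fixes c d :: "real \<Rightarrow> real"
  assumes c: "continuous_on {l<..<u} c" and d: "integrable (lborel_on {l<..<u}) d"
    and weak: "\<And>\<eta>. test_fun {l<..<u} \<eta> \<Longrightarrow>
      (LINT t|lborel_on {l<..<u}. c t * deriv \<eta> t) = - (LINT t|lborel_on {l<..<u}. d t * \<eta> t)"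
    and ab: "l < a" "a \<le> b" "b < u"
  shows "c b - c a = (LINT t|lborel_on {l<..<u}. indicator {a<..b} t * d t)"
proof -
  obtain K k where "smooth_step K k" using smooth_step_exists by blast
  then interpret smooth_step K k .
  let ?S = "{l<..<u}"
  \<comment> \<open>extended by 0, so that the kernels can be integrated over the whole line\<close>
  define C where "C t = indicator ?S t * c t" for t
  have C [measurable]: "C \<in> borel_measurable borel"
    using borel_measurable_continuous_on_indicator[OF _ c] by (simp add: C_def[abs_def])
  have contC: "isCont C t" if "t \<in> ?S" for t
  proof -
    have "continuous_on ?S C"
      using c by (rule continuous_on_eq) (simp add: C_def)
    then show ?thesis using that by (simp add: continuous_on_eq_continuous_at)
  qed
  have "(\<lambda>n. LINT t|lborel. C t * kern n s t) \<longlonglongrightarrow> C s \<and>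
      (\<forall>\<^sub>F n in sequentially. integrable lborel (\<lambda>t. C t * kern n s t))" if "s \<in> ?S" for s
  proof -
    have supp: "\<forall>\<^sub>F n in sequentially. \<forall>x. kern n s x \<noteq> 0 \<longrightarrow> dist x s < e" if "e > 0" for e
      using inverse_Suc_less[OF that]
    proof eventually_elim
      case (elim n)
      then show ?case using kern_nonzero[of n s] by (force simp: dist_real_def)
    qed
    show ?thesis
      using mollifier_tendsto[OF _ C contC[OF that] kern_integral(1) kern_nonneg kern_integral(2) supp]
      by simp
  qed
  then have lim: "s \<in> ?S \<Longrightarrow> (\<lambda>n. LINT t|lborel. C t * kern n s t) \<longlonglongrightarrow> C s"
    and ev_int: "s \<in> ?S \<Longrightarrow> \<forall>\<^sub>F n in sequentially. integrable lborel (\<lambda>t. C t * kern n s t)" for s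
    by blast+
  have aS: "a \<in> ?S" and bS: "b \<in> ?S" and ub: "u - b > 0" using ab by auto
  have lhs: "(\<lambda>n. (LINT t|lborel. C t * kern n a t) - (LINT t|lborel. C t * kern n b t)) \<longlonglongrightarrow> C a - C b"
    using ab by (intro tendsto_diff lim) auto
  have eq: "\<forall>\<^sub>F n in sequentially.
      (LINT t|lborel. C t * kern n a t) - (LINT t|lborel. C t * kern n b t) =
      - (LINT t|lborel_on ?S. d t * plateau n a b t)"
    using ev_int[OF aS] ev_int[OF bS] inverse_Suc_less[OF ub]
  proof eventually_elim
    case (elim n)
    have "(LINT t|lborel. C t * kern n a t) - (LINT t|lborel. C t * kern n b t)
        = (LINT t|lborel. C t * (kern n a t - kern n b t))"
      using elim ab by (simp add: algebra_simps)
    also have "\<dots> = (LINT t|lborel_on ?S. c t * deriv (plateau n a b) t)"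
      by (simp add: integral_restrict_space C_def DERIV_imp_deriv[OF plateau_deriv] mult.assoc)
    also have "\<dots> = - (LINT t|lborel_on ?S. d t * plateau n a b t)"
      using elim ab by (intro weak test_fun_plateau) auto
    finally show ?case .
  qed
  have rhs: "(\<lambda>n. LINT t|lborel_on ?S. d t * plateau n a b t)
      \<longlonglongrightarrow> (LINT t|lborel_on ?S. d t * indicator {a<..b} t)"
  proof (rule integral_dominated_convergence[where w = "\<lambda>t. \<bar>d t\<bar>"])
    have [measurable]: "d \<in> borel_measurable (lborel_on ?S)" using d by auto
    have pm [measurable]: "plateau n a b \<in> borel_measurable (lborel_on ?S)" for n
      by (rule measurable_restrict_space1) simp
    show "(\<lambda>t. d t * plateau n a b t) \<in> borel_measurable (lborel_on ?S)" for n by measurable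
    have [measurable]: "indicator {a<..b} \<in> borel_measurable (lborel_on ?S)"
      by (rule measurable_restrict_space1) simp
    show "(\<lambda>t. d t * indicator {a<..b} t) \<in> borel_measurable (lborel_on ?S)" by measurable
    show "AE t in lborel_on ?S. (\<lambda>n. d t * plateau n a b t) \<longlonglongrightarrow> d t * indicator {a<..b} t"
      using ab by (intro AE_I2 tendsto_mult tendsto_const plateau_limit)
    show "AE t in lborel_on ?S. norm (d t * plateau n a b t) \<le> \<bar>d t\<bar>" for n
      using plateau_bound[OF ab(2)] by (auto simp: abs_mult mult_left_le)
  qed (use d in auto)
  have "- (LINT t|lborel_on ?S. d t * indicator {a<..b} t) = C a - C b"
    using LIMSEQ_unique[OF tendsto_minus[OF rhs] lhs[unfolded tendsto_cong[OF eq]]] .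
  then show ?thesis using ab by (simp add: C_def mult.commute)
qed

lemma
  fixes f :: "'a \<Rightarrow> real" and g :: "'b \<Rightarrow> real"
  assumes M: "sigma_finite_measure M" and N: "sigma_finite_measure N"
    and f: "integrable M f" and g: "integrable N g"
  shows integrable_pair_product: "integrable (M \<Otimes>\<^sub>M N) (\<lambda>z. f (fst z) * g (snd z))"
    and integral_pair_product:
      "(LINT z|(M \<Otimes>\<^sub>M N). f (fst z) * g (snd z)) = integral\<^sup>L M f * integral\<^sup>L N g"
proof -
  interpret pair_sigma_finite M N using M N by (simp add: pair_sigma_finite_def)
  have [measurable]: "f \<in> borel_measurable M" "g \<in> borel_measurable N" using f g by auto
  show i: "integrable (M \<Otimes>\<^sub>M N) (\<lambda>z. f (fst z) * g (snd z))"
    using f g by (intro Fubini_integrable) (auto simp: abs_mult)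
  show "(LINT z|(M \<Otimes>\<^sub>M N). f (fst z) * g (snd z)) = integral\<^sup>L M f * integral\<^sup>L N g"
    using integral_fst'[OF i] by simp
qed

lemma AE_abs_le_imp_nonneg:
  assumes "AE z in (lborel :: 'a::euclidean_space measure). \<bar>G z\<bar> \<le> \<theta>"
  shows "\<theta> \<ge> (0 :: real)"
proof -
  have "AE z in (lborel :: 'a measure). 0 \<le> \<theta>" using assms by (auto elim!: eventually_mono)
  moreover have "ae_filter (lborel :: 'a measure) \<noteq> bot"
    by (simp add: ae_filter_eq_bot_iff)
  ultimately show ?thesis by (simp add: eventually_const)
qed

text \<open>Test with a plateau over \<open>(a, b]\<close> in the first variable times a kernel at \<open>s\<close> in the second:
  the partial derivative is a difference of two kernels, concentrated at \<open>(a, s)\<close> and at \<open>(b, s)\<close>,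
  while the mass of the test function tends to \<open>b - a\<close>.\<close>

lemma weak_partial_bound_imp_lipschitz:
  fixes F G :: "real \<times> real \<Rightarrow> real"
  assumes cont: "continuous_on UNIV F" and weak: "weak_partial UNIV F (1, 0) G"
    and bound: "AE z in lborel. \<bar>G z\<bar> \<le> \<theta>" and ab: "a \<le> b"
  shows "\<bar>F (b, s) - F (a, s)\<bar> \<le> \<theta> * (b - a)"
proof -
  obtain K k where "smooth_step K k" using smooth_step_exists by blast
  then interpret smooth_step K k .
  have \<theta>: "\<theta> \<ge> 0" by (rule AE_abs_le_imp_nonneg[OF bound])
  have F [measurable]: "F \<in> borel_measurable borel"
    using cont by (rule borel_measurable_continuous_onI)
  have prod: "integrable lborel (\<lambda>z::real \<times> real. f (fst z) * g (snd z))"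
      "(LINT z|lborel. f (fst z) * g (snd z)) = integral\<^sup>L lborel f * integral\<^sup>L lborel g"
    if "integrable lborel f" "integrable lborel g" for f g :: "real \<Rightarrow> real"
    using that integrable_pair_product[of lborel lborel f g] integral_pair_product[of lborel lborel f g]
    by (simp_all add: lborel_prod lborel.sigma_finite_measure_axioms)
  define \<kappa> where "\<kappa> c n z = kern n c (fst z) * kern n s (snd z)" for c n and z :: "real \<times> real"
  define \<phi> where "\<phi> n z = plateau n a b (fst z) * kern n s (snd z)" for n and z :: "real \<times> real"
  have "(\<lambda>n. LINT z|lborel. F z * \<kappa> c n z) \<longlonglongrightarrow> F (c, s) \<and>
      (\<forall>\<^sub>F n in sequentially. integrable lborel (\<lambda>z. F z * \<kappa> c n z))" for c
  proof -
    have supp: "\<forall>\<^sub>F n in sequentially. \<forall>z. \<kappa> c n z \<noteq> 0 \<longrightarrow> dist z (c, s) < e" if "e > 0" for e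
      using inverse_Suc_less[OF half_gt_zero[OF that]]
    proof eventually_elim
      case (elim n)
      show ?case
      proof (intro allI impI)
        fix z assume "\<kappa> c n z \<noteq> 0"
        then have "kern n c (fst z) \<noteq> 0" "kern n s (snd z) \<noteq> 0" by (auto simp: \<kappa>_def)
        then have "\<bar>fst z - c\<bar> < e / 2" "\<bar>snd z - s\<bar> < e / 2" using kern_nonzero elim by fastforce+
        then have "dist (fst z) c + dist (snd z) s < e" by (simp add: dist_real_def)
        moreover have "dist z (c, s) \<le> dist (fst z) c + dist (snd z) s"
          by (cases z) (auto simp: dist_Pair_Pair sqrt_sum_squares_le_sum)
        ultimately show "dist z (c, s) < e" by linarith
      qed
    qed
    have "isCont F (c, s)" using cont by (simp add: continuous_on_eq_continuous_at)
    moreover have "integrable lborel (\<kappa> c n)" "integral\<^sup>L lborel (\<kappa> c n) = 1" "\<kappa> c n z \<ge> 0" for n z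
      using prod[OF kern_integral(1) kern_integral(1)]
      by (auto simp: \<kappa>_def[abs_def] kern_integral(2) kern_nonneg)
    ultimately show ?thesis
      using mollifier_tendsto[OF _ F, of lborel "(c, s)" "\<kappa> c"] supp by simp
  qed
  then have lim: "(\<lambda>n. LINT z|lborel. F z * \<kappa> c n z) \<longlonglongrightarrow> F (c, s)"
    and int: "\<forall>\<^sub>F n in sequentially. integrable lborel (\<lambda>z. F z * \<kappa> c n z)" for c
    by blast+
  have test: "test_fun UNIV (\<phi> n)" for n
  proof -
    have "smooth (\<phi> n)"
      unfolding smooth_def \<phi>_def
    proof (intro allI Ck_mult)
      fix j
      show "Ck j (\<lambda>z::real \<times> real. plateau n a b (fst z))"
        using Ck_affine[OF bounded_linear_fst, of j "plateau n a b" 0] smooth_plateau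
        by (simp add: smooth_def)
      show "Ck j (\<lambda>z::real \<times> real. kern n s (snd z))"
        using Ck_affine[OF bounded_linear_snd, of j "kern n s" 0] smooth_kern
        by (simp add: smooth_def)
    qed
    moreover have "closure {z. \<phi> n z \<noteq> 0} \<subseteq>
        cbox (a, s) (b + 1 / real (Suc n), s + 1 / real (Suc n))"
    proof (rule closure_support_subset)
      fix z assume "\<phi> n z \<noteq> 0"
      then have "plateau n a b (fst z) \<noteq> 0" "kern n s (snd z) \<noteq> 0" by (auto simp: \<phi>_def)
      from plateau_nonzero[OF this(1) ab] kern_nonzero[OF this(2)]
      show "z \<in> cbox (a, s) (b + 1 / real (Suc n), s + 1 / real (Suc n))"
        by (cases z) (simp add: cbox_Pair_eq)
    qed (rule closed_cbox)
    then have "compact (closure {z. \<phi> n z \<noteq> 0})"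
      using compact_cbox by (metis closed_closure compact_Int_closed inf.absorb_iff2)
    ultimately show ?thesis by (simp add: test_fun_def)
  qed
  have partial_\<phi>: "partial (\<phi> n) (1, 0) z = \<kappa> a n z - \<kappa> b n z" for n z
  proof -
    obtain D where D: "(kern n s has_real_derivative D) (at (snd z))"
      using smooth_kern[of n s] unfolding smooth_def
      by (metis Ck.simps(2) real_differentiable_def)
    have "((\<lambda>z. plateau n a b (fst z)) has_derivative
        (\<lambda>h. (kern n a (fst z) - kern n b (fst z)) * fst h)) (at z)"
      using has_derivative_compose[OF bounded_linear_imp_has_derivative[OF bounded_linear_fst]
          plateau_deriv[of n a b "fst z", unfolded has_field_derivative_def]] by simp
    moreover have "((\<lambda>z. kern n s (snd z)) has_derivative (\<lambda>h. D * snd h)) (at z)"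
      using has_derivative_compose[OF bounded_linear_imp_has_derivative[OF bounded_linear_snd]
          D[unfolded has_field_derivative_def]] by simp
    ultimately have "(\<phi> n has_derivative (\<lambda>h. plateau n a b (fst z) * (D * snd h) +
        (kern n a (fst z) - kern n b (fst z)) * fst h * kern n s (snd z))) (at z)"
      unfolding \<phi>_def by (rule has_derivative_mult)
    from fun_cong[OF frechet_derivative_at[OF this], of "(1, 0)"]
    show ?thesis by (simp add: \<kappa>_def algebra_simps)
  qed
  have \<phi>_int: "integrable lborel (\<phi> n)" "(LINT z|lborel. \<phi> n z) \<le> b - a + 1 / real (Suc n)"
    "\<phi> n z \<ge> 0" for n z
  proof -
    let ?I = "indicator {a..b + 1 / real (Suc n)} :: real \<Rightarrow> real"
    have I: "integrable lborel ?I" "integral\<^sup>L lborel ?I = b - a + 1 / real (Suc n)"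
    proof -
      have "a \<le> b + 1 / real (Suc n)" using ab by (intro add_increasing2) auto
      then show "integrable lborel ?I" "integral\<^sup>L lborel ?I = b - a + 1 / real (Suc n)"
        by (simp_all del: of_nat_Suc)
    qed
    have le: "plateau n a b t \<le> ?I t" for t
      using plateau_bound[OF ab, of n t] plateau_nonzero[OF _ ab, of n t]
      by (cases "plateau n a b t = 0") (auto simp: indicator_def)
    have p: "integrable lborel (plateau n a b)"
      by (rule integrable_le[OF I(1)]) (use le plateau_bound[OF ab] in auto)
    show "integrable lborel (\<phi> n)" "\<phi> n z \<ge> 0"
      using prod(1)[OF p kern_integral(1)] plateau_bound[OF ab] kern_nonneg
      by (auto simp: \<phi>_def[abs_def])
    have "(LINT z|lborel. \<phi> n z) = integral\<^sup>L lborel (plateau n a b)"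
      using prod(2)[OF p kern_integral(1)] by (simp add: \<phi>_def[abs_def] kern_integral(2))
    also have "\<dots> \<le> integral\<^sup>L lborel ?I" by (intro integral_mono p I le)
    finally show "(LINT z|lborel. \<phi> n z) \<le> b - a + 1 / real (Suc n)" using I by simp
  qed
  have G\<phi>: "\<bar>LINT z|lborel. G z * \<phi> n z\<bar> \<le> \<theta> * (b - a + 1 / real (Suc n))" for n
  proof (cases "integrable lborel (\<lambda>z. G z * \<phi> n z)")
    case True
    have "\<bar>LINT z|lborel. G z * \<phi> n z\<bar> \<le> (LINT z|lborel. \<bar>G z * \<phi> n z\<bar>)"
      by (rule integral_abs_bound)
    also have "\<dots> \<le> (LINT z|lborel. \<theta> * \<phi> n z)"
    proof (rule integral_mono_AE)
      show "AE z in lborel. \<bar>G z * \<phi> n z\<bar> \<le> \<theta> * \<phi> n z"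
        using bound by eventually_elim (simp add: abs_mult \<phi>_int(3) mult_right_mono)
    qed (use True \<phi>_int in auto)
    also have "\<dots> \<le> \<theta> * (b - a + 1 / real (Suc n))"
      using \<phi>_int(2)[of n] \<theta> by (simp add: mult_left_mono del: of_nat_Suc)
    finally show ?thesis .
  next
    case False
    then show ?thesis using \<theta> ab by (simp add: not_integrable_integral_eq)
  qed
  have "(\<lambda>n. \<bar>(LINT z|lborel. F z * \<kappa> a n z) - (LINT z|lborel. F z * \<kappa> b n z)\<bar>)
      \<longlonglongrightarrow> \<bar>F (a, s) - F (b, s)\<bar>"
    by (intro tendsto_intros lim)
  moreover have "(\<lambda>n. \<theta> * (b - a + 1 / real (Suc n))) \<longlonglongrightarrow> \<theta> * (b - a + 0)"
    using LIMSEQ_inverse_real_of_nat by (intro tendsto_intros) (simp add: inverse_eq_divide)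
  moreover have "\<forall>\<^sub>F n in sequentially.
      \<bar>(LINT z|lborel. F z * \<kappa> a n z) - (LINT z|lborel. F z * \<kappa> b n z)\<bar> \<le> \<theta> * (b - a + 1 / real (Suc n))"
    using int[of a] int[of b]
  proof eventually_elim
    case (elim n)
    have "(LINT z|lborel. F z * \<kappa> a n z) - (LINT z|lborel. F z * \<kappa> b n z) =
        (LINT z|lborel_on UNIV. F z * partial (\<phi> n) (1, 0) z)"
      using elim by (simp add: partial_\<phi> right_diff_distrib integral_restrict_space)
    also have "\<dots> = - (LINT z|lborel. G z * \<phi> n z)"
      using weak test[of n] by (simp add: weak_partial_def integral_restrict_space)
    finally show ?case using G\<phi>[of n] by simp
  qed
  ultimately have "\<bar>F (a, s) - F (b, s)\<bar> \<le> \<theta> * (b - a + 0)"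
    by (intro tendsto_le[OF _ _ _ , of sequentially]) auto
  then show ?thesis by (simp add: abs_minus_commute)
qed


section \<open>Separability of spaces of square integrable functions\<close>

lemma L2_add:
  assumes "L2 M u" "L2 M v" shows "L2 M (\<lambda>x. u x + v x)"
proof -
  have [measurable]: "u \<in> borel_measurable M" "v \<in> borel_measurable M"
    using assms by (auto simp: L2_def)
  have "(norm (u x + v x))\<^sup>2 \<le> 2 * (norm (u x))\<^sup>2 + 2 * (norm (v x))\<^sup>2" for x
  proof -
    have "(norm (u x + v x))\<^sup>2 \<le> (norm (u x) + norm (v x))\<^sup>2"
      by (intro power_mono norm_triangle_ineq) auto
    also have "\<dots> \<le> 2 * (norm (u x))\<^sup>2 + 2 * (norm (v x))\<^sup>2"
      using zero_le_power2[of "norm (u x) - norm (v x)"] by (simp add: power2_eq_square algebra_simps)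
    finally show ?thesis .
  qed
  then have "integrable M (\<lambda>x. (norm (u x + v x))\<^sup>2)"
    by - (rule integrable_le[of M "\<lambda>x. 2 * (norm (u x))\<^sup>2 + 2 * (norm (v x))\<^sup>2"],
      use assms in \<open>auto simp: L2_def\<close>)
  then show ?thesis by (simp add: L2_def)
qed

lemma L2_scaleR: "L2 M u \<Longrightarrow> L2 M (\<lambda>x. c *\<^sub>R u x)"
  by (auto simp: L2_def power_mult_distrib)

lemma L2_diff: "L2 M u \<Longrightarrow> L2 M v \<Longrightarrow> L2 M (\<lambda>x. u x - v x)"
  using L2_add[of M u "\<lambda>x. (- 1) *\<^sub>R v x"] L2_scaleR[of M v "- 1"] by simp

lemma L2_zero: "L2 M (\<lambda>x. 0)"
  by (simp add: L2_def)

lemma L2_cong: "(\<And>x. x \<in> space M \<Longrightarrow> u x = v x) \<Longrightarrow> L2 M u \<longleftrightarrow> L2 M v"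
  unfolding L2_def by (simp cong: measurable_cong Bochner_Integration.integrable_cong)

lemma L2_bound:
  assumes "L2 M v" "u \<in> borel_measurable M" "AE x in M. norm (u x) \<le> norm (v x)"
  shows "L2 M u"
proof -
  have "integrable M (\<lambda>x. (norm (u x))\<^sup>2)"
  proof (rule integrable_le[of M "\<lambda>x. (norm (v x))\<^sup>2"])
    show "AE x in M. norm ((norm (u x))\<^sup>2) \<le> (norm (v x))\<^sup>2"
      using assms(3) by eventually_elim (simp add: power_mono)
  qed (use assms in \<open>auto simp: L2_def\<close>)
  with assms show ?thesis by (simp add: L2_def)
qed

lemma L2_bounded:
  assumes "finite_measure M" "u \<in> borel_measurable M" "\<And>x. norm (u x) \<le> B"
  shows "L2 M u"
proof -
  interpret finite_measure M by fact
  have "integrable M (\<lambda>x. (norm (u x))\<^sup>2)"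
    using assms by (intro integrable_const_bound[where B = "B\<^sup>2"]) (auto intro!: AE_I2 power_mono)
  with assms show ?thesis by (simp add: L2_def)
qed

lemma L2_inner_integrable:
  assumes "L2 M u" "L2 M v"
  shows "integrable M (\<lambda>x. u x \<bullet> v x)"
proof -
  have [measurable]: "u \<in> borel_measurable M" "v \<in> borel_measurable M"
    using assms by (auto simp: L2_def)
  have "\<bar>u x \<bullet> v x\<bar> \<le> (norm (u x))\<^sup>2 + (norm (v x))\<^sup>2" for x
  proof -
    have "\<bar>u x \<bullet> v x\<bar> \<le> norm (u x) * norm (v x)" by (rule Cauchy_Schwarz_ineq2)
    also have "\<dots> \<le> (norm (u x))\<^sup>2 + (norm (v x))\<^sup>2"
      using sum_squares_bound[of "norm (u x)" "norm (v x)"]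
        mult_nonneg_nonneg[OF norm_ge_zero[of "u x"] norm_ge_zero[of "v x"]] by linarith
    finally show ?thesis .
  qed
  then show ?thesis
    by - (rule integrable_le[of M "\<lambda>x. (norm (u x))\<^sup>2 + (norm (v x))\<^sup>2"],
      use assms in \<open>auto simp: L2_def\<close>)
qed

lemma L2_mult_integrable: "L2 M u \<Longrightarrow> L2 M v \<Longrightarrow> integrable M (\<lambda>x. u x * v x :: real)"
  using L2_inner_integrable[of M u v] by simp

lemma L2_integrable:
  fixes u :: "'a \<Rightarrow> real"
  assumes "finite_measure M" "L2 M u" shows "integrable M u"
  using L2_mult_integrable[OF assms(2) L2_bounded[OF assms(1), of "\<lambda>x. 1" 1]] by simp

abbreviation L2_dist_sq :: "'a measure \<Rightarrow> ('a \<Rightarrow> 'b::euclidean_space) \<Rightarrow> ('a \<Rightarrow> 'b) \<Rightarrow> real" where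
  "L2_dist_sq M u v \<equiv> (LINT x|M. (norm (u x - v x))\<^sup>2)"

lemma L2_dist_sq_triangle:
  assumes "L2 M u" "L2 M v" "L2 M w"
  shows "L2_dist_sq M u w \<le> 2 * L2_dist_sq M u v + 2 * L2_dist_sq M v w"
proof -
  have i: "integrable M (\<lambda>x. (norm (u x - w x))\<^sup>2)" "integrable M (\<lambda>x. (norm (u x - v x))\<^sup>2)"
    "integrable M (\<lambda>x. (norm (v x - w x))\<^sup>2)"
    using L2_diff[OF assms(1,3)] L2_diff[OF assms(1,2)] L2_diff[OF assms(2,3)] by (auto simp: L2_def)
  have "L2_dist_sq M u w \<le> (LINT x|M. 2 * (norm (u x - v x))\<^sup>2 + 2 * (norm (v x - w x))\<^sup>2)"
  proof (rule integral_mono)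
    fix x
    have "norm (u x - w x) \<le> norm (u x - v x) + norm (v x - w x)"
      using norm_triangle_ineq[of "u x - v x" "v x - w x"] by simp
    then have "(norm (u x - w x))\<^sup>2 \<le> (norm (u x - v x) + norm (v x - w x))\<^sup>2"
      by (intro power_mono) auto
    also have "\<dots> \<le> 2 * (norm (u x - v x))\<^sup>2 + 2 * (norm (v x - w x))\<^sup>2"
      using zero_le_power2[of "norm (u x - v x) - norm (v x - w x)"]
      by (simp add: power2_eq_square algebra_simps)
    finally show "(norm (u x - w x))\<^sup>2 \<le> 2 * (norm (u x - v x))\<^sup>2 + 2 * (norm (v x - w x))\<^sup>2" .
  qed (use i in auto)
  then show ?thesis using i by simp
qed

lemma L2_dist_sq_add:
  assumes "L2 M u" "L2 M v" "L2 M u'" "L2 M v'"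
  shows "L2_dist_sq M (\<lambda>x. u x + v x) (\<lambda>x. u' x + v' x)
    \<le> 2 * L2_dist_sq M u u' + 2 * L2_dist_sq M v v'"
proof -
  have "L2_dist_sq M (\<lambda>x. u x + v x) (\<lambda>x. u x + v' x) = L2_dist_sq M v v'"
    "L2_dist_sq M (\<lambda>x. u x + v' x) (\<lambda>x. u' x + v' x) = L2_dist_sq M u u'" by simp_all
  with L2_dist_sq_triangle[of M "\<lambda>x. u x + v x" "\<lambda>x. u x + v' x" "\<lambda>x. u' x + v' x"] assms
  show ?thesis by (simp add: L2_add)
qed

lemma L2_dist_sq_commute: "L2_dist_sq M u v = L2_dist_sq M v u"
  by (simp add: norm_minus_commute)

text \<open>Dynkin's lemma requires a generator that is stable under intersections, and membership of the
  whole space serves its complementation step; both survive restriction and products.\<close>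

definition countably_generated :: "'a measure \<Rightarrow> bool" where
  "countably_generated M \<longleftrightarrow> (\<exists>G. countable G \<and> G \<subseteq> Pow (space M) \<and> Int_stable G \<and>
     space M \<in> G \<and> sets M = sigma_sets (space M) G)"

lemma countably_generated_borel:
  fixes M :: "'a::second_countable_topology measure"
  assumes "sets M = sets borel"
  shows "countably_generated M"
proof -
  have sp: "space M = UNIV" using sets_eq_imp_space_eq[OF assms] by simp
  obtain B :: "'a set set" where B: "countable B" "topological_basis B"
    using ex_countable_basis by blast
  define G where "G = {\<Inter>F |F. finite F \<and> F \<subseteq> B}"
  have "G = Inter ` {F. finite F \<and> F \<subseteq> B}" by (auto simp: G_def)
  then have "countable G" using countable_Collect_finite_subset[OF B(1)] by simp
  moreover have "Int_stable G"
    unfolding Int_stable_def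
  proof (intro ballI)
    fix a b assume "a \<in> G" "b \<in> G"
    then obtain F F' where "a = \<Inter>F" "b = \<Inter>F'" "finite F" "F \<subseteq> B" "finite F'" "F' \<subseteq> B"
      by (auto simp: G_def)
    then have "a \<inter> b = \<Inter>(F \<union> F') \<and> finite (F \<union> F') \<and> F \<union> F' \<subseteq> B" by auto
    then show "a \<inter> b \<in> G" unfolding G_def by blast
  qed
  moreover have "UNIV \<in> G" unfolding G_def by (auto intro!: exI[of _ "{}"])
  moreover have "sets borel = sigma_sets UNIV G"
  proof (rule antisym)
    have "B \<subseteq> G" unfolding G_def by (auto intro!: exI[of _ "{_}"])
    then show "sets borel \<subseteq> sigma_sets UNIV G"
      unfolding borel_eq_countable_basis[OF B] using sigma_sets_mono'[of B G UNIV] by simp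
    have "G \<subseteq> sets borel"
      unfolding G_def using topological_basis_open[OF B(2)]
      by (auto intro!: borel_open open_Inter)
    then show "sigma_sets UNIV G \<subseteq> sets borel"
      using sets.sigma_sets_subset[of G borel] by simp
  qed
  ultimately show ?thesis unfolding countably_generated_def sp assms by blast
qed

lemma countably_generated_restrict_space:
  assumes "countably_generated M" "U \<in> sets M"
  shows "countably_generated (restrict_space M U)"
proof -
  obtain G where G: "countable G" "G \<subseteq> Pow (space M)" "Int_stable G" "space M \<in> G"
    "sets M = sigma_sets (space M) G"
    using assms(1) unfolding countably_generated_def by blast
  have sub: "U \<subseteq> space M" using assms(2) sets.sets_into_space by blast
  let ?G = "(\<inter>) U ` G"
  have "Int_stable ?G"
    unfolding Int_stable_def
  proof (intro ballI)
    fix x y assume "x \<in> ?G" "y \<in> ?G"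
    then obtain a b where "x = U \<inter> a" "y = U \<inter> b" "a \<in> G" "b \<in> G" by blast
    then have "x \<inter> y = U \<inter> (a \<inter> b)" "a \<inter> b \<in> G"
      using G(3) by (auto simp: Int_stable_def)
    then show "x \<inter> y \<in> ?G" by simp
  qed
  moreover have "U \<in> ?G" using G(4) sub by (auto intro!: image_eqI[of _ _ "space M"])
  moreover have "sets (restrict_space M U) = sigma_sets U ?G"
    using sigma_sets_Int[of U "space M" G] assms(2) sub G(5) by (simp add: sets_restrict_space)
  ultimately show ?thesis
    using G(1) assms(2) unfolding countably_generated_def
    by (intro exI[of _ ?G]) (auto simp: space_restrict_space2)
qed

lemma countably_generated_pair:
  assumes "countably_generated M" "countably_generated N"
  shows "countably_generated (M \<Otimes>\<^sub>M N)"
proof -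
  obtain G where G: "countable G" "G \<subseteq> Pow (space M)" "Int_stable G" "space M \<in> G"
    "sets M = sigma_sets (space M) G"
    using assms(1) unfolding countably_generated_def by blast
  obtain H where H: "countable H" "H \<subseteq> Pow (space N)" "Int_stable H" "space N \<in> H"
    "sets N = sigma_sets (space N) H"
    using assms(2) unfolding countably_generated_def by blast
  let ?E = "{a \<times> b |a b. a \<in> G \<and> b \<in> H}"
  have E: "?E = (\<lambda>(a, b). a \<times> b) ` (G \<times> H)" by auto
  have "countable ?E" unfolding E using G(1) H(1) by auto
  moreover have sub: "?E \<subseteq> Pow (space M \<times> space N)" using G(2) H(2) by blast
  moreover have "Int_stable ?E"
    unfolding Int_stable_def
  proof (intro ballI)
    fix x y assume "x \<in> ?E" "y \<in> ?E"
    then obtain a b a' b' where "x = a \<times> b" "y = a' \<times> b'" "a \<in> G" "b \<in> H" "a' \<in> G" "b' \<in> H"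
      by blast
    then have "x \<inter> y = (a \<inter> a') \<times> (b \<inter> b')" "a \<inter> a' \<in> G" "b \<inter> b' \<in> H"
      using G(3) H(3) by (auto simp: Int_stable_def)
    then show "x \<inter> y \<in> ?E" by blast
  qed
  moreover have "space M \<times> space N \<in> ?E" using G(4) H(4) by auto
  moreover have "sets (M \<Otimes>\<^sub>M N) = sigma_sets (space M \<times> space N) ?E"
    using sets_pair_eq[OF G(2,5) _ _ _ H(2,5), of "{space M}" "{space N}"] G(4) H(4) sub
    by simp
  ultimately show ?thesis
    unfolding countably_generated_def space_pair_measure by blast
qed

definition simple_sum :: "('a set \<times> 'b) list \<Rightarrow> 'a \<Rightarrow> 'b::real_vector" where
  "simple_sum l x = (\<Sum>(A, q)\<leftarrow>l. indicator A x *\<^sub>R q)"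

lemma L2_indicator:
  assumes "finite_measure M" "A \<in> sets M" shows "L2 M (\<lambda>x. indicator A x *\<^sub>R q)"
proof (rule L2_bounded[OF assms(1)])
  show "(\<lambda>x. indicator A x *\<^sub>R q) \<in> borel_measurable M" using assms(2) by measurable
  show "norm (indicator A x *\<^sub>R q) \<le> norm q" for x by (simp add: indicator_def)
qed

lemma L2_simple_sum:
  assumes "finite_measure M" "\<And>A q. (A, q) \<in> set l \<Longrightarrow> A \<in> sets M"
  shows "L2 M (simple_sum l)"
  using assms(2)
proof (induction l)
  case Nil
  then show ?case by (simp add: simple_sum_def[abs_def] L2_zero)
next
  case (Cons a l)
  obtain A q where a: "a = (A, q)" by force
  have "L2 M (\<lambda>x. indicator A x *\<^sub>R q)"
    using Cons.prems a by (intro L2_indicator[OF assms(1)]) auto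
  moreover have "L2 M (simple_sum l)" using Cons by auto
  ultimately show ?case using a L2_add by (fastforce simp: simple_sum_def[abs_def])
qed

text \<open>Simple functions over a countable generator with values in a countable dense set are dense:
  approximability passes from the generator to all measurable sets by Dynkin's lemma, and from
  simple functions to their dominated limits.\<close>

lemma L2_countable_dense:
  assumes fin: "finite_measure M" and gen: "countably_generated M"
  shows "\<exists>D :: ('a \<Rightarrow> 'b::euclidean_space) set. countable D \<and> (\<forall>d\<in>D. L2 M d) \<and>
    (\<forall>u e. L2 M u \<longrightarrow> e > 0 \<longrightarrow> (\<exists>d\<in>D. L2_dist_sq M u d < e))"
proof -
  interpret finite_measure M by fact
  obtain G where G: "countable G" "G \<subseteq> Pow (space M)" "Int_stable G" "space M \<in> G"
    "sets M = sigma_sets (space M) G"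
    using gen unfolding countably_generated_def by blast
  have Gs: "G \<subseteq> sets M" unfolding G(5) by auto
  obtain Q :: "'b set" where Q: "countable Q" "\<And>X. open X \<Longrightarrow> X \<noteq> {} \<Longrightarrow> \<exists>d\<in>Q. d \<in> X"
    using countable_dense_setE by blast
  define D where "D = simple_sum ` lists (G \<times> Q)"
  have cD: "countable D" unfolding D_def using G(1) Q(1) by (intro countable_image countable_lists) auto
  have LD: "L2 M d" if "d \<in> D" for d
    using that Gs unfolding D_def by (auto intro!: L2_simple_sum[OF fin] simp: lists_eq_set)
  have D_add: "(\<lambda>x. d x + d' x) \<in> D" if "d \<in> D" "d' \<in> D" for d d'
  proof -
    from that(1) obtain l where l: "d = simple_sum l" "l \<in> lists (G \<times> Q)"
      unfolding D_def by (rule imageE)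
    from that(2) obtain l' where l': "d' = simple_sum l'" "l' \<in> lists (G \<times> Q)"
      unfolding D_def by (rule imageE)
    have "(\<lambda>x. d x + d' x) = simple_sum (l @ l')" by (simp add: l l' simple_sum_def[abs_def])
    then show ?thesis using l l' unfolding D_def by simp
  qed
  \<comment> \<open>the functions that \<open>D\<close> approximates; closed under sums and \<open>L\<^sup>2\<close> limits\<close>
  define W where "W u \<longleftrightarrow> L2 M u \<and> (\<forall>e>0. \<exists>d\<in>D. L2_dist_sq M u d < e)" for u :: "'a \<Rightarrow> 'b"
  have W_cong: "W u \<longleftrightarrow> W v" if "\<And>x. x \<in> space M \<Longrightarrow> u x = v x" for u v
    using that L2_cong[of M u v] unfolding W_def by (simp cong: Bochner_Integration.integral_cong)
  have W_lim: "W u" if u: "L2 M u" and ap: "\<And>e. e > 0 \<Longrightarrow> \<exists>v. W v \<and> L2_dist_sq M u v < e" for u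
    unfolding W_def
  proof (intro conjI allI impI u)
    fix e :: real assume "e > 0"
    then obtain v where v: "W v" "L2_dist_sq M u v < e / 4" using ap[of "e / 4"] by auto
    obtain d where d: "d \<in> D" "L2_dist_sq M v d < e / 4"
      using v(1) \<open>e > 0\<close> unfolding W_def by (meson divide_pos_pos zero_less_numeral)
    have "L2_dist_sq M u d < e"
      using L2_dist_sq_triangle[OF u _ LD[OF d(1)], of v] v d by (simp add: W_def)
    then show "\<exists>d\<in>D. L2_dist_sq M u d < e" using d by blast
  qed
  have W_add: "W (\<lambda>x. u x + v x)" if uv: "W u" "W v" for u v
    unfolding W_def
  proof (intro conjI allI impI)
    show "L2 M (\<lambda>x. u x + v x)" using uv by (simp add: W_def L2_add)
    fix e :: real assume "e > 0"
    then obtain d d' where d: "d \<in> D" "L2_dist_sq M u d < e / 4" "d' \<in> D" "L2_dist_sq M v d' < e / 4"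
      using uv unfolding W_def by (meson divide_pos_pos zero_less_numeral)
    have "L2_dist_sq M (\<lambda>x. u x + v x) (\<lambda>x. d x + d' x) < e"
      using L2_dist_sq_add[of M u v d d'] uv d LD by (simp add: W_def)
    then show "\<exists>d\<in>D. L2_dist_sq M (\<lambda>x. u x + v x) d < e"
      by (rule bexI[OF _ D_add[OF d(1,3)]])
  qed
  have W_0: "W (\<lambda>x. 0)"
  proof -
    have "simple_sum [] \<in> D" unfolding D_def by (rule imageI) simp
    then have "(\<lambda>x. 0) \<in> D" by (simp add: simple_sum_def[abs_def])
    then show ?thesis unfolding W_def using L2_zero by (auto intro!: bexI[of _ "\<lambda>x. 0"])
  qed
  have W_sum: "W (\<lambda>x. \<Sum>i\<in>I. u i x)" if "finite I" "\<And>i. i \<in> I \<Longrightarrow> W (u i)" for I :: "'c set" and u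
    using that by (induction I rule: finite_induct) (auto intro: W_0 W_add)
  have L2_ind: "L2 M (\<lambda>x. indicator A x *\<^sub>R y)" if "A \<in> sets M" for A and y :: 'b
    using that by (rule L2_indicator[OF fin])
  have W_gen: "W (\<lambda>x. indicator A x *\<^sub>R y)" if "A \<in> G" for A and y :: 'b
  proof -
    have A: "A \<in> sets M" using that Gs by blast
    show ?thesis
      unfolding W_def
    proof (intro conjI allI impI L2_ind A)
      fix e :: real assume e: "e > 0"
      define \<delta> where "\<delta> = sqrt (e / (measure M (space M) + 1))"
      have pos: "measure M (space M) + 1 > 0" by (simp add: add_nonneg_pos)
      then have "\<delta> > 0" using e by (simp add: \<delta>_def)
      then obtain q where q: "q \<in> Q" "q \<in> ball y \<delta>" using Q(2)[of "ball y \<delta>"] by auto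
      have "norm (y - q) \<le> \<delta>" using q(2) by (simp add: dist_norm)
      then have "(norm (y - q))\<^sup>2 \<le> \<delta>\<^sup>2" by (intro power_mono) auto
      also have "\<delta>\<^sup>2 = e / (measure M (space M) + 1)" using e pos by (simp add: \<delta>_def)
      finally have yq: "(norm (y - q))\<^sup>2 \<le> e / (measure M (space M) + 1)" .
      have "L2_dist_sq M (\<lambda>x. indicator A x *\<^sub>R y) (simple_sum [(A, q)])
          = (LINT x|M. indicator A x * (norm (y - q))\<^sup>2)"
        by (intro Bochner_Integration.integral_cong) (auto simp: simple_sum_def indicator_def)
      also have "\<dots> = measure M A * (norm (y - q))\<^sup>2" using A by simp
      also have "\<dots> \<le> measure M (space M) * (e / (measure M (space M) + 1))"
        using yq by (intro mult_mono finite_measure_mono) (use A sets.sets_into_space in auto)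
      also have "\<dots> < e" using e pos by (simp add: field_simps)
      finally show "\<exists>d\<in>D. L2_dist_sq M (\<lambda>x. indicator A x *\<^sub>R y) d < e"
        using that q unfolding D_def by (intro bexI[OF _ imageI[of "[(A, q)]"]]) auto
    qed
  qed
  have W_ind: "\<forall>y. W (\<lambda>x. indicator A x *\<^sub>R y)" if "A \<in> sets M" for A
    using G(3,2) that[unfolded G(5)]
  proof (induction rule: sigma_sets_induct_disjoint)
    case (basic A)
    then show ?case by (simp add: W_gen)
  next
    case empty
    then show ?case by (simp add: W_0)
  next
    case (compl A)
    show ?case
    proof
      fix y :: 'b
      have "W (\<lambda>x. indicator (space M) x *\<^sub>R y + indicator A x *\<^sub>R (- y))"
        by (rule W_add[OF W_gen[OF G(4)] compl(2)[rule_format]])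
      then show "W (\<lambda>x. indicator (space M - A) x *\<^sub>R y)"
        by (subst W_cong) (auto simp: indicator_def)
    qed
  next
    case (union A)
    have A: "A i \<in> sets M" for i using union(2) unfolding G(5) by auto
    show ?case
    proof
      fix y :: 'b
      let ?u = "\<lambda>x. indicator (\<Union>i. A i) x *\<^sub>R y"
      let ?v = "\<lambda>n x. \<Sum>i<n. indicator (A i) x *\<^sub>R y"
      have v: "?v n x = indicator (\<Union>i<n. A i) x *\<^sub>R y" for n x
      proof -
        have "(indicator (\<Union>i<n. A i) x :: real) = (\<Sum>i<n. indicator (A i) x)"
          using union(1) by (intro indicator_UN_disjoint) (auto simp: disjoint_family_on_def)
        then show ?thesis by (simp add: scaleR_left.sum)
      qed
      have W: "W (?v n)" for n using union(3) by (intro W_sum) auto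
      have Lu: "L2 M ?u" using A by (intro L2_ind) auto
      have "(\<lambda>n. L2_dist_sq M ?u (?v n)) \<longlonglongrightarrow> (LINT x|M. 0)"
      proof (rule integral_dominated_convergence[where w = "\<lambda>x. (norm y)\<^sup>2"])
        show "(\<lambda>x. (norm (?u x - ?v n x))\<^sup>2) \<in> borel_measurable M" for n
          using A by measurable
        show "AE x in M. (\<lambda>n. (norm (?u x - ?v n x))\<^sup>2) \<longlonglongrightarrow> 0"
        proof (rule AE_I2)
          fix x
          have "\<forall>\<^sub>F n in sequentially. ?u x - ?v n x = 0"
          proof (cases "x \<in> (\<Union>i. A i)")
            case True
            then obtain i where "x \<in> A i" by blast
            then show ?thesis
              unfolding v eventually_sequentially by (intro exI[of _ "Suc i"]) (auto simp: indicator_def)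
          qed (simp add: v)
          then have "\<forall>\<^sub>F n in sequentially. (norm (?u x - ?v n x))\<^sup>2 = 0"
            by eventually_elim simp
          then show "(\<lambda>n. (norm (?u x - ?v n x))\<^sup>2) \<longlonglongrightarrow> 0"
            by (rule tendsto_eventually)
        qed
        show "AE x in M. norm ((norm (?u x - ?v n x))\<^sup>2) \<le> (norm y)\<^sup>2" for n
          unfolding v by (rule AE_I2) (auto simp: indicator_def)
      qed auto
      then have lim: "(\<lambda>n. L2_dist_sq M ?u (?v n)) \<longlonglongrightarrow> 0" by simp
      show "W ?u"
      proof (rule W_lim[OF Lu])
        fix e :: real assume "e > 0"
        from order_tendstoD(2)[OF lim this] obtain n where "L2_dist_sq M ?u (?v n) < e"
          by (auto simp: eventually_sequentially)
        then show "\<exists>v. W v \<and> L2_dist_sq M ?u v < e" using W by blast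
      qed
    qed
  qed
  have W_all: "W u" if u: "L2 M u" for u
  proof (rule W_lim[OF u])
    fix e :: real assume "e > 0"
    have um: "u \<in> borel_measurable M" using u by (simp add: L2_def)
    obtain F where F: "\<And>i. simple_function M (F i)" "\<And>x. x \<in> space M \<Longrightarrow> (\<lambda>i. F i x) \<longlonglongrightarrow> u x"
      "\<And>i x. x \<in> space M \<Longrightarrow> norm (F i x) \<le> 2 * norm (u x)"
      using borel_measurable_implies_sequence_metric[OF um, of 0] unfolding dist_norm diff_zero by blast
    have Fm: "F i \<in> borel_measurable M" for i using F(1) by (rule borel_measurable_simple_function)
    have WF: "W (F i)" for i
    proof -
      have fin: "finite (F i ` space M)" using F(1)[of i] by (simp add: simple_function_def)
      have "W (\<lambda>x. \<Sum>y\<in>F i ` space M. indicator (F i -` {y} \<inter> space M) x *\<^sub>R y)"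
        using W_ind F(1)[of i] by (intro W_sum fin) (auto simp: simple_function_def)
      moreover have "(\<Sum>y\<in>F i ` space M. indicator (F i -` {y} \<inter> space M) x *\<^sub>R y) = F i x"
        if "x \<in> space M" for x
      proof -
        have "(\<Sum>y\<in>F i ` space M. indicator (F i -` {y} \<inter> space M) x *\<^sub>R y) =
            (\<Sum>y\<in>F i ` space M. if y = F i x then y else 0)"
          using that by (intro sum.cong) (auto simp: indicator_def)
        then show ?thesis using that fin by simp
      qed
      ultimately show ?thesis by (subst W_cong[symmetric]) auto
    qed
    have "(\<lambda>n. L2_dist_sq M u (F n)) \<longlonglongrightarrow> (LINT x|M. 0)"
    proof (rule integral_dominated_convergence[where w = "\<lambda>x. 9 * (norm (u x))\<^sup>2"])
      show "(\<lambda>x. (norm (u x - F n x))\<^sup>2) \<in> borel_measurable M" for n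
        using um Fm by measurable
      show "AE x in M. (\<lambda>n. (norm (u x - F n x))\<^sup>2) \<longlonglongrightarrow> 0"
      proof (rule AE_I2)
        fix x assume "x \<in> space M"
        have "(\<lambda>n. (norm (u x - F n x))\<^sup>2) \<longlonglongrightarrow> (norm (u x - u x))\<^sup>2"
          by (intro tendsto_intros F \<open>x \<in> space M\<close>)
        then show "(\<lambda>n. (norm (u x - F n x))\<^sup>2) \<longlonglongrightarrow> 0" by simp
      qed
      show "AE x in M. norm ((norm (u x - F n x))\<^sup>2) \<le> 9 * (norm (u x))\<^sup>2" for n
      proof (rule AE_I2)
        fix x assume "x \<in> space M"
        then have "norm (u x - F n x) \<le> 3 * norm (u x)"
          using norm_triangle_ineq4[of "u x" "F n x"] F(3)[of x n] by linarith
        then have "(norm (u x - F n x))\<^sup>2 \<le> (3 * norm (u x))\<^sup>2" by (intro power_mono) auto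
        then show "norm ((norm (u x - F n x))\<^sup>2) \<le> 9 * (norm (u x))\<^sup>2"
          by (simp add: power_mult_distrib)
      qed
    qed (use u in \<open>auto simp: L2_def\<close>)
    then have lim: "(\<lambda>n. L2_dist_sq M u (F n)) \<longlonglongrightarrow> 0" by simp
    from order_tendstoD(2)[OF lim \<open>e > 0\<close>] obtain n where "L2_dist_sq M u (F n) < e"
      by (auto simp: eventually_sequentially)
    then show "\<exists>v. W v \<and> L2_dist_sq M u v < e" using WF by blast
  qed
  show ?thesis
    using cD LD W_all unfolding W_def by (intro exI[of _ D]) blast
qed

lemma mult_le_sum_squares: "0 \<le> p \<Longrightarrow> 0 \<le> q \<Longrightarrow> p * q \<le> p\<^sup>2 + q\<^sup>2" for p q :: real
  using sum_squares_bound[of p q] mult_nonneg_nonneg[of p q] by linarith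

text \<open>A substitute for the Cauchy-Schwarz inequality: Young's inequality with weight \<open>\<delta>\<close>.\<close>

lemma inner_integral_bound:
  assumes "L2 M F" "L2 M u" "\<delta> > 0" "(LINT x|M. (norm (u x))\<^sup>2) \<le> \<delta>\<^sup>2"
  shows "\<bar>LINT x|M. F x \<bullet> u x\<bar> \<le> \<delta> * ((LINT x|M. (norm (F x))\<^sup>2) + 1)"
proof -
  have i: "integrable M (\<lambda>x. (norm (F x))\<^sup>2)" "integrable M (\<lambda>x. (norm (u x))\<^sup>2)"
    using assms by (auto simp: L2_def)
  have "\<bar>LINT x|M. F x \<bullet> u x\<bar> \<le> (LINT x|M. \<bar>F x \<bullet> u x\<bar>)"
    by (rule integral_abs_bound)
  also have "\<dots> \<le> (LINT x|M. \<delta> * (norm (F x))\<^sup>2 + inverse \<delta> * (norm (u x))\<^sup>2)"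
  proof (rule integral_mono)
    show "integrable M (\<lambda>x. \<bar>F x \<bullet> u x\<bar>)"
      by (intro integrable_abs L2_inner_integrable assms)
    show "integrable M (\<lambda>x. \<delta> * (norm (F x))\<^sup>2 + inverse \<delta> * (norm (u x))\<^sup>2)"
      using i by auto
    fix x
    have "\<bar>F x \<bullet> u x\<bar> \<le> norm (F x) * norm (u x)" by (rule Cauchy_Schwarz_ineq2)
    also have "\<dots> = (sqrt \<delta> * norm (F x)) * (norm (u x) / sqrt \<delta>)" using assms(3) by simp
    also have "\<dots> \<le> (sqrt \<delta> * norm (F x))\<^sup>2 + (norm (u x) / sqrt \<delta>)\<^sup>2"
      using assms(3) by (intro mult_le_sum_squares) auto
    also have "\<dots> = \<delta> * (norm (F x))\<^sup>2 + inverse \<delta> * (norm (u x))\<^sup>2"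
      using assms(3) by (simp add: power_mult_distrib power_divide field_simps)
    finally show "\<bar>F x \<bullet> u x\<bar> \<le> \<delta> * (norm (F x))\<^sup>2 + inverse \<delta> * (norm (u x))\<^sup>2" .
  qed
  also have "\<dots> = \<delta> * (LINT x|M. (norm (F x))\<^sup>2) + inverse \<delta> * (LINT x|M. (norm (u x))\<^sup>2)"
    using i by simp
  also have "\<dots> \<le> \<delta> * (LINT x|M. (norm (F x))\<^sup>2) + inverse \<delta> * \<delta>\<^sup>2"
    using assms(3,4) by (intro add_left_mono mult_left_mono) auto
  also have "inverse \<delta> * \<delta>\<^sup>2 = \<delta>" using assms(3) by (simp add: power2_eq_square)
  finally show ?thesis by (simp add: algebra_simps)
qed

text \<open>A subset of a separable pseudometric space is separable: choose, for every point of the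
  countable dense set and every \<open>n\<close>, a point of the subset within distance \<open>1 / n\<close> if there is one.\<close>

lemma L2_pair_separable:
  fixes X :: "(('m \<Rightarrow> 'a::euclidean_space) \<times> ('n \<Rightarrow> 'b::euclidean_space)) set"
  assumes M: "finite_measure M" "countably_generated M"
    and N: "finite_measure N" "countably_generated N"
    and X: "\<forall>u v. (u, v) \<in> X \<longrightarrow> L2 M u \<and> L2 N v"
  shows "\<exists>X0. countable X0 \<and> X0 \<subseteq> X \<and> (\<forall>u v e. (u, v) \<in> X \<longrightarrow> e > 0 \<longrightarrow>
    (\<exists>u0 v0. (u0, v0) \<in> X0 \<and> L2_dist_sq M u u0 < e \<and> L2_dist_sq N v v0 < e))"
proof -
  obtain D1 :: "('m \<Rightarrow> 'a) set" where D1: "countable D1" "\<And>d. d \<in> D1 \<Longrightarrow> L2 M d"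
    "\<And>u e. L2 M u \<Longrightarrow> e > 0 \<Longrightarrow> \<exists>d\<in>D1. L2_dist_sq M u d < e"
    using L2_countable_dense[OF M, where 'b = 'a] by blast
  obtain D2 :: "('n \<Rightarrow> 'b) set" where D2: "countable D2" "\<And>d. d \<in> D2 \<Longrightarrow> L2 N d"
    "\<And>u e. L2 N u \<Longrightarrow> e > 0 \<Longrightarrow> \<exists>d\<in>D2. L2_dist_sq N u d < e"
    using L2_countable_dense[OF N, where 'b = 'b] by blast
  define near where "near = (\<lambda>(d, d', n :: nat) (u, v). (u, v) \<in> X \<and>
    L2_dist_sq M u d < 1 / real (Suc n) \<and> L2_dist_sq N v d' < 1 / real (Suc n))"
  define I where "I = {i \<in> D1 \<times> D2 \<times> UNIV. \<exists>x. near i x}"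
  define sel where "sel i = (SOME x. near i x)" for i
  have sel: "near i (sel i)" if "i \<in> I" for i
    using that unfolding I_def sel_def by (auto intro: someI_ex)
  show ?thesis
  proof (intro exI[of _ "sel ` I"] conjI allI impI)
    have "countable (D1 \<times> D2 \<times> (UNIV :: nat set))" using D1(1) D2(1) by auto
    then have "countable I" by (rule countable_subset[rotated]) (auto simp: I_def)
    then show "countable (sel ` I)" by auto
    show "sel ` I \<subseteq> X"
    proof
      fix x assume "x \<in> sel ` I"
      then obtain i where "near i x" using sel by blast
      then show "x \<in> X" by (auto simp: near_def split: prod.splits)
    qed
    fix u v and e :: real
    assume uv: "(u, v) \<in> X" and "e > 0"
    obtain n where n: "1 / real (Suc n) < e / 4"
      using inverse_Suc_less[of "e / 4"] \<open>e > 0\<close> by (auto simp: eventually_sequentially)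
    have pos: "1 / real (Suc n) > 0" by simp
    obtain d where d: "d \<in> D1" "L2_dist_sq M u d < 1 / real (Suc n)"
      using D1(3)[OF _ pos] X[rule_format, OF uv] by blast
    obtain d' where d': "d' \<in> D2" "L2_dist_sq N v d' < 1 / real (Suc n)"
      using D2(3)[OF _ pos] X[rule_format, OF uv] by blast
    have nr: "near (d, d', n) (u, v)" using uv d d' by (simp add: near_def)
    have i: "(d, d', n) \<in> I"
      unfolding I_def using d(1) d'(1) nr by blast
    obtain u0 v0 where s: "sel (d, d', n) = (u0, v0)" by force
    have s': "(u0, v0) \<in> X" "L2_dist_sq M u0 d < 1 / real (Suc n)"
      "L2_dist_sq N v0 d' < 1 / real (Suc n)"
      using sel[OF i] unfolding s by (auto simp: near_def)
    have "L2_dist_sq M u u0 < e"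
      using L2_dist_sq_triangle[of M u d u0] X[rule_format, OF uv] X[rule_format, OF s'(1)] D1(2)[OF d(1)] d(2) s'(2) n
        L2_dist_sq_commute[of M d u0] by linarith
    moreover have "L2_dist_sq N v v0 < e"
      using L2_dist_sq_triangle[of N v d' v0] X[rule_format, OF uv] X[rule_format, OF s'(1)] D2(2)[OF d'(1)] d'(2) s'(3) n
        L2_dist_sq_commute[of N d' v0] by linarith
    moreover have "(u0, v0) \<in> sel ` I" using imageI[OF i, of sel] s by simp
    ultimately show "\<exists>u0 v0. (u0, v0) \<in> sel ` I \<and> L2_dist_sq M u u0 < e \<and> L2_dist_sq N v v0 < e"
      by (intro exI[of _ u0] exI[of _ v0] conjI)
  qed
qed

text \<open>The weak formulation provides, for each test function, a null set of exceptional times.  As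
  the test functions form a separable set and the functionals are continuous, one null set serves
  all test functions, among them those that depend on the time.\<close>

lemma AE_uniform_in_test_function:
  fixes X :: "(('m \<Rightarrow> 'a::euclidean_space) \<times> ('n \<Rightarrow> 'b::euclidean_space)) set"
  assumes M: "finite_measure M" "countably_generated M"
    and N: "finite_measure N" "countably_generated N"
    and X: "\<forall>u v. (u, v) \<in> X \<longrightarrow> L2 M u \<and> L2 N v"
    and F: "AE t in S. L2 M (F t)" and H: "AE t in S. L2 N (H t)"
    and zero: "\<And>u v. (u, v) \<in> X \<Longrightarrow>
      AE t in S. (LINT x|M. F t x \<bullet> u x) + (LINT x|N. H t x \<bullet> v x) = 0"
  shows "AE t in S. \<forall>(u, v)\<in>X. (LINT x|M. F t x \<bullet> u x) + (LINT x|N. H t x \<bullet> v x) = 0"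
proof -
  obtain X0 where X0: "countable X0" "X0 \<subseteq> X" "\<forall>u v e. (u, v) \<in> X \<longrightarrow> e > 0 \<longrightarrow>
      (\<exists>u0 v0. (u0, v0) \<in> X0 \<and> L2_dist_sq M u u0 < e \<and> L2_dist_sq N v v0 < e)"
    using L2_pair_separable[OF M N X] by (elim exE conjE)
  have "AE t in S. \<forall>x\<in>X0. (LINT y|M. F t y \<bullet> fst x y) + (LINT y|N. H t y \<bullet> snd x y) = 0"
    using zero X0(2) by (subst AE_ball_countable[OF X0(1)]) auto
  with F H show ?thesis
  proof eventually_elim
    case (elim t)
    show ?case
    proof safe
      fix u v assume uv: "(u, v) \<in> X"
      let ?L = "(LINT x|M. F t x \<bullet> u x) + (LINT x|N. H t x \<bullet> v x)"
      let ?c = "(LINT x|M. (norm (F t x))\<^sup>2) + (LINT x|N. (norm (H t x))\<^sup>2) + 2"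
      have c: "?c > 0"
        by (intro add_nonneg_pos add_nonneg_nonneg Bochner_Integration.integral_nonneg) auto
      have "\<bar>?L\<bar> \<le> e" if "e > 0" for e
      proof -
        define \<delta> where "\<delta> = e / ?c"
        have \<delta>: "\<delta> > 0" "\<delta>\<^sup>2 > 0" using that c by (simp_all add: \<delta>_def)
        obtain u0 v0 where uv0: "(u0, v0) \<in> X0" "L2_dist_sq M u u0 < \<delta>\<^sup>2" "L2_dist_sq N v v0 < \<delta>\<^sup>2"
          using X0(3)[rule_format, OF uv \<delta>(2)] by blast
        have L: "L2 M u" "L2 M u0" "L2 N v" "L2 N v0" using X[rule_format, OF uv] X[rule_format, of u0 v0] X0(2) uv0(1) by auto
        have "(LINT x|M. F t x \<bullet> u0 x) + (LINT x|N. H t x \<bullet> v0 x) = 0"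
          using elim(3) uv0(1) by force
        then have "?L = (LINT x|M. F t x \<bullet> (u x - u0 x)) + (LINT x|N. H t x \<bullet> (v x - v0 x))"
          using L2_inner_integrable[OF elim(1) L(1)] L2_inner_integrable[OF elim(1) L(2)]
            L2_inner_integrable[OF elim(2) L(3)] L2_inner_integrable[OF elim(2) L(4)]
          by (simp add: inner_diff_right)
        moreover have "\<bar>LINT x|M. F t x \<bullet> (u x - u0 x)\<bar> \<le> \<delta> * ((LINT x|M. (norm (F t x))\<^sup>2) + 1)"
          using uv0(2) by (intro inner_integral_bound elim L2_diff L \<delta>(1)) simp
        moreover have "\<bar>LINT x|N. H t x \<bullet> (v x - v0 x)\<bar> \<le> \<delta> * ((LINT x|N. (norm (H t x))\<^sup>2) + 1)"
          using uv0(3) by (intro inner_integral_bound elim L2_diff L \<delta>(1)) simp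
        ultimately have "\<bar>?L\<bar> \<le> \<delta> * ?c" by (simp add: algebra_simps)
        also have "\<delta> * ?c = e" using c by (simp add: \<delta>_def)
        finally show ?thesis .
      qed
      then show "?L = 0" using field_le_epsilon[of "\<bar>?L\<bar>" 0] by simp
    qed
  qed
qed


section \<open>Sections of functions on product spaces\<close>

lemma L2_section:
  assumes M: "sigma_finite_measure M" and N: "sigma_finite_measure N"
    and h: "L2 (M \<Otimes>\<^sub>M N) h"
  shows "AE a in M. L2 N (\<lambda>x. h (a, x))"
proof -
  interpret pair_sigma_finite M N using M N by (simp add: pair_sigma_finite_def)
  have [measurable]: "h \<in> borel_measurable (M \<Otimes>\<^sub>M N)" using h by (simp add: L2_def)
  have "AE a in M. integrable N (\<lambda>x. (norm (h (a, x)))\<^sup>2)"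
    using h AE_integrable_fst'[of "\<lambda>z. (norm (h z))\<^sup>2"] by (simp add: L2_def)
  then show ?thesis
    using AE_space by eventually_elim (simp add: L2_def)
qed

text \<open>Triples \<open>((t, x), y)\<close> are regrouped as \<open>(t, (x, y))\<close>, so that the functions of \<open>(x, y)\<close> at
  a fixed time appear as sections.\<close>

lemma distr_pair_assoc:
  assumes A: "sigma_finite_measure A" and B: "sigma_finite_measure B" and C: "sigma_finite_measure C"
  shows "(A \<Otimes>\<^sub>M B) \<Otimes>\<^sub>M C =
    distr (A \<Otimes>\<^sub>M (B \<Otimes>\<^sub>M C)) ((A \<Otimes>\<^sub>M B) \<Otimes>\<^sub>M C) (\<lambda>(a, b, c). ((a, b), c))"
proof (rule pair_measure_eqI)
  interpret B: sigma_finite_measure B by fact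
  interpret C: sigma_finite_measure C by fact
  show "sigma_finite_measure (A \<Otimes>\<^sub>M B)" by (rule sigma_finite_pair_measure[OF A B])
  fix X Y assume X [measurable]: "X \<in> sets (A \<Otimes>\<^sub>M B)" and Y [measurable]: "Y \<in> sets C"
  have "emeasure (distr (A \<Otimes>\<^sub>M (B \<Otimes>\<^sub>M C)) ((A \<Otimes>\<^sub>M B) \<Otimes>\<^sub>M C) (\<lambda>(a, b, c). ((a, b), c))) (X \<times> Y)
      = (\<integral>\<^sup>+ z. indicator (X \<times> Y) z \<partial>distr (A \<Otimes>\<^sub>M (B \<Otimes>\<^sub>M C)) ((A \<Otimes>\<^sub>M B) \<Otimes>\<^sub>M C) (\<lambda>(a, b, c). ((a, b), c)))"
    by simp
  also have "\<dots> = (\<integral>\<^sup>+ z. (case z of (a, b, c) \<Rightarrow> indicator (X \<times> Y) ((a, b), c)) \<partial>(A \<Otimes>\<^sub>M (B \<Otimes>\<^sub>M C)))"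
    by (subst nn_integral_distr) (auto intro!: nn_integral_cong)
  also have "\<dots> = (\<integral>\<^sup>+ a. \<integral>\<^sup>+ z. (case z of (b, c) \<Rightarrow> indicator (X \<times> Y) ((a, b), c)) \<partial>(B \<Otimes>\<^sub>M C) \<partial>A)"
    by (subst sigma_finite_measure.nn_integral_fst[OF sigma_finite_pair_measure[OF B C], symmetric]) auto
  also have "\<dots> = (\<integral>\<^sup>+ a. \<integral>\<^sup>+ b. \<integral>\<^sup>+ c. indicator (X \<times> Y) ((a, b), c) \<partial>C \<partial>B \<partial>A)"
    by (intro nn_integral_cong, subst C.nn_integral_fst[symmetric]) auto
  also have "\<dots> = (\<integral>\<^sup>+ a. \<integral>\<^sup>+ b. indicator X (a, b) * emeasure C Y \<partial>B \<partial>A)"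
    by (intro nn_integral_cong) (simp add: indicator_times nn_integral_cmult)
  also have "\<dots> = (\<integral>\<^sup>+ z. indicator X z * emeasure C Y \<partial>(A \<Otimes>\<^sub>M B))"
    by (subst B.nn_integral_fst[symmetric]) auto
  also have "\<dots> = emeasure (A \<Otimes>\<^sub>M B) X * emeasure C Y"
    by (simp add: nn_integral_multc)
  finally show "emeasure (A \<Otimes>\<^sub>M B) X * emeasure C Y = emeasure
      (distr (A \<Otimes>\<^sub>M (B \<Otimes>\<^sub>M C)) ((A \<Otimes>\<^sub>M B) \<Otimes>\<^sub>M C) (\<lambda>(a, b, c). ((a, b), c))) (X \<times> Y)" ..
qed (use C in auto)

lemma L2_pair_assoc:
  assumes A: "sigma_finite_measure A" and B: "sigma_finite_measure B" and C: "sigma_finite_measure C"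
    and h: "L2 ((A \<Otimes>\<^sub>M B) \<Otimes>\<^sub>M C) (\<lambda>((a, b), c). h a b c)"
  shows "L2 (A \<Otimes>\<^sub>M (B \<Otimes>\<^sub>M C)) (\<lambda>(a, b, c). h a b c)"
proof -
  let ?h = "\<lambda>((a, b), c). h a b c" and ?i = "\<lambda>(a, b, c). ((a, b), c)"
  have hm [measurable]: "?h \<in> borel_measurable ((A \<Otimes>\<^sub>M B) \<Otimes>\<^sub>M C)" using h by (simp add: L2_def)
  have i [measurable]: "?i \<in> measurable (A \<Otimes>\<^sub>M (B \<Otimes>\<^sub>M C)) ((A \<Otimes>\<^sub>M B) \<Otimes>\<^sub>M C)" by measurable
  have "integrable (distr (A \<Otimes>\<^sub>M (B \<Otimes>\<^sub>M C)) ((A \<Otimes>\<^sub>M B) \<Otimes>\<^sub>M C) ?i) (\<lambda>z. (norm (?h z))\<^sup>2)"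
    using h distr_pair_assoc[OF A B C] by (simp add: L2_def)
  then have "integrable (A \<Otimes>\<^sub>M (B \<Otimes>\<^sub>M C)) (\<lambda>z. (norm (?h (?i z)))\<^sup>2)"
    by (subst (asm) integrable_distr_eq) auto
  moreover have "(\<lambda>z. ?h (?i z)) \<in> borel_measurable (A \<Otimes>\<^sub>M (B \<Otimes>\<^sub>M C))" by measurable
  ultimately have "L2 (A \<Otimes>\<^sub>M (B \<Otimes>\<^sub>M C)) (\<lambda>z. ?h (?i z))" unfolding L2_def by blast
  moreover have "(\<lambda>z. ?h (?i z)) = (\<lambda>(a, b, c). h a b c)" by auto
  ultimately show ?thesis by (simp only:)
qed

lemma AE_pair_assoc:
  assumes A: "sigma_finite_measure A" and B: "sigma_finite_measure B" and C: "sigma_finite_measure C"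
    and [measurable]: "Measurable.pred ((A \<Otimes>\<^sub>M B) \<Otimes>\<^sub>M C) (\<lambda>((a, b), c). P a b c)"
    and ae: "AE a in A. AE (b, c) in B \<Otimes>\<^sub>M C. P a b c"
  shows "AE ((a, b), c) in (A \<Otimes>\<^sub>M B) \<Otimes>\<^sub>M C. P a b c"
proof -
  interpret pair_sigma_finite A "B \<Otimes>\<^sub>M C"
    using A sigma_finite_pair_measure[OF B C] by (simp add: pair_sigma_finite_def)
  let ?P = "\<lambda>((a, b), c). P a b c" and ?i = "\<lambda>(a, b, c). ((a, b), c)"
  have i [measurable]: "?i \<in> measurable (A \<Otimes>\<^sub>M (B \<Otimes>\<^sub>M C)) ((A \<Otimes>\<^sub>M B) \<Otimes>\<^sub>M C)" by measurable
  have "Measurable.pred (A \<Otimes>\<^sub>M (B \<Otimes>\<^sub>M C)) (\<lambda>z. ?P (?i z))" by measurable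
  then have "AE z in A \<Otimes>\<^sub>M (B \<Otimes>\<^sub>M C). ?P (?i z)"
    using ae by (intro AE_pair_measure) (auto simp: pred_def split_beta)
  then show ?thesis
    by (subst distr_pair_assoc[OF A B C], subst AE_distr_iff) auto
qed


section \<open>Weak time derivatives and the energy of a difference\<close>

abbreviation time_interval :: "real \<Rightarrow> real measure" where
  "time_interval T \<equiv> lborel_on {0<..<T}"

lemma finite_measure_lborel_on:
  assumes "bounded U" "U \<in> sets borel" shows "finite_measure (lborel_on U)"
  using assms emeasure_bounded_finite[OF assms(1)]
  by (intro finite_measureI) (auto simp: emeasure_restrict_space space_restrict_space)

lemma finite_measure_time_interval: "finite_measure (time_interval T)"
  by (rule finite_measure_lborel_on) auto

lemma borel_measurable_time_interval:
  "b \<in> borel_measurable borel \<Longrightarrow> b \<in> borel_measurable (time_interval T)"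
  by (rule measurable_restrict_space1) simp

text \<open>Continuity on the compact support bounds a test function and its derivative.\<close>

lemma deriv_test_fun:
  fixes \<eta> :: "real \<Rightarrow> real"
  assumes "test_fun U \<eta>"
  obtains B where "continuous_on UNIV \<eta>" "continuous_on UNIV (deriv \<eta>)"
    "\<And>t. \<bar>\<eta> t\<bar> \<le> B" "\<And>t. \<bar>deriv \<eta> t\<bar> \<le> B"
proof -
  let ?S = "closure {t. \<eta> t \<noteq> 0}"
  have Ck: "Ck k \<eta>" for k using assms by (simp add: test_fun_def smooth_def)
  have diff: "\<eta> differentiable (at t)" for t using Ck[of 1] by simp
  have "partial \<eta> 1 = deriv \<eta>"
    using diff by (auto simp: fun_eq_iff DERIV_deriv_iff_real_differentiable intro!: partial_real)
  then have c: "continuous_on UNIV \<eta>" "continuous_on UNIV (deriv \<eta>)"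
    using Ck[of 0] Ck[of 1] by auto
  have K: "compact ?S" using assms by (simp add: test_fun_def)
  have \<eta>0: "\<eta> t = 0" if "t \<notin> ?S" for t
    using that closure_subset[of "{t. \<eta> t \<noteq> 0}"] by blast
  have zero: "\<eta> t = 0" "deriv \<eta> t = 0" if t: "t \<notin> ?S" for t
  proof -
    show "\<eta> t = 0" by (rule \<eta>0[OF t])
    have "((\<lambda>_. 0) has_real_derivative 0) (at t)" by simp
    then have "(\<eta> has_real_derivative 0) (at t)"
    proof (rule has_field_derivative_transform_within_open[of _ _ _ "- ?S"])
      show "open (- ?S)" by (intro open_Compl closed_closure)
      show "t \<in> - ?S" using t by blast
      show "0 = \<eta> x" if "x \<in> - ?S" for x using \<eta>0[of x] that by (metis ComplD)
    qed
    then show "deriv \<eta> t = 0" by (rule DERIV_imp_deriv)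
  qed
  have bdd: "\<exists>B. \<forall>t\<in>?S. \<bar>h t\<bar> \<le> B" if "continuous_on UNIV h" for h :: "real \<Rightarrow> real"
  proof -
    have "compact (h ` ?S)" 
      by (rule compact_continuous_image[OF continuous_on_subset[OF that] K]) simp
    then have "bounded (h ` ?S)" by (rule compact_imp_bounded)
    then show ?thesis by (auto simp: bounded_iff)
  qed
  obtain B1 B2 where B: "\<forall>t\<in>?S. \<bar>\<eta> t\<bar> \<le> B1" "\<forall>t\<in>?S. \<bar>deriv \<eta> t\<bar> \<le> B2"
    using bdd[OF c(1)] bdd[OF c(2)] by blast
  show ?thesis
  proof (rule that[OF c, of "max 0 (max B1 B2)"])
    fix t
    show "\<bar>\<eta> t\<bar> \<le> max 0 (max B1 B2)" using B zero[of t] by (cases "t \<in> ?S") force+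
    show "\<bar>deriv \<eta> t\<bar> \<le> max 0 (max B1 B2)" using B zero[of t] by (cases "t \<in> ?S") force+
  qed
qed

lemma L2_mult_bounded:
  fixes u :: "'a \<Rightarrow> real"
  assumes "L2 M u" "b \<in> borel_measurable M" "\<And>x. \<bar>b x\<bar> \<le> B"
  shows "L2 M (\<lambda>x. u x * b x)"
proof (rule L2_bound)
  show "L2 M (\<lambda>x. B *\<^sub>R u x)" using assms(1) by (rule L2_scaleR)
  have [measurable]: "u \<in> borel_measurable M" using assms(1) by (simp add: L2_def)
  show "(\<lambda>x. u x * b x) \<in> borel_measurable M" using assms(2) by measurable
  show "AE x in M. norm (u x * b x) \<le> norm (B *\<^sub>R u x)"
  proof (rule AE_I2)
    fix x
    have "\<bar>u x\<bar> * \<bar>b x\<bar> \<le> \<bar>u x\<bar> * \<bar>B\<bar>"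
      using assms(3)[of x] by (intro mult_left_mono) auto
    then show "norm (u x * b x) \<le> norm (B *\<^sub>R u x)" by (simp add: abs_mult mult.commute)
  qed
qed

lemma L2_AE_cong:
  assumes "L2 M v" "u \<in> borel_measurable M" "AE x in M. u x = v x"
  shows "L2 M u"
  using assms(3) by (intro L2_bound[OF assms(1,2)]) auto

text \<open>The weak time derivative is given point by point in \<open>z\<close>, with a null set depending on the test
  function, whereas the initial value is attained in \<open>L\<^sup>2(M)\<close>.  Integration over a set \<open>B\<close> brings the
  two together: \<open>t \<mapsto> \<integral>\<^sub>B r t\<close>, for the continuous representative \<open>r\<close>, is continuous on \<open>[0, T]\<close>
  and its weak derivative on \<open>(0, T)\<close> is \<open>t \<mapsto> \<integral>\<^sub>B u' t\<close>.  As \<open>B\<close> is arbitrary, the resulting identity of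
  integrals over \<open>B\<close> is an identity of functions.\<close>

lemma weak_time_deriv_imp_integral:
  fixes u u' :: "real \<Rightarrow> 'm \<Rightarrow> real"
  assumes T: "T > 0" and M: "finite_measure M"
    and u: "L2 (time_interval T \<Otimes>\<^sub>M M) (\<lambda>(t, z). u t z)"
    and u': "L2 (time_interval T \<Otimes>\<^sub>M M) (\<lambda>(t, z). u' t z)"
    and deriv: "weak_time_deriv {0<..<T} M u u'"
    and init: "has_initial_value T M u u0"
  shows "AE t in time_interval T. AE z in M.
    u t z = u0 z + (LINT s|time_interval T. indicator {..t} s * u' s z)"
proof -
  let ?S = "time_interval T"
  interpret S: finite_measure ?S by (rule finite_measure_time_interval)
  interpret M: finite_measure M by fact
  interpret pair_sigma_finite ?S M ..
  have fin: "finite_measure (?S \<Otimes>\<^sub>M M)"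
    by (rule finite_measure_pair_measure[OF M S.finite_measure_axioms])
  have [measurable]: "(\<lambda>(t, z). u t z) \<in> borel_measurable (?S \<Otimes>\<^sub>M M)"
    "(\<lambda>(t, z). u' t z) \<in> borel_measurable (?S \<Otimes>\<^sub>M M)"
    using u u' by (simp_all add: L2_def)
  obtain r where r: "\<And>t. t \<in> {0..T} \<Longrightarrow> L2 M (r t)"
    "\<And>s. s \<in> {0..T} \<Longrightarrow> ((\<lambda>t. LINT z|M. (r t z - r s z)\<^sup>2) \<longlongrightarrow> 0) (at s within {0..T})"
    "AE t in ?S. AE z in M. r t z = u t z" "AE z in M. r 0 z = u0 z"
    using init unfolding has_initial_value_def by blast
  have inc: "AE z in M. r t z = r 0 z + (LINT s|?S. indicator {..t} s * u' s z)"
    if t: "0 < t" "t < T" for t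
  proof -
    have int: "integrable (?S \<Otimes>\<^sub>M M) (\<lambda>(s, z). u' s z * b s)"
      if "b \<in> borel_measurable borel" "\<And>s. \<bar>b s\<bar> \<le> C" for b :: "real \<Rightarrow> real" and C
    proof -
      have [measurable]: "b \<in> borel_measurable ?S"
        by (rule borel_measurable_time_interval) fact
      have "L2 (?S \<Otimes>\<^sub>M M) (\<lambda>x. (case x of (s, z) \<Rightarrow> u' s z) * b (fst x))"
        by (rule L2_mult_bounded[OF u', of _ C]) (use that in auto)
      from L2_integrable[OF fin this] show ?thesis by (simp add: split_beta')
    qed
    have int_t: "integrable (?S \<Otimes>\<^sub>M M) (\<lambda>(s, z). indicator {..t} s * u' s z)"
      using int[of "indicator {..t}" 1] by (simp add: mult.commute)
    show ?thesis
    proof (rule M.density_unique_banach)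
      show rt: "integrable M (r t)" by (rule L2_integrable[OF M r(1)]) (use t in auto)
      have r0: "integrable M (r 0)" by (rule L2_integrable[OF M r(1)]) (use T in auto)
      have I: "integrable M (\<lambda>z. LINT s|?S. indicator {..t} s * u' s z)"
        by (rule integrable_snd) (rule int_t)
      show "integrable M (\<lambda>z. r 0 z + (LINT s|?S. indicator {..t} s * u' s z))"
        using r0 I by simp
      fix B assume B [measurable]: "B \<in> sets M"
      define c where "c s = (LINT z|M. indicator B z * r s z)" for s
      define d where "d s = (LINT z|M. indicator B z * u' s z)" for s
      have L2B: "L2 M (indicator B :: _ \<Rightarrow> real)"
        by (rule L2_bounded[OF M, of _ 1]) (auto simp: indicator_def)
      have rB: "integrable M (\<lambda>z. indicator B z * r s z)" if "s \<in> {0..T}" for s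
        using L2_mult_integrable[OF L2B r(1)[OF that]] by simp
      have contc: "continuous_on {0..T} c"
        unfolding continuous_on_def
      proof (intro ballI tendstoI)
        fix s e :: real assume s: "s \<in> {0..T}" and e: "e > 0"
        let ?C = "(LINT z|M. (norm (indicator B z :: real))\<^sup>2) + 1"
        have C: "?C > 0" by (intro add_nonneg_pos Bochner_Integration.integral_nonneg) auto
        have half: "e / (2 * q) * q = e / 2" if "q > 0" for q using that by simp
        define \<delta> where "\<delta> = e / (2 * ?C)"
        have \<delta>: "\<delta> > 0" "\<delta>\<^sup>2 > 0" using e C by (simp_all add: \<delta>_def)
        have "\<forall>\<^sub>F t in at s within {0..T}. t \<in> {0..T}"
          by (simp add: eventually_at_filter)
        with order_tendstoD(2)[OF r(2)[OF s] \<delta>(2)]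
        show "\<forall>\<^sub>F t in at s within {0..T}. dist (c t) (c s) < e"
        proof eventually_elim
          case (elim t)
          have "c t - c s = (LINT z|M. indicator B z \<bullet> (r t z - r s z))"
            using rB[OF elim(2)] rB[OF s] by (simp add: c_def right_diff_distrib)
          moreover have "\<bar>LINT z|M. indicator B z \<bullet> (r t z - r s z)\<bar> \<le> \<delta> * ?C"
            using elim by (intro inner_integral_bound L2B L2_diff r(1) s \<delta>(1)) auto
          moreover have "\<delta> * ?C = e / 2" unfolding \<delta>_def by (rule half[OF C])
          ultimately show ?case using e by (simp add: dist_real_def)
        qed
      qed
      have "c \<in> borel_measurable (restrict_space borel {0<..<T})"
        by (intro borel_measurable_continuous_on_restrict continuous_on_subset[OF contc]) auto
      then have cm: "c \<in> borel_measurable ?S"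
        by (simp cong: measurable_cong_sets sets_restrict_space_cong)
      have intB: "integrable (?S \<Otimes>\<^sub>M M) (\<lambda>(s, z). indicator B z * u' s z * b s)"
        if "b \<in> borel_measurable borel" "\<And>s. \<bar>b s\<bar> \<le> C" for b :: "real \<Rightarrow> real" and C
      proof -
        have [measurable]: "b \<in> borel_measurable ?S"
        by (rule borel_measurable_time_interval) fact
        show ?thesis
          by (rule integrable_le[OF integrable_norm[OF int[OF that]]])
            (auto simp: indicator_def)
      qed
      have d_int: "integrable ?S d"
        unfolding d_def using integrable_fst[OF intB[of "\<lambda>_. 1" 1]] by simp
      have weak: "(LINT s|?S. c s * deriv \<eta> s) = - (LINT s|?S. d s * \<eta> s)"
        if \<eta>: "test_fun {0<..<T} \<eta>" for \<eta>
      proof -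
        obtain C where C: "continuous_on UNIV \<eta>" "continuous_on UNIV (deriv \<eta>)"
          "\<And>t. \<bar>\<eta> t\<bar> \<le> C" "\<And>t. \<bar>deriv \<eta> t\<bar> \<le> C"
          using deriv_test_fun[OF \<eta>] by blast
        have mb: "\<eta> \<in> borel_measurable borel" "deriv \<eta> \<in> borel_measurable borel"
          using C by (auto intro: borel_measurable_continuous_onI)
        note m = mb[THEN borel_measurable_time_interval, of T]
        have uint: "integrable (?S \<Otimes>\<^sub>M M) (\<lambda>(s, z). indicator B z * u s z * deriv \<eta> s)"
        proof -
          note m[measurable]
          have "L2 (?S \<Otimes>\<^sub>M M) (\<lambda>x. (case x of (s, z) \<Rightarrow> u s z) * (indicator B (snd x) * deriv \<eta> (fst x)))"
            by (rule L2_mult_bounded[OF u, of _ C])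
              (use C(4) order.trans[OF abs_ge_zero C(4)] in \<open>auto simp: indicator_def\<close>)
          from L2_integrable[OF fin this] show ?thesis by (simp add: split_beta' mult_ac)
        qed
        have "(LINT s|?S. c s * deriv \<eta> s) = (LINT s|?S. LINT z|M. indicator B z * u s z * deriv \<eta> s)"
        proof (rule integral_cong_AE)
          have ae: "AE s in ?S. c s = (LINT z|M. indicator B z * u s z)"
            using r(3) AE_space
          proof eventually_elim
            case (elim s)
            then have [measurable]: "u s \<in> borel_measurable M" "r s \<in> borel_measurable M"
              using r(1)[of s] by (auto simp: L2_def space_restrict_space)
            show ?case
              unfolding c_def using elim(1) by (intro integral_cong_AE) (auto elim!: eventually_mono)
          qed
          show "(\<lambda>s. c s * deriv \<eta> s) \<in> borel_measurable ?S"
            using m(2) cm by measurable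
          show "AE s in ?S. c s * deriv \<eta> s = (LINT z|M. indicator B z * u s z * deriv \<eta> s)"
            using ae by eventually_elim simp
          show "(\<lambda>s. LINT z|M. indicator B z * u s z * deriv \<eta> s) \<in> borel_measurable ?S"
            using m(2) by measurable
        qed
        also have "\<dots> = (LINT z|M. LINT s|?S. indicator B z * u s z * deriv \<eta> s)"
          using Fubini_integral[OF uint] by simp
        also have "\<dots> = (LINT z|M. indicator B z * (LINT s|?S. u s z * deriv \<eta> s))"
          by (simp add: mult.assoc)
        also have "\<dots> = (LINT z|M. indicator B z * - (LINT s|?S. u' s z * \<eta> s))"
        proof (rule integral_cong_AE)
          note m[measurable]
          show "(\<lambda>z. indicator B z * (LINT s|?S. u s z * deriv \<eta> s)) \<in> borel_measurable M"
            "(\<lambda>z. indicator B z * - (LINT s|?S. u' s z * \<eta> s)) \<in> borel_measurable M"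
            by measurable
          show "AE z in M. indicator B z * (LINT s|?S. u s z * deriv \<eta> s) =
              indicator B z * - (LINT s|?S. u' s z * \<eta> s)"
            using deriv \<eta> unfolding weak_time_deriv_def by (auto elim!: eventually_mono)
        qed
        also have "\<dots> = - (LINT z|M. LINT s|?S. indicator B z * u' s z * \<eta> s)"
          by (simp add: mult.assoc)
        also have "(LINT z|M. LINT s|?S. indicator B z * u' s z * \<eta> s) =
            (LINT s|?S. LINT z|M. indicator B z * u' s z * \<eta> s)"
          using Fubini_integral[OF intB[OF mb(1) C(3)]] by simp
        also have "\<dots> = (LINT s|?S. d s * \<eta> s)" by (simp add: d_def)
        finally show ?thesis .
      qed
      have "c t - c 0 = (LINT s|?S. indicator {..t} s * d s)"
      proof -
        \<comment> \<open>the weak derivative lives on the open interval; the left end point is reached by continuity\<close>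
        define a where "a n = t / real (Suc n)" for n
        have a: "0 < a n" "a n \<le> t" for n
          using t by (auto simp: a_def field_simps)
        have a_lim: "a \<longlonglongrightarrow> 0"
          using tendsto_mult[OF tendsto_const[of t] LIMSEQ_inverse_real_of_nat]
          by (simp add: a_def[abs_def] divide_inverse)
        have eq: "c t - c (a n) = (LINT s|?S. indicator {a n<..t} s * d s)" for n
          using t a[of n] by (intro weak_derivative_imp_increment[OF _ d_int weak]
              continuous_on_subset[OF contc]) auto
        have "(\<lambda>n. c (a n)) \<longlonglongrightarrow> c 0"
          using contc a_lim by (rule continuous_on_tendsto_compose)
            (use a t in \<open>auto intro!: always_eventually simp: less_imp_le order.trans[of _ t]\<close>)
        then have "(\<lambda>n. c t - c (a n)) \<longlonglongrightarrow> c t - c 0" by (intro tendsto_intros)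
        moreover have "(\<lambda>n. LINT s|?S. indicator {a n<..t} s * d s)
            \<longlonglongrightarrow> (LINT s|?S. indicator {..t} s * d s)"
        proof (rule integral_dominated_convergence[where w = "\<lambda>s. \<bar>d s\<bar>"])
          have [measurable]: "d \<in> borel_measurable ?S" using d_int by auto
          have [measurable]: "indicator A \<in> borel_measurable ?S" if "A \<in> sets borel" for A
            using that by (intro borel_measurable_time_interval) simp
          show "(\<lambda>s. indicator {..t} s * d s) \<in> borel_measurable ?S"
            "\<And>n. (\<lambda>s. indicator {a n<..t} s * d s) \<in> borel_measurable ?S" by measurable
          show "AE s in ?S. (\<lambda>n. indicator {a n<..t} s * d s) \<longlonglongrightarrow> indicator {..t} s * d s"
          proof (rule AE_I2)
            fix s assume "s \<in> space ?S"
            then have "0 < s" by (simp add: space_restrict_space)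
            from order_tendstoD(2)[OF a_lim this]
            have "\<forall>\<^sub>F n in sequentially. indicator {a n<..t} s * d s = indicator {..t} s * d s"
              by eventually_elim (simp add: indicator_def)
            then show "(\<lambda>n. indicator {a n<..t} s * d s) \<longlonglongrightarrow> indicator {..t} s * d s"
              by (rule tendsto_eventually)
          qed
          show "AE s in ?S. norm (indicator {a n<..t} s * d s) \<le> \<bar>d s\<bar>" for n
            by (rule AE_I2) (auto simp: indicator_def)
        qed (use d_int in auto)
        ultimately show ?thesis unfolding eq by (rule LIMSEQ_unique)
      qed
      also have "\<dots> = (LINT s|?S. LINT z|M. indicator B z * u' s z * indicator {..t} s)"
        by (simp add: d_def mult.commute)
      also have "\<dots> = (LINT z|M. LINT s|?S. indicator B z * u' s z * indicator {..t} s)"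
        using Fubini_integral[OF intB[of "indicator {..t}" 1]] by (simp add: indicator_def)
      also have "\<dots> = (LINT z|M. indicator B z * (LINT s|?S. indicator {..t} s * u' s z))"
        by (simp add: mult_ac)
      finally have *: "c t = c 0 + (LINT z|M. indicator B z * (LINT s|?S. indicator {..t} s * u' s z))"
        by simp
      show "set_lebesgue_integral M B (r t) =
          set_lebesgue_integral M B (\<lambda>z. r 0 z + (LINT s|?S. indicator {..t} s * u' s z))"
        using * rB[of 0] T integrable_mult_indicator[OF B I]
        by (simp add: set_lebesgue_integral_def c_def distrib_left)
    qed
  qed
  show ?thesis
    using r(3) AE_space
  proof eventually_elim
    case (elim t)
    then have "0 < t" "t < T" by (auto simp: space_restrict_space)
    from elim(1) inc[OF this] r(4) show ?case by eventually_elim simp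
  qed
qed

lemma integrable_up_to_time:
  fixes k :: "real \<Rightarrow> real"
  assumes k: "integrable (time_interval T) k"
  shows "integrable (time_interval T) (\<lambda>s. indicator {..t} s * k s)"
proof (rule integrable_le[OF integrable_norm[OF k]])
  have "indicator {..t} \<in> borel_measurable (time_interval T)"
    by (intro borel_measurable_time_interval) simp
  with k show "(\<lambda>s. indicator {..t} s * k s) \<in> borel_measurable (time_interval T)"
    by (intro borel_measurable_times) auto
qed (auto simp: indicator_def)

text \<open>By Fubini the square \<open>[0, t]\<^sup>2\<close> splits along the diagonal into two triangles with equal
  integrals.\<close>

lemma square_of_primitive:
  fixes k :: "real \<Rightarrow> real"
  assumes k: "integrable (time_interval T) k"
  defines "G t \<equiv> (LINT s|time_interval T. indicator {..t} s * k s)"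
  shows "(G t)\<^sup>2 = 2 * (LINT s|time_interval T. indicator {..t} s * (k s * G s))"
proof -
  let ?S = "time_interval T"
  interpret S: finite_measure ?S by (rule finite_measure_time_interval)
  interpret pair_sigma_finite ?S ?S ..
  define h where "h s = indicator {..t} s * k s" for s
  have ind [measurable]: "indicator A \<in> borel_measurable ?S" if "A \<in> sets borel" for A :: "real set"
    using that by (intro borel_measurable_time_interval) simp
  have [measurable]: "k \<in> borel_measurable ?S" using k by auto
  have h: "integrable ?S h"
    unfolding h_def using k by (rule integrable_up_to_time)
  have [measurable]: "h \<in> borel_measurable ?S" using h by auto
  have id [measurable]: "(\<lambda>t. t) \<in> borel_measurable ?S"
    by (rule borel_measurable_time_interval) simp
  have le [measurable]: "Measurable.pred (?S \<Otimes>\<^sub>M ?S) (\<lambda>z. snd z \<le> fst z)"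
  proof -
    have "fst \<in> borel_measurable (?S \<Otimes>\<^sub>M ?S)" "snd \<in> borel_measurable (?S \<Otimes>\<^sub>M ?S)"
      using measurable_compose[OF measurable_fst id] measurable_compose[OF measurable_snd id] by auto
    then show ?thesis by measurable
  qed
  have prod: "integrable (?S \<Otimes>\<^sub>M ?S) (\<lambda>z. h (fst z) * h (snd z))"
    "(LINT z|(?S \<Otimes>\<^sub>M ?S). h (fst z) * h (snd z)) = (G t)\<^sup>2"
    using integrable_pair_product[OF S.sigma_finite_measure_axioms S.sigma_finite_measure_axioms h h]
      integral_pair_product[OF S.sigma_finite_measure_axioms S.sigma_finite_measure_axioms h h]
    by (simp_all add: h_def[abs_def] G_def power2_eq_square)
  let ?lo = "\<lambda>z. of_bool (snd z \<le> fst z) * (h (fst z) * h (snd z))"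
  let ?hi = "\<lambda>z. of_bool (\<not> snd z \<le> fst z) * (h (fst z) * h (snd z))"
  have lo: "integrable (?S \<Otimes>\<^sub>M ?S) ?lo"
    by (rule integrable_le[OF integrable_norm[OF prod(1)]]) auto
  have hi: "integrable (?S \<Otimes>\<^sub>M ?S) ?hi"
    by (rule integrable_le[OF integrable_norm[OF prod(1)]]) auto
  have inner: "h s * (LINT r|?S. of_bool (r \<le> s) * h r) = indicator {..t} s * (k s * G s)" for s
  proof (cases "s \<le> t")
    case True
    then have "(LINT r|?S. of_bool (r \<le> s) * h r) = G s"
      unfolding G_def by (intro Bochner_Integration.integral_cong) (auto simp: h_def indicator_def)
    then show ?thesis by (simp add: h_def)
  qed (simp add: h_def)
  have "(LINT z|(?S \<Otimes>\<^sub>M ?S). ?lo z) = (LINT s|?S. LINT r|?S. h s * (of_bool (r \<le> s) * h r))"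
    using integral_fst'[OF lo] by (simp add: mult_ac)
  then have lo_eq: "(LINT z|(?S \<Otimes>\<^sub>M ?S). ?lo z) = (LINT s|?S. indicator {..t} s * (k s * G s))"
    by (simp add: inner)
  have "(LINT z|(?S \<Otimes>\<^sub>M ?S). ?hi z) = (LINT r|?S. LINT s|?S. h r * (of_bool (\<not> r \<le> s) * h s))"
    using integral_snd[of "\<lambda>s r. ?hi (s, r)"] hi by (simp add: split_beta' mult_ac)
  also have "\<dots> = (LINT r|?S. h r * (LINT s|?S. of_bool (s \<le> r) * h s))"
  proof (rule Bochner_Integration.integral_cong[OF refl])
    fix r
    have "AE s in ?S. s \<noteq> r"
      using AE_lborel_singleton[of r] by (subst AE_restrict_space_iff) (auto elim!: eventually_mono)
    moreover have "(\<lambda>s. of_bool (\<not> r \<le> s) * h s) \<in> borel_measurable ?S"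
      "(\<lambda>s. of_bool (s \<le> r) * h s) \<in> borel_measurable ?S"
      using id by measurable
    ultimately have "(LINT s|?S. of_bool (\<not> r \<le> s) * h s) = (LINT s|?S. of_bool (s \<le> r) * h s)"
      by (intro integral_cong_AE) (auto elim!: eventually_mono)
    then show "(LINT s|?S. h r * (of_bool (\<not> r \<le> s) * h s)) = h r * (LINT s|?S. of_bool (s \<le> r) * h s)"
      by simp
  qed
  finally have hi_eq: "(LINT z|(?S \<Otimes>\<^sub>M ?S). ?hi z) = (LINT s|?S. indicator {..t} s * (k s * G s))"
    by (simp add: inner)
  have "(G t)\<^sup>2 = (LINT z|(?S \<Otimes>\<^sub>M ?S). ?lo z + ?hi z)"
    unfolding prod(2)[symmetric] by (intro Bochner_Integration.integral_cong) auto
  also have "\<dots> = (LINT z|(?S \<Otimes>\<^sub>M ?S). ?lo z) + (LINT z|(?S \<Otimes>\<^sub>M ?S). ?hi z)"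
    using lo hi by (rule Bochner_Integration.integral_add)
  finally show ?thesis by (simp add: lo_eq hi_eq)
qed

lemma primitive_measurable:
  assumes M: "finite_measure M"
    and k: "(\<lambda>(t, z). k t z :: real) \<in> borel_measurable (time_interval T \<Otimes>\<^sub>M M)"
  shows "(\<lambda>(t, z). LINT s|time_interval T. indicator {..t} s * k s z)
    \<in> borel_measurable (time_interval T \<Otimes>\<^sub>M M)"
proof -
  let ?S = "time_interval T"
  interpret S: finite_measure ?S by (rule finite_measure_time_interval)
  have id: "(\<lambda>t. t) \<in> borel_measurable ?S"
    by (rule borel_measurable_time_interval) simp
  have 1 [measurable]: "(\<lambda>x. fst (fst x)) \<in> borel_measurable ((?S \<Otimes>\<^sub>M M) \<Otimes>\<^sub>M ?S)"
    by (rule measurable_compose[OF measurable_compose[OF measurable_fst measurable_fst] id])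
  have 2 [measurable]: "snd \<in> borel_measurable ((?S \<Otimes>\<^sub>M M) \<Otimes>\<^sub>M ?S)"
    by (rule measurable_compose[OF measurable_snd id])
  have "(\<lambda>x. (snd x, snd (fst x))) \<in> measurable ((?S \<Otimes>\<^sub>M M) \<Otimes>\<^sub>M ?S) (?S \<Otimes>\<^sub>M M)" by measurable
  from measurable_compose[OF this k]
  have 3 [measurable]: "(\<lambda>x. k (snd x) (snd (fst x))) \<in> borel_measurable ((?S \<Otimes>\<^sub>M M) \<Otimes>\<^sub>M ?S)"
    by simp
  have "(\<lambda>x. (if snd x \<le> fst (fst x) then 1 else 0) * k (snd x) (snd (fst x)))
      \<in> borel_measurable ((?S \<Otimes>\<^sub>M M) \<Otimes>\<^sub>M ?S)"
    by measurable
  then have "(\<lambda>(x, s). indicator {..fst x} s * k s (snd x)) \<in> borel_measurable ((?S \<Otimes>\<^sub>M M) \<Otimes>\<^sub>M ?S)"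
    by (simp add: split_beta' indicator_def of_bool_def)
  from S.borel_measurable_lebesgue_integral[OF this] show ?thesis
    by (simp add: split_beta')
qed

text \<open>The squared \<open>L\<^sup>2\<close> norm of the primitive \<open>G\<close> of \<open>k\<close> at time \<open>t\<close> is twice the integral of \<open>k G\<close> over
  \<open>(0, t)\<close>, hence not positive.\<close>

lemma dissipative_primitive_vanishes:
  fixes k :: "real \<Rightarrow> 'm \<Rightarrow> real"
  assumes M: "finite_measure M"
    and k: "L2 (time_interval T \<Otimes>\<^sub>M M) (\<lambda>(t, z). k t z)"
    and G: "L2 (time_interval T \<Otimes>\<^sub>M M) (\<lambda>(t, z). G t z)"
    and prim: "\<And>t z. G t z = (LINT s|time_interval T. indicator {..t} s * k s z)"
    and diss: "AE t in time_interval T. (LINT z|M. k t z * G t z) \<le> 0"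
  shows "AE t in time_interval T. AE z in M. G t z = 0"
proof -
  let ?S = "time_interval T"
  interpret S: finite_measure ?S by (rule finite_measure_time_interval)
  interpret M: finite_measure M by fact
  interpret pair_sigma_finite ?S M ..
  have fin: "finite_measure (?S \<Otimes>\<^sub>M M)"
    by (rule finite_measure_pair_measure[OF M S.finite_measure_axioms])
  have kG: "integrable (?S \<Otimes>\<^sub>M M) (\<lambda>(t, z). k t z * G t z)"
    using L2_mult_integrable[OF k G] by (simp add: split_beta')
  have ind [measurable]: "indicator A \<in> borel_measurable ?S" if "A \<in> sets borel" for A :: "real set"
    using that by (intro borel_measurable_time_interval) simp
  have k_int: "AE z in M. integrable ?S (\<lambda>s. k s z)"
    using AE_integrable_snd[of k] L2_integrable[OF fin k] by simp
  have "AE t in ?S. L2 M (\<lambda>z. G t z)"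
    using L2_section[OF S.sigma_finite_measure_axioms M.sigma_finite_measure_axioms G] by simp
  then show ?thesis
  proof eventually_elim
    case (elim t)
    have kGt: "integrable (?S \<Otimes>\<^sub>M M) (\<lambda>(s, z). indicator {..t} s * (k s z * G s z))"
    proof (rule integrable_le[OF integrable_norm[OF kG]])
      have [measurable]: "(\<lambda>x. k (fst x) (snd x) * G (fst x) (snd x)) \<in> borel_measurable (?S \<Otimes>\<^sub>M M)"
        using kG by (auto simp: split_beta' dest: borel_measurable_integrable)
      show "(\<lambda>(s, z). indicator {..t} s * (k s z * G s z)) \<in> borel_measurable (?S \<Otimes>\<^sub>M M)"
        unfolding split_beta' by measurable
    qed (auto simp: indicator_def)
    have "(LINT z|M. (G t z)\<^sup>2) = (LINT z|M. 2 * (LINT s|?S. indicator {..t} s * (k s z * G s z)))"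
    proof (rule integral_cong_AE)
      show "AE z in M. (G t z)\<^sup>2 = 2 * (LINT s|?S. indicator {..t} s * (k s z * G s z))"
        using k_int by eventually_elim (unfold prim, rule square_of_primitive)
      have [measurable]: "G t \<in> borel_measurable M" using elim by (simp add: L2_def)
      show "(\<lambda>z. (G t z)\<^sup>2) \<in> borel_measurable M" by measurable
      show "(\<lambda>z. 2 * (LINT s|?S. indicator {..t} s * (k s z * G s z))) \<in> borel_measurable M"
        using integrable_snd[OF kGt] by auto
    qed
    also have "\<dots> = 2 * (LINT s|?S. indicator {..t} s * (LINT z|M. k s z * G s z))"
      using Fubini_integral[OF kGt] by simp
    also have "(LINT s|?S. indicator {..t} s * (LINT z|M. k s z * G s z)) \<le> 0"
    proof -
      have "0 \<le> (LINT s|?S. indicator {..t} s * - (LINT z|M. k s z * G s z))"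
        using diss by (intro integral_nonneg_AE) (auto elim!: eventually_mono intro: mult_nonneg_nonpos)
      then show ?thesis by simp
    qed
    finally have "(LINT z|M. (G t z)\<^sup>2) \<le> 0" by simp
    moreover have "(LINT z|M. (G t z)\<^sup>2) \<ge> 0" by (intro Bochner_Integration.integral_nonneg) auto
    ultimately have "(LINT z|M. (G t z)\<^sup>2) = 0" by simp
    moreover have "integrable M (\<lambda>z. (G t z)\<^sup>2)" using elim by (simp add: L2_def)
    ultimately have "AE z in M. (G t z)\<^sup>2 = 0"
      by (subst (asm) integral_nonneg_eq_0_iff_AE) auto
    then show ?case by simp
  qed
qed

text \<open>Two functions with the same initial value differ by the primitive of the difference of their
  time derivatives.\<close>

lemma dissipative_difference_vanishes:
  fixes u1 u2 u1' u2' :: "real \<Rightarrow> 'm \<Rightarrow> real"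
  assumes T: "T > 0" and M: "finite_measure M"
    and u1: "L2 (time_interval T \<Otimes>\<^sub>M M) (\<lambda>(t, z). u1 t z)"
      "L2 (time_interval T \<Otimes>\<^sub>M M) (\<lambda>(t, z). u1' t z)"
      "weak_time_deriv {0<..<T} M u1 u1'" "has_initial_value T M u1 u0"
    and u2: "L2 (time_interval T \<Otimes>\<^sub>M M) (\<lambda>(t, z). u2 t z)"
      "L2 (time_interval T \<Otimes>\<^sub>M M) (\<lambda>(t, z). u2' t z)"
      "weak_time_deriv {0<..<T} M u2 u2'" "has_initial_value T M u2 u0"
    and diss: "AE t in time_interval T. (LINT z|M. (u1' t z - u2' t z) * (u1 t z - u2 t z)) \<le> 0"
  shows "AE t in time_interval T. AE z in M. u1 t z = u2 t z"
proof -
  let ?S = "time_interval T"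
  interpret S: finite_measure ?S by (rule finite_measure_time_interval)
  interpret M: finite_measure M by fact
  interpret pair_sigma_finite ?S M ..
  have fin: "finite_measure (?S \<Otimes>\<^sub>M M)"
    by (rule finite_measure_pair_measure[OF M S.finite_measure_axioms])
  define k where "k t z = u1' t z - u2' t z" for t z
  define G where "G t z = (LINT s|?S. indicator {..t} s * k s z)" for t z
  have k: "L2 (?S \<Otimes>\<^sub>M M) (\<lambda>(t, z). k t z)"
    using L2_diff[OF u1(2) u2(2)] by (simp add: k_def split_beta')
  have ind [measurable]: "indicator A \<in> borel_measurable ?S" if "A \<in> sets borel" for A :: "real set"
    using that by (intro borel_measurable_time_interval) simp
  have int: "AE z in M. integrable ?S (\<lambda>s. indicator {..t} s * v s z)"
    if "L2 (?S \<Otimes>\<^sub>M M) (\<lambda>(t, z). v t z)" for v :: "real \<Rightarrow> 'm \<Rightarrow> real" and t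
  proof -
    have "AE z in M. integrable ?S (\<lambda>s. v s z)"
      using AE_integrable_snd[of v] L2_integrable[OF fin that] by simp
    then show ?thesis
      by eventually_elim (rule integrable_up_to_time)
  qed
  have diff: "AE t in ?S. AE z in M. u1 t z - u2 t z = G t z"
    using weak_time_deriv_imp_integral[OF T M u1] weak_time_deriv_imp_integral[OF T M u2]
  proof eventually_elim
    case (elim t)
    from elim int[OF u1(2), of t] int[OF u2(2), of t] show ?case
      by eventually_elim (simp add: G_def k_def right_diff_distrib)
  qed
  have Gm: "(\<lambda>(t, z). G t z) \<in> borel_measurable (?S \<Otimes>\<^sub>M M)"
    unfolding G_def using k by (intro primitive_measurable M) (simp add: L2_def)
  have um: "(\<lambda>(t, z). u1 t z - u2 t z) \<in> borel_measurable (?S \<Otimes>\<^sub>M M)"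
    and uL2: "L2 (?S \<Otimes>\<^sub>M M) (\<lambda>(t, z). u1 t z - u2 t z)"
    using L2_diff[OF u1(1) u2(1)] by (simp_all add: split_beta' L2_def)
  have "AE x in ?S \<Otimes>\<^sub>M M. (case x of (t, z) \<Rightarrow> G t z) = (case x of (t, z) \<Rightarrow> u1 t z - u2 t z)"
  proof (rule AE_pair_measure)
    show "{x \<in> space (?S \<Otimes>\<^sub>M M). (case x of (t, z) \<Rightarrow> G t z) = (case x of (t, z) \<Rightarrow> u1 t z - u2 t z)}
        \<in> sets (?S \<Otimes>\<^sub>M M)"
      by (rule borel_measurable_eq[OF Gm um])
    show "AE t in ?S. AE z in M. (case (t, z) of (t, z) \<Rightarrow> G t z) =
        (case (t, z) of (t, z) \<Rightarrow> u1 t z - u2 t z)"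
      using diff by (auto elim!: eventually_mono)
  qed
  then have G: "L2 (?S \<Otimes>\<^sub>M M) (\<lambda>(t, z). G t z)"
    by (rule L2_AE_cong[OF uL2 Gm])
  have sec: "AE t in ?S. L2 M (\<lambda>z. k t z)" "AE t in ?S. L2 M (\<lambda>z. G t z)"
    "AE t in ?S. L2 M (\<lambda>z. u1 t z - u2 t z)"
    using L2_section[OF S.sigma_finite_measure_axioms M.sigma_finite_measure_axioms] k G uL2
    by (force simp: split_beta')+
  have "AE t in ?S. (LINT z|M. k t z * G t z) \<le> 0"
    using diss diff sec
  proof eventually_elim
    case (elim t)
    have [measurable]: "k t \<in> borel_measurable M" "G t \<in> borel_measurable M"
      "(\<lambda>z. u1 t z - u2 t z) \<in> borel_measurable M"
      using elim by (simp_all add: L2_def)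
    have "(LINT z|M. k t z * G t z) = (LINT z|M. k t z * (u1 t z - u2 t z))"
      using elim(2) by (intro integral_cong_AE) (auto elim!: eventually_mono)
    then show ?case using elim(1) by (simp add: k_def)
  qed
  from dissipative_primitive_vanishes[OF M k G _ this] have "AE t in ?S. AE z in M. G t z = 0"
    by (simp add: G_def)
  with diff show ?thesis
  proof eventually_elim
    case (elim t)
    then show ?case by eventually_elim simp
  qed
qed


section \<open>Finite measures on polytopal domains and sections of Bochner functions\<close>

text \<open>Everything takes place on finite, countably generated measure spaces.  The surface measure is
  finite as there are finitely many facets and the prisms over them are bounded.\<close>

lemma convex_polytopal_domainD:
  assumes "convex_polytopal_domain U"
  shows "finite_measure (lborel_on U)" "countably_generated (lborel_on U)"
    "finite_measure (surface_measure U)" "countably_generated (surface_measure U)"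
proof -
  have U: "open U" "convex U" "polytope (closure U)"
    using assms by (auto simp: convex_polytopal_domain_def)
  have bdd: "bounded (closure U)" using U(3) by (rule polytope_imp_bounded)
  show "finite_measure (lborel_on U)"
    using U(1) bounded_subset[OF bdd closure_subset] by (intro finite_measure_lborel_on) auto
  show "countably_generated (lborel_on U)"
    using U(1) by (intro countably_generated_restrict_space countably_generated_borel) auto
  show "countably_generated (surface_measure U)"
    by (rule countably_generated_borel) simp
  obtain B where B: "\<And>x. x \<in> closure U \<Longrightarrow> norm x \<le> B" using bdd by (auto simp: bounded_iff)
  have "emeasure lborel (prism F UNIV) < \<infinity>" if F: "F facet_of closure U" for F
  proof -
    have "norm z \<le> B + 1" if pz: "z \<in> prism F UNIV" for z
    proof -
      obtain b s where z: "z = b + s *\<^sub>R facet_normal F" "b \<in> F" "0 \<le> s" "s \<le> 1"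
        using pz unfolding prism_def by blast
      have "norm z \<le> norm b + s"
        using norm_triangle_ineq[of b "s *\<^sub>R facet_normal F"] facet_normal(1)[OF F] z by simp
      moreover have "b \<in> closure U" using z(2) facet_of_imp_subset[OF F] by blast
      ultimately show ?thesis using B[of b] z(4) by linarith
    qed
    then have "bounded (prism F UNIV)" by (auto simp: bounded_iff)
    then show ?thesis by (rule emeasure_bounded_finite)
  qed
  moreover have "finite {F. F facet_of closure U}" using U(3) by (rule finite_polytope_facets)
  ultimately have "emeasure (surface_measure U) UNIV < \<infinity>"
    using U(2) by (subst emeasure_surface_measure) (auto simp: less_top)
  then show "finite_measure (surface_measure U)" by (intro finite_measureI) simp
qed

lemma L2_Pair: "L2 M u \<Longrightarrow> L2 M v \<Longrightarrow> L2 M (\<lambda>x. (u x, v x))"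
  unfolding L2_def by (auto simp: norm_Pair)

lemma L2_section_triple:
  assumes A: "sigma_finite_measure A" and B: "sigma_finite_measure B" and C: "sigma_finite_measure C"
    and h: "L2 ((A \<Otimes>\<^sub>M B) \<Otimes>\<^sub>M C) (\<lambda>((a, b), c). h a b c)"
  shows "AE a in A. L2 (B \<Otimes>\<^sub>M C) (\<lambda>(b, c). h a b c)"
  using L2_section[OF A sigma_finite_pair_measure[OF B C] L2_pair_assoc[OF A B C h]]
  by (simp add: split_beta')

lemma L2_into_section:
  assumes A: "sigma_finite_measure A" and B: "sigma_finite_measure B"
    and U: "sigma_finite_measure (lborel_on U)"
    and u: "L2_into (A \<Otimes>\<^sub>M B) U V (\<lambda>(t, x). u t x) (\<lambda>(t, x). Du t x)"
  shows "AE t in A. L2_into B U V (u t) (Du t)"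
proof -
  interpret pair_sigma_finite A B using A B by (simp add: pair_sigma_finite_def)
  have "AE t in A. AE x in B. V U (u t x) (Du t x)"
    using AE_pair[of "\<lambda>a. V U ((\<lambda>(t, x). u t x) a) ((\<lambda>(t, x). Du t x) a)"] u
    by (simp add: L2_into_def)
  moreover have "AE t in A. L2 (B \<Otimes>\<^sub>M lborel_on U) (\<lambda>(x, y). u t x y)"
    using u by (intro L2_section_triple A B U) (simp add: L2_into_def split_beta')
  moreover have "AE t in A. L2 (B \<Otimes>\<^sub>M lborel_on U) (\<lambda>(x, y). Du t x y)"
    using u by (intro L2_section_triple A B U) (simp add: L2_into_def split_beta')
  ultimately show ?thesis by eventually_elim (simp add: L2_into_def)
qed

lemma is_trace_L2_section:
  assumes A: "sigma_finite_measure A" and B: "sigma_finite_measure B"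
    and U: "sigma_finite_measure (surface_measure U)"
    and w: "is_trace_L2 (A \<Otimes>\<^sub>M B) U (\<lambda>(t, x). u t x) (\<lambda>(t, x). Du t x) (\<lambda>(t, x). w t x)"
  shows "AE t in A. is_trace_L2 B U (u t) (Du t) (w t)"
proof -
  interpret pair_sigma_finite A B using A B by (simp add: pair_sigma_finite_def)
  have "AE t in A. AE x in B. is_trace U (u t x) (Du t x) (w t x)"
    using AE_pair[of "\<lambda>a. is_trace U ((\<lambda>(t, x). u t x) a) ((\<lambda>(t, x). Du t x) a) ((\<lambda>(t, x). w t x) a)"] w
    by (simp add: is_trace_L2_def)
  moreover have "AE t in A. L2 (B \<Otimes>\<^sub>M surface_measure U) (\<lambda>(x, y). w t x y)"
    using w by (intro L2_section_triple A B U) (simp add: is_trace_L2_def split_beta')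
  ultimately show ?thesis by eventually_elim (simp add: is_trace_L2_def)
qed


section \<open>The elliptic equation\<close>

text \<open>Testing with the solution itself yields
  \<open>A \<parallel>Dp\<parallel>\<^sup>2 \<le> \<theta> \<parallel>p\<parallel>\<^sup>2 \<le> \<theta> C \<parallel>Dp\<parallel>\<^sup>2\<close>, where \<open>\<theta> C \<le> C < A\<close> if \<open>C > 0\<close>, because \<open>\<theta> < 2 C / A < 1\<close>.
  If \<open>C \<le> 0\<close>, Poincare's inequality alone gives \<open>p = 0\<close>.\<close>

lemma elliptic_solution_vanishes:
  fixes U :: "'x::euclidean_space set"
  assumes poincare: "poincare_constant U C" "2 * C / A < 1" and A: "A > 0"
    and \<theta>: "\<theta> < 2 * C / A" "\<theta> \<ge> 0"
    and p: "H10 U p Dp"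
    and eq: "A * (LINT x|lborel_on U. Dp x \<bullet> Dp x) = (LINT x|lborel_on U. q x * p x)"
    and q: "q \<in> borel_measurable (lborel_on U)" "\<And>x. \<bar>q x\<bar> \<le> \<theta> * \<bar>p x\<bar>"
  shows "AE x in lborel_on U. p x = 0"
proof -
  let ?M = "lborel_on U"
  have L: "L2 ?M p" "L2 ?M Dp" using p by (auto simp: H10_def H1_def)
  have p2: "integrable ?M (\<lambda>x. (p x)\<^sup>2)" using L by (simp add: L2_def)
  have q2: "L2 ?M q"
    by (rule L2_bound[OF L2_scaleR[OF L(1), of \<theta>] q(1)]) (use q(2) \<theta>(2) in \<open>auto simp: abs_mult\<close>)
  have Dp0: "(LINT x|?M. (norm (Dp x))\<^sup>2) \<ge> 0" by (intro Bochner_Integration.integral_nonneg) auto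
  have P: "(LINT x|?M. (p x)\<^sup>2) \<le> C * (LINT x|?M. (norm (Dp x))\<^sup>2)"
    using poincare(1) p unfolding poincare_constant_def by blast
  have "A * (LINT x|?M. (norm (Dp x))\<^sup>2) = (LINT x|?M. q x * p x)"
    using eq by (simp add: power2_norm_eq_inner)
  also have "\<dots> \<le> (LINT x|?M. \<theta> * (p x)\<^sup>2)"
  proof (rule integral_mono)
    show "integrable ?M (\<lambda>x. q x * p x)" by (rule L2_mult_integrable[OF q2 L(1)])
    show "integrable ?M (\<lambda>x. \<theta> * (p x)\<^sup>2)" using p2 by simp
    fix x
    have "q x * p x \<le> \<bar>q x\<bar> * \<bar>p x\<bar>" using abs_ge_self[of "q x * p x"] by (simp add: abs_mult)
    also have "\<dots> \<le> (\<theta> * \<bar>p x\<bar>) * \<bar>p x\<bar>" using q(2)[of x] by (intro mult_right_mono) auto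
    finally show "q x * p x \<le> \<theta> * (p x)\<^sup>2" by (simp add: power2_eq_square mult.assoc)
  qed
  also have "\<dots> \<le> \<theta> * (C * (LINT x|?M. (norm (Dp x))\<^sup>2))"
    using P \<theta>(2) by (simp add: mult_left_mono)
  finally have le: "(A - \<theta> * C) * (LINT x|?M. (norm (Dp x))\<^sup>2) \<le> 0" by (simp add: algebra_simps)
  have C: "2 * C < A" using poincare(2) A by (simp add: field_simps)
  have "(LINT x|?M. (p x)\<^sup>2) \<le> 0"
  proof (cases "C \<le> 0")
    case True
    then show ?thesis using P Dp0 by (smt (verit) mult_nonpos_nonneg)
  next
    case False
    have "\<theta> < 1" using \<theta>(1) poincare(2) by linarith
    then have "\<theta> * C \<le> C" using False by (simp add: mult_left_le_one_le \<theta>(2))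
    then have "A - \<theta> * C > 0" using C False by linarith
    then have "(LINT x|?M. (norm (Dp x))\<^sup>2) \<le> 0" using le by (simp add: mult_le_0_iff)
    then show ?thesis using P Dp0 by simp
  qed
  moreover have "(LINT x|?M. (p x)\<^sup>2) \<ge> 0" by (intro Bochner_Integration.integral_nonneg) auto
  ultimately have "AE x in ?M. (p x)\<^sup>2 = 0"
    using integral_nonneg_eq_0_iff_AE[OF p2] by simp
  then show ?thesis by simp
qed


section \<open>The tested weak formulation and uniqueness\<close>

text \<open>A test function \<open>\<psi>\<close> of the parabolic equation is recorded as the pair of \<open>(\<psi>, D\<psi>)\<close> on
  \<open>\<Omega> \<times> Y\<close> and of its trace on \<open>\<Omega> \<times> \<partial>Y\<close>.\<close>

definition parabolic_tests ::
  "'x::euclidean_space set \<Rightarrow> 'y::euclidean_space set \<Rightarrow> (('x \<times> 'y \<Rightarrow> real \<times> 'y) \<times> ('x \<times> 'y \<Rightarrow> real)) set"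
  where "parabolic_tests \<Omega> Y = {(\<lambda>(x, y). (\<psi> x y, D\<psi> x y), \<lambda>(x, y). v x y) |\<psi> D\<psi> v.
    L2_into (lborel_on \<Omega>) Y H1 \<psi> D\<psi> \<and> is_trace_L2 (lborel_on \<Omega>) Y \<psi> D\<psi> v}"

text \<open>The parabolic equation at a fixed time says that the sum of two functionals vanishes on the test
  functions; these are their representing functions in \<open>L\<^sup>2(\<Omega> \<times> Y)\<close> and in \<open>L\<^sup>2(\<Omega> \<times> \<partial>Y)\<close>.\<close>

definition bulk_functional ::
  "real \<Rightarrow> ('x \<Rightarrow> 'y \<Rightarrow> real) \<Rightarrow> ('x \<Rightarrow> 'y \<Rightarrow> 'y::euclidean_space) \<Rightarrow> 'x \<times> 'y \<Rightarrow> real \<times> 'y" where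
  "bulk_functional D \<rho>' D\<rho> = (\<lambda>(x, y). (\<rho>' x y, D *\<^sub>R D\<rho> x y))"

definition robin_functional ::
  "'y set \<Rightarrow> real \<Rightarrow> real \<Rightarrow> real \<Rightarrow> ('x \<Rightarrow> real) \<Rightarrow> ('x \<Rightarrow> 'y \<Rightarrow> real) \<Rightarrow> 'x \<times> 'y \<Rightarrow> real" where
  "robin_functional \<Gamma> \<kappa> b R p w = (\<lambda>(x, y). - (\<kappa> * (indicator \<Gamma> y * (p x + b - R * w x y))))"

lemma L2_parabolic_tests:
  "(u, v) \<in> parabolic_tests \<Omega> Y \<Longrightarrow>
    L2 (lborel_on \<Omega> \<Otimes>\<^sub>M lborel_on Y) u \<and> L2 (lborel_on \<Omega> \<Otimes>\<^sub>M surface_measure Y) v"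
  unfolding parabolic_tests_def
  by (auto simp: L2_into_def is_trace_L2_def split_beta' intro!: L2_Pair)

lemma AE_time_interval_exists:
  assumes "T > 0" "AE t in time_interval T. P t" shows "\<exists>t. P t"
proof -
  have "ae_filter (time_interval T) \<noteq> bot"
    using assms(1) by (simp add: ae_filter_eq_bot_iff emeasure_restrict_space)
  then show ?thesis using assms(2) by (rule eventually_happens')
qed

text \<open>What the uniqueness proof uses of a weak solution: \<open>\<pi>\<close> vanishes, and at almost every time the
  parabolic equation holds for all test functions at once, \<open>\<rho> t\<close> being one of them.\<close>

lemma weak_solution_tested:
  fixes \<Omega> :: "'x::euclidean_space set" and Y :: "'y::euclidean_space set"
  assumes T: "T > 0" and dom: "convex_polytopal_domain \<Omega>" "convex_polytopal_domain Y"
    and \<Gamma>: "\<Gamma> \<in> sets borel"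
    and A: "A > 0" and poincare: "poincare_constant \<Omega> C" "2 * C / A < 1"
    and \<theta>: "\<theta> < 2 * C / A" "\<theta> \<ge> 0"
    and f: "continuous_on UNIV (\<lambda>(r, s). f r s)" "\<And>r s. \<bar>f r s\<bar> \<le> \<theta> * \<bar>r\<bar>"
    and g: "linear_L2H1_L2 \<Omega> Y g"
    and sol: "weak_solution T \<Omega> Y \<Gamma> A D R b \<kappa> f g \<rho>\<^sub>I \<pi> \<rho>"
  obtains D\<rho> \<rho>' w where
    "L2 (time_interval T \<Otimes>\<^sub>M lborel_on \<Omega>) (\<lambda>(t, x). \<pi> t x)"
    "L2 ((time_interval T \<Otimes>\<^sub>M lborel_on \<Omega>) \<Otimes>\<^sub>M lborel_on Y) (\<lambda>((t, x), y). \<rho> t x y)"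
    "L2 ((time_interval T \<Otimes>\<^sub>M lborel_on \<Omega>) \<Otimes>\<^sub>M lborel_on Y) (\<lambda>((t, x), y). \<rho>' t x y)"
    "weak_time_deriv {0<..<T} (lborel_on \<Omega> \<Otimes>\<^sub>M lborel_on Y)
       (\<lambda>t (x, y). \<rho> t x y) (\<lambda>t (x, y). \<rho>' t x y)"
    "AE t in time_interval T. AE x in lborel_on \<Omega>. \<pi> t x = 0"
    "AE t in time_interval T.
      (\<lambda>(x, y). (\<rho> t x y, D\<rho> t x y), \<lambda>(x, y). w t x y) \<in> parabolic_tests \<Omega> Y"
    "AE t in time_interval T.
      L2 (lborel_on \<Omega> \<Otimes>\<^sub>M lborel_on Y) (bulk_functional D (\<rho>' t) (D\<rho> t)) \<and>
      L2 (lborel_on \<Omega> \<Otimes>\<^sub>M surface_measure Y) (robin_functional \<Gamma> \<kappa> b R (\<pi> t) (w t))"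
    "AE t in time_interval T. \<forall>(u, v)\<in>parabolic_tests \<Omega> Y.
      (LINT z|(lborel_on \<Omega> \<Otimes>\<^sub>M lborel_on Y). bulk_functional D (\<rho>' t) (D\<rho> t) z \<bullet> u z) +
      (LINT z|(lborel_on \<Omega> \<Otimes>\<^sub>M surface_measure Y). robin_functional \<Gamma> \<kappa> b R (\<pi> t) (w t) z \<bullet> v z) = 0"
proof -
  let ?S = "time_interval T" and ?M = "lborel_on \<Omega>" and ?Y = "lborel_on Y" and ?B = "surface_measure Y"
  interpret S: finite_measure ?S by (rule finite_measure_time_interval)
  interpret M: finite_measure ?M using convex_polytopal_domainD(1)[OF dom(1)] .
  interpret Y: finite_measure ?Y using convex_polytopal_domainD(1)[OF dom(2)] .
  interpret B: finite_measure ?B using convex_polytopal_domainD(3)[OF dom(2)] .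
  interpret MY: pair_sigma_finite ?M ?Y ..
  interpret MB: pair_sigma_finite ?M ?B ..
  note sf = S.sigma_finite_measure_axioms M.sigma_finite_measure_axioms
    Y.sigma_finite_measure_axioms B.sigma_finite_measure_axioms
  have finMY: "finite_measure (?M \<Otimes>\<^sub>M ?Y)" and finMB: "finite_measure (?M \<Otimes>\<^sub>M ?B)"
    using finite_measure_pair_measure M.finite_measure_axioms Y.finite_measure_axioms
      B.finite_measure_axioms by blast+
  have cgM: "countably_generated ?M" and cgMY: "countably_generated (?M \<Otimes>\<^sub>M ?Y)"
    and cgMB: "countably_generated (?M \<Otimes>\<^sub>M ?B)"
    by (intro countably_generated_pair convex_polytopal_domainD dom)+
  obtain D\<pi> D\<rho> \<rho>' w where
    \<pi>: "L2_into ?S \<Omega> H10 \<pi> D\<pi>" and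
    \<rho>: "L2_into (?S \<Otimes>\<^sub>M ?M) Y H1 (\<lambda>(t, x). \<rho> t x) (\<lambda>(t, x). D\<rho> t x)" and
    w: "is_trace_L2 (?S \<Otimes>\<^sub>M ?M) Y (\<lambda>(t, x). \<rho> t x) (\<lambda>(t, x). D\<rho> t x) (\<lambda>(t, x). w t x)" and
    \<rho>': "L2 ((?S \<Otimes>\<^sub>M ?M) \<Otimes>\<^sub>M ?Y) (\<lambda>((t, x), y). \<rho>' t x y)" and
    deriv: "weak_time_deriv {0<..<T} (?M \<Otimes>\<^sub>M ?Y) (\<lambda>t (x, y). \<rho> t x y) (\<lambda>t (x, y). \<rho>' t x y)" and
    weak0: "\<forall>\<phi> D\<phi> \<psi> D\<psi> v. H10 \<Omega> \<phi> D\<phi> \<and> L2_into ?M Y H1 \<psi> D\<psi> \<and> is_trace_L2 ?M Y \<psi> D\<psi> v \<longrightarrow>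
       (AE t in ?S.
          A * (LINT x|?M. D\<pi> t x \<bullet> D\<phi> x) = (LINT x|?M. f (\<pi> t x) (g (\<rho> t) x) * \<phi> x) \<and>
          (LINT x|?M. LINT y|?Y. \<rho>' t x y * \<psi> x y) +
            D * (LINT x|?M. LINT y|?Y. D\<rho> t x y \<bullet> D\<psi> x y) =
            \<kappa> * (LINT x|?M. (LINT y:\<Gamma>|?B. (\<pi> t x + b - R * w t x y) * v x y)))"
    using sol unfolding weak_solution_def by (elim exE conjE) (rule that)
  note weak = weak0[rule_format]
  have \<rho>t: "AE t in ?S. L2_into ?M Y H1 (\<rho> t) (D\<rho> t)"
    by (rule L2_into_section[OF sf(1-3) \<rho>])
  have wt: "AE t in ?S. is_trace_L2 ?M Y (\<rho> t) (D\<rho> t) (w t)"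
    by (rule is_trace_L2_section[OF sf(1,2,4) w])
  have \<pi>t: "AE t in ?S. H10 \<Omega> (\<pi> t) (D\<pi> t)" using \<pi> by (simp add: L2_into_def)
  have \<pi>L2: "AE t in ?S. L2 ?M (\<pi> t) \<and> L2 ?M (D\<pi> t)"
    using \<pi>t by eventually_elim (simp add: H10_def H1_def)
  \<comment> \<open>Both equations are tested simultaneously.  To use one of them, some test function for the other
     is required; the solution itself provides it.\<close>
  have test_ex: "\<exists>\<psi> D\<psi> v. L2_into ?M Y H1 \<psi> D\<psi> \<and> is_trace_L2 ?M Y \<psi> D\<psi> v"
    using AE_time_interval_exists[OF T eventually_conj[OF \<rho>t wt]] by blast
  have \<phi>_ex: "\<exists>\<phi> D\<phi>. H10 \<Omega> \<phi> D\<phi>" using AE_time_interval_exists[OF T \<pi>t] by blast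

  have fm: "(\<lambda>x. f (p x) (h x)) \<in> borel_measurable ?M"
    if "p \<in> borel_measurable ?M" "h \<in> borel_measurable ?M" for p h
  proof -
    have "(\<lambda>x. (p x, h x)) \<in> borel_measurable ?M" using that by (rule borel_measurable_Pair)
    from measurable_compose[OF this borel_measurable_continuous_onI[OF f(1)]] show ?thesis by simp
  qed
  have qt: "AE t in ?S. (\<lambda>x. f (\<pi> t x) (g (\<rho> t) x)) \<in> borel_measurable ?M"
    using \<pi>L2 \<rho>t
  proof eventually_elim
    case (elim t)
    then have "L2 ?M (g (\<rho> t))" using g unfolding linear_L2H1_L2_def by blast
    then show ?case using elim by (intro fm) (auto simp: L2_def)
  qed
  \<comment> \<open>the elliptic equation as the vanishing of a functional on the pairs \<open>(\<phi>, D\<phi>)\<close>, completed by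
     zero in the second component\<close>
  let ?F = "\<lambda>t x. (- f (\<pi> t x) (g (\<rho> t) x), A *\<^sub>R D\<pi> t x)"
  let ?X = "{((\<lambda>x. (\<phi> x, D\<phi> x)), (\<lambda>x. 0 :: real)) |\<phi> D\<phi>. H10 \<Omega> \<phi> D\<phi>}"
  have Ft: "AE t in ?S. L2 ?M (\<lambda>x. f (\<pi> t x) (g (\<rho> t) x)) \<and> L2 ?M (?F t)"
    using \<pi>L2 qt
  proof eventually_elim
    case (elim t)
    have "L2 ?M (\<lambda>x. f (\<pi> t x) (g (\<rho> t) x))"
      by (rule L2_bound[OF L2_scaleR[of ?M "\<pi> t" \<theta>] elim(2)])
        (use elim f(2) \<theta>(2) in \<open>auto simp: abs_mult\<close>)
    moreover from L2_scaleR[OF this, of "- 1"] have "L2 ?M (\<lambda>x. - f (\<pi> t x) (g (\<rho> t) x))" by simp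
    ultimately show ?case using elim by (auto intro!: L2_Pair L2_scaleR)
  qed
  have "AE t in ?S. \<forall>(u, v)\<in>?X. (LINT x|?M. ?F t x \<bullet> u x) + (LINT x|?M. 0 \<bullet> v x) = 0"
  proof (rule AE_uniform_in_test_function[where H = "\<lambda>t x. 0 :: real"])
    show "\<forall>u v. (u, v) \<in> ?X \<longrightarrow> L2 ?M u \<and> L2 ?M v"
      by (auto simp: H10_def H1_def L2_zero intro!: L2_Pair)
    show "AE t in ?S. L2 ?M (?F t)" using Ft by (auto elim!: eventually_mono)
    fix u and v :: "'x \<Rightarrow> real" assume "(u, v) \<in> ?X"
    then obtain \<phi> D\<phi> where u: "u = (\<lambda>x. (\<phi> x, D\<phi> x))" and \<phi>: "H10 \<Omega> \<phi> D\<phi>" by blast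
    obtain \<psi> D\<psi> v' where "L2_into ?M Y H1 \<psi> D\<psi> \<and> is_trace_L2 ?M Y \<psi> D\<psi> v'"
      using test_ex by blast
    with \<phi> weak[of \<phi> D\<phi> \<psi> D\<psi> v'] have "AE t in ?S.
        A * (LINT x|?M. D\<pi> t x \<bullet> D\<phi> x) = (LINT x|?M. f (\<pi> t x) (g (\<rho> t) x) * \<phi> x)"
      by (auto elim!: eventually_mono)
    with Ft \<pi>L2 show "AE t in ?S. (LINT x|?M. ?F t x \<bullet> u x) + (LINT x|?M. 0 \<bullet> v x) = 0"
    proof eventually_elim
      case (elim t)
      have L: "L2 ?M \<phi>" "L2 ?M D\<phi>" using \<phi> by (auto simp: H10_def H1_def)
      have "integrable ?M (\<lambda>x. f (\<pi> t x) (g (\<rho> t) x) * \<phi> x)" "integrable ?M (\<lambda>x. D\<pi> t x \<bullet> D\<phi> x)"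
        using elim L by (auto intro!: L2_mult_integrable L2_inner_integrable)
      then show ?case using elim(3) by (simp add: u inner_Pair)
    qed
  qed (auto simp: M.finite_measure_axioms cgM L2_zero)
  with \<pi>t qt Ft \<pi>L2 have \<pi>0: "AE t in ?S. AE x in ?M. \<pi> t x = 0"
  proof eventually_elim
    case (elim t)
    have L: "L2 ?M (\<pi> t)" "L2 ?M (D\<pi> t)" using elim by auto
    have "integrable ?M (\<lambda>x. f (\<pi> t x) (g (\<rho> t) x) * \<pi> t x)" "integrable ?M (\<lambda>x. D\<pi> t x \<bullet> D\<pi> t x)"
      using elim L by (auto intro!: L2_mult_integrable L2_inner_integrable)
    moreover have "(LINT x|?M. ?F t x \<bullet> (\<pi> t x, D\<pi> t x)) = 0"
      using elim(1,5) by force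
    ultimately have "A * (LINT x|?M. D\<pi> t x \<bullet> D\<pi> t x) = (LINT x|?M. f (\<pi> t x) (g (\<rho> t) x) * \<pi> t x)"
      by (simp add: inner_Pair)
    from elliptic_solution_vanishes[OF poincare A \<theta> elim(1) this elim(2) f(2)] show ?case .
  qed

  have \<rho>'t: "AE t in ?S. L2 (?M \<Otimes>\<^sub>M ?Y) (\<lambda>(x, y). \<rho>' t x y)"
    by (rule L2_section_triple[OF sf(1-3) \<rho>'])
  have bulk: "AE t in ?S. L2 (?M \<Otimes>\<^sub>M ?Y) (bulk_functional D (\<rho>' t) (D\<rho> t))"
    using \<rho>'t \<rho>t
  proof eventually_elim
    case (elim t)
    then have "L2 (?M \<Otimes>\<^sub>M ?Y) (\<lambda>z. (\<rho>' t (fst z) (snd z), D *\<^sub>R D\<rho> t (fst z) (snd z)))"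
      by (intro L2_Pair L2_scaleR) (simp_all add: L2_into_def split_beta')
    then show ?case by (simp add: bulk_functional_def split_beta')
  qed
  have robin: "AE t in ?S. L2 (?M \<Otimes>\<^sub>M ?B) (robin_functional \<Gamma> \<kappa> b R (\<pi> t) (w t))"
    using \<pi>L2 wt
  proof eventually_elim
    case (elim t)
    have wL: "L2 (?M \<Otimes>\<^sub>M ?B) (\<lambda>z. w t (fst z) (snd z))"
      using elim by (simp add: is_trace_L2_def split_beta')
    have \<pi>m: "\<pi> t \<in> borel_measurable ?M" "integrable ?M (\<lambda>x. (\<pi> t x)\<^sup>2)"
      using elim by (auto simp: L2_def)
    have "integrable (?M \<Otimes>\<^sub>M ?B) (\<lambda>z. (\<pi> t (fst z))\<^sup>2 * 1)"
      by (rule integrable_pair_product[OF sf(2,4) \<pi>m(2)]) simp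
    then have pL: "L2 (?M \<Otimes>\<^sub>M ?B) (\<lambda>z. \<pi> t (fst z))"
      using \<pi>m(1) by (simp add: L2_def)
    have bL: "L2 (?M \<Otimes>\<^sub>M ?B) (\<lambda>z. b)" by (rule L2_bounded[OF finMB, of _ "\<bar>b\<bar>"]) auto
    have sumL: "L2 (?M \<Otimes>\<^sub>M ?B) (\<lambda>z. \<pi> t (fst z) + b - R *\<^sub>R w t (fst z) (snd z))"
      by (intro L2_diff L2_add pL bL L2_scaleR wL)
    have "L2 (?M \<Otimes>\<^sub>M ?B) (\<lambda>z. (\<pi> t (fst z) + b - R *\<^sub>R w t (fst z) (snd z)) * indicator \<Gamma> (snd z))"
      by (rule L2_mult_bounded[OF sumL, of _ 1]) (use \<Gamma> in \<open>auto simp: indicator_def\<close>)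
    from L2_scaleR[OF this, of "- \<kappa>"] show ?case
      by (simp add: robin_functional_def split_beta' mult_ac)
  qed
  have "AE t in ?S. \<forall>(u, v)\<in>parabolic_tests \<Omega> Y.
      (LINT z|(?M \<Otimes>\<^sub>M ?Y). bulk_functional D (\<rho>' t) (D\<rho> t) z \<bullet> u z) +
      (LINT z|(?M \<Otimes>\<^sub>M ?B). robin_functional \<Gamma> \<kappa> b R (\<pi> t) (w t) z \<bullet> v z) = 0"
  proof (rule AE_uniform_in_test_function[OF finMY cgMY finMB cgMB _ bulk robin])
    show "\<forall>u v. (u, v) \<in> parabolic_tests \<Omega> Y \<longrightarrow> L2 (?M \<Otimes>\<^sub>M ?Y) u \<and> L2 (?M \<Otimes>\<^sub>M ?B) v"
      using L2_parabolic_tests by blast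
    fix u v assume uv: "(u, v) \<in> parabolic_tests \<Omega> Y"
    then obtain \<psi> D\<psi> v' where u: "u = (\<lambda>(x, y). (\<psi> x y, D\<psi> x y))" and v: "v = (\<lambda>(x, y). v' x y)"
      and \<psi>: "L2_into ?M Y H1 \<psi> D\<psi>" "is_trace_L2 ?M Y \<psi> D\<psi> v'"
      unfolding parabolic_tests_def by blast
    obtain \<phi> D\<phi> where "H10 \<Omega> \<phi> D\<phi>" using \<phi>_ex by blast
    with \<psi> have "AE t in ?S. (LINT x|?M. LINT y|?Y. \<rho>' t x y * \<psi> x y) +
        D * (LINT x|?M. LINT y|?Y. D\<rho> t x y \<bullet> D\<psi> x y) =
        \<kappa> * (LINT x|?M. (LINT y:\<Gamma>|?B. (\<pi> t x + b - R * w t x y) * v' x y))"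
      using weak[of \<phi> D\<phi> \<psi> D\<psi> v'] by (auto elim!: eventually_mono)
    with \<rho>'t \<rho>t robin
    show "AE t in ?S. (LINT z|(?M \<Otimes>\<^sub>M ?Y). bulk_functional D (\<rho>' t) (D\<rho> t) z \<bullet> u z) +
      (LINT z|(?M \<Otimes>\<^sub>M ?B). robin_functional \<Gamma> \<kappa> b R (\<pi> t) (w t) z \<bullet> v z) = 0"
    proof eventually_elim
      case (elim t)
      have i1: "integrable (?M \<Otimes>\<^sub>M ?Y) (\<lambda>z. \<rho>' t (fst z) (snd z) * \<psi> (fst z) (snd z))"
        using elim(1) \<psi>(1) by (intro L2_mult_integrable) (simp_all add: L2_into_def split_beta')
      have i2: "integrable (?M \<Otimes>\<^sub>M ?Y) (\<lambda>z. D\<rho> t (fst z) (snd z) \<bullet> D\<psi> (fst z) (snd z))"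
        using elim(2) \<psi>(1) by (intro L2_inner_integrable) (simp_all add: L2_into_def split_beta')
      have i3: "integrable (?M \<Otimes>\<^sub>M ?B) (\<lambda>z. robin_functional \<Gamma> \<kappa> b R (\<pi> t) (w t) z * v z)"
        using elim(3) L2_parabolic_tests[OF uv] by (intro L2_mult_integrable) auto
      have "(LINT z|(?M \<Otimes>\<^sub>M ?Y). bulk_functional D (\<rho>' t) (D\<rho> t) z \<bullet> u z) =
          (LINT z|(?M \<Otimes>\<^sub>M ?Y). \<rho>' t (fst z) (snd z) * \<psi> (fst z) (snd z) +
            D * (D\<rho> t (fst z) (snd z) \<bullet> D\<psi> (fst z) (snd z)))"
        by (simp add: bulk_functional_def u split_beta' inner_Pair)
      also have "\<dots> = (LINT x|?M. LINT y|?Y. \<rho>' t x y * \<psi> x y) +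
          D * (LINT x|?M. LINT y|?Y. D\<rho> t x y \<bullet> D\<psi> x y)"
        using i1 i2 MY.integral_fst'[OF i1] MY.integral_fst'[OF i2] by simp
      finally have 1: "(LINT z|(?M \<Otimes>\<^sub>M ?Y). bulk_functional D (\<rho>' t) (D\<rho> t) z \<bullet> u z) = \<dots>" .
      have "(LINT z|(?M \<Otimes>\<^sub>M ?B). robin_functional \<Gamma> \<kappa> b R (\<pi> t) (w t) z \<bullet> v z) =
          (LINT x|?M. LINT y|?B. robin_functional \<Gamma> \<kappa> b R (\<pi> t) (w t) (x, y) * v (x, y))"
        using MB.integral_fst'[OF i3] by simp
      also have "\<dots> = (LINT x|?M. LINT y|?B.
          - \<kappa> * (indicator \<Gamma> y * ((\<pi> t x + b - R * w t x y) * v' x y)))"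
        by (simp add: robin_functional_def v mult.assoc)
      also have "\<dots> = - \<kappa> * (LINT x|?M. (LINT y:\<Gamma>|?B. (\<pi> t x + b - R * w t x y) * v' x y))"
        by (simp only: set_lebesgue_integral_def integral_mult_right_zero real_scaleR_def)
      finally show ?case using 1 elim(4) by simp
    qed
  qed
  moreover have "AE t in ?S.
      (\<lambda>(x, y). (\<rho> t x y, D\<rho> t x y), \<lambda>(x, y). w t x y) \<in> parabolic_tests \<Omega> Y"
    using \<rho>t wt unfolding parabolic_tests_def by eventually_elim blast
  moreover have "L2 (?S \<Otimes>\<^sub>M ?M) (\<lambda>(t, x). \<pi> t x)" using \<pi> by (simp add: L2_into_def)
  moreover have "L2 ((?S \<Otimes>\<^sub>M ?M) \<Otimes>\<^sub>M ?Y) (\<lambda>((t, x), y). \<rho> t x y)"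
    using \<rho> by (simp add: L2_into_def split_beta')
  ultimately show ?thesis using that \<rho>' deriv \<pi>0 eventually_conj[OF bulk robin] by blast
qed

text \<open>Test the equation of each solution with each of the two solutions and combine the four identities
  bilinearly; in this way the difference of the solutions need not itself be shown to be a test
  function.  As \<open>p1 = p2\<close>, the boundary term is \<open>\<kappa> R\<close> times the integral of \<open>(w1 - w2)\<^sup>2\<close> over
  \<open>\<Omega> \<times> \<Gamma>\<close>, and the gradient term is \<open>D \<parallel>Dr1 - Dr2\<parallel>\<^sup>2\<close>; neither is negative.\<close>

lemma energy_inequality:
  fixes \<Omega> :: "'x::euclidean_space set" and Y :: "'y::euclidean_space set"
  assumes dom: "convex_polytopal_domain \<Omega>" "convex_polytopal_domain Y"
    and const: "D > 0" "R > 0" "\<kappa> > 0"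
    and p: "p1 \<in> borel_measurable (lborel_on \<Omega>)" "p2 \<in> borel_measurable (lborel_on \<Omega>)"
      "AE x in lborel_on \<Omega>. p1 x = p2 x"
    and r': "L2 (lborel_on \<Omega> \<Otimes>\<^sub>M lborel_on Y) (\<lambda>(x, y). r1' x y)"
      "L2 (lborel_on \<Omega> \<Otimes>\<^sub>M lborel_on Y) (\<lambda>(x, y). r2' x y)"
    and bulk: "L2 (lborel_on \<Omega> \<Otimes>\<^sub>M lborel_on Y) (bulk_functional D r1' Dr1)"
      "L2 (lborel_on \<Omega> \<Otimes>\<^sub>M lborel_on Y) (bulk_functional D r2' Dr2)"
    and robin: "L2 (lborel_on \<Omega> \<Otimes>\<^sub>M surface_measure Y) (robin_functional \<Gamma> \<kappa> b R p1 w1)"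
      "L2 (lborel_on \<Omega> \<Otimes>\<^sub>M surface_measure Y) (robin_functional \<Gamma> \<kappa> b R p2 w2)"
    and tests: "(\<lambda>(x, y). (r1 x y, Dr1 x y), \<lambda>(x, y). w1 x y) \<in> parabolic_tests \<Omega> Y"
      "(\<lambda>(x, y). (r2 x y, Dr2 x y), \<lambda>(x, y). w2 x y) \<in> parabolic_tests \<Omega> Y"
    and eq: "\<forall>(u, v)\<in>parabolic_tests \<Omega> Y.
      (LINT z|(lborel_on \<Omega> \<Otimes>\<^sub>M lborel_on Y). bulk_functional D r1' Dr1 z \<bullet> u z) +
      (LINT z|(lborel_on \<Omega> \<Otimes>\<^sub>M surface_measure Y). robin_functional \<Gamma> \<kappa> b R p1 w1 z \<bullet> v z) = 0"
      "\<forall>(u, v)\<in>parabolic_tests \<Omega> Y.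
      (LINT z|(lborel_on \<Omega> \<Otimes>\<^sub>M lborel_on Y). bulk_functional D r2' Dr2 z \<bullet> u z) +
      (LINT z|(lborel_on \<Omega> \<Otimes>\<^sub>M surface_measure Y). robin_functional \<Gamma> \<kappa> b R p2 w2 z \<bullet> v z) = 0"
  shows "(LINT (x, y)|(lborel_on \<Omega> \<Otimes>\<^sub>M lborel_on Y). (r1' x y - r2' x y) * (r1 x y - r2 x y)) \<le> 0"
proof -
  let ?M = "lborel_on \<Omega>" and ?Y = "lborel_on Y" and ?B = "surface_measure Y"
  interpret M: finite_measure ?M using convex_polytopal_domainD(1)[OF dom(1)] .
  interpret B: finite_measure ?B using convex_polytopal_domainD(3)[OF dom(2)] .
  interpret MB: pair_sigma_finite ?M ?B ..
  let ?N = "?M \<Otimes>\<^sub>M ?Y" and ?P = "?M \<Otimes>\<^sub>M ?B"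
  define F1 F2 where "F1 = bulk_functional D r1' Dr1" and "F2 = bulk_functional D r2' Dr2"
  define H1 H2 where "H1 = robin_functional \<Gamma> \<kappa> b R p1 w1" and "H2 = robin_functional \<Gamma> \<kappa> b R p2 w2"
  define u1 u2 where "u1 = (\<lambda>(x, y). (r1 x y, Dr1 x y))" and "u2 = (\<lambda>(x, y). (r2 x y, Dr2 x y))"
  define v1 v2 where "v1 = (\<lambda>(x, y). w1 x y)" and "v2 = (\<lambda>(x, y). w2 x y)"
  note uv = tests[folded u1_def u2_def v1_def v2_def]
  note L = bulk[folded F1_def F2_def] robin[folded H1_def H2_def]
    L2_parabolic_tests[OF uv(1)] L2_parabolic_tests[OF uv(2)]
  have e: "(LINT z|?N. F1 z \<bullet> u1 z) + (LINT z|?P. H1 z \<bullet> v1 z) = 0"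
    "(LINT z|?N. F1 z \<bullet> u2 z) + (LINT z|?P. H1 z \<bullet> v2 z) = 0"
    "(LINT z|?N. F2 z \<bullet> u1 z) + (LINT z|?P. H2 z \<bullet> v1 z) = 0"
    "(LINT z|?N. F2 z \<bullet> u2 z) + (LINT z|?P. H2 z \<bullet> v2 z) = 0"
    using eq[folded F1_def F2_def H1_def H2_def] uv by fastforce+
  have iF: "integrable ?N (\<lambda>z. F z \<bullet> u z)" if "F = F1 \<or> F = F2" "u = u1 \<or> u = u2" for F u
    using that L by (intro L2_inner_integrable) auto
  have iH: "integrable ?P (\<lambda>z. H z \<bullet> v z)" if "H = H1 \<or> H = H2" "v = v1 \<or> v = v2" for H v
    using that L by (intro L2_inner_integrable) auto
  have "(LINT z|?N. (F1 z - F2 z) \<bullet> (u1 z - u2 z)) + (LINT z|?P. (H1 z - H2 z) \<bullet> (v1 z - v2 z)) = 0"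
    using e iF iH by (simp add: inner_diff_left inner_diff_right del: inner_real_def)
  moreover have "(LINT z|?P. (H1 z - H2 z) \<bullet> (v1 z - v2 z)) \<ge> 0"
  proof (rule integral_nonneg_AE)
    have "AE z in ?P. p1 (fst z) = p2 (fst z)"
    proof (rule MB.AE_pair_measure)
      show "{z \<in> space ?P. p1 (fst z) = p2 (fst z)} \<in> sets ?P" using p(1,2) by measurable
      show "AE x in ?M. AE y in ?B. p1 (fst (x, y)) = p2 (fst (x, y))"
        using p(3) by (auto elim!: eventually_mono)
    qed
    then show "AE z in ?P. 0 \<le> (H1 z - H2 z) \<bullet> (v1 z - v2 z)"
    proof eventually_elim
      case (elim z)
      have "(H1 z - H2 z) \<bullet> (v1 z - v2 z) = \<kappa> * R * indicator \<Gamma> (snd z) * (v1 z - v2 z)\<^sup>2"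
        using elim by (simp add: H1_def H2_def v1_def v2_def robin_functional_def split_beta'
            power2_eq_square algebra_simps)
      then show ?case using const by simp
    qed
  qed
  ultimately have "(LINT z|?N. (F1 z - F2 z) \<bullet> (u1 z - u2 z)) \<le> 0" by linarith
  moreover have "(LINT (x, y)|?N. (r1' x y - r2' x y) * (r1 x y - r2 x y))
      \<le> (LINT z|?N. (F1 z - F2 z) \<bullet> (u1 z - u2 z))"
  proof (rule integral_mono)
    show "integrable ?N (\<lambda>z. (F1 z - F2 z) \<bullet> (u1 z - u2 z))"
      using L by (intro L2_inner_integrable L2_diff) auto
    have nf: "norm (fst q) \<le> norm q" for q :: "real \<times> 'y"
      using norm_fst_le[of "fst q" "snd q"] by simp
    have "L2 ?N (\<lambda>z. fst (u1 z - u2 z))"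
    proof (rule L2_bound)
      show d: "L2 ?N (\<lambda>z. u1 z - u2 z)" using L by (intro L2_diff) auto
      have "(\<lambda>z. u1 z - u2 z) \<in> borel_measurable ?N" using d by (simp add: L2_def)
      from measurable_compose[OF this borel_measurable_continuous_onI[OF continuous_on_fst[OF continuous_on_id]]]
      show "(\<lambda>z. fst (u1 z - u2 z)) \<in> borel_measurable ?N" by simp
      show "AE z in ?N. norm (fst (u1 z - u2 z)) \<le> norm (u1 z - u2 z)"
        by (rule AE_I2) (rule nf)
    qed
    from L2_mult_integrable[OF L2_diff[OF r'] this]
    show "integrable ?N (\<lambda>(x, y). (r1' x y - r2' x y) * (r1 x y - r2 x y))"
      by (simp add: split_beta' u1_def u2_def)
    fix z
    have "(F1 z - F2 z) \<bullet> (u1 z - u2 z) = (case z of (x, y) \<Rightarrow>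
        (r1' x y - r2' x y) * (r1 x y - r2 x y) + D * (norm (Dr1 x y - Dr2 x y))\<^sup>2)"
      by (simp add: F1_def F2_def u1_def u2_def bulk_functional_def split_beta' inner_Pair
          power2_norm_eq_inner flip: scaleR_diff_right)
    then show "(case z of (x, y) \<Rightarrow> (r1' x y - r2' x y) * (r1 x y - r2 x y))
        \<le> (F1 z - F2 z) \<bullet> (u1 z - u2 z)"
      using const(1) by (simp add: split_beta')
  qed
  ultimately show ?thesis by linarith
qed

theorem theorem3:
  fixes \<Omega> :: "'x::euclidean_space set"
    and Y \<Gamma>\<^sub>R \<Gamma>\<^sub>N :: "'y::euclidean_space set"
    and T A D R p\<^sub>F \<kappa> \<theta> C\<^sub>\<Omega> C\<^sub>f \<alpha> C\<^sub>g :: real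
    and f :: "real \<Rightarrow> real \<Rightarrow> real" and D1f D2f :: "real \<times> real \<Rightarrow> real"
    and g :: "('x \<Rightarrow> 'y \<Rightarrow> real) \<Rightarrow> 'x \<Rightarrow> real"
    and \<rho>\<^sub>I :: "'x \<Rightarrow> 'y \<Rightarrow> real" and D\<rho>\<^sub>I :: "'x \<Rightarrow> 'y \<Rightarrow> 'y"
    and \<pi>1 \<pi>2 :: "real \<Rightarrow> 'x \<Rightarrow> real" and \<rho>1 \<rho>2 :: "real \<Rightarrow> 'x \<Rightarrow> 'y \<Rightarrow> real"
  assumes dims: "DIM('x) \<in> {1, 2, 3}" "DIM('y) \<in> {1, 2, 3}"
    and T: "T > 0"
    and domains: "convex_polytopal_domain \<Omega>" "convex_polytopal_domain Y"
    and boundary: "frontier Y = \<Gamma>\<^sub>R \<union> \<Gamma>\<^sub>N" "\<Gamma>\<^sub>R \<inter> \<Gamma>\<^sub>N = {}" "\<Gamma>\<^sub>R \<in> sets borel"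
    and constants: "A > 0" "D > 0" "R > 0" "p\<^sub>F > 0" "\<kappa> > 0"
    and poincare: "poincare_constant \<Omega> C\<^sub>\<Omega>" "2 * C\<^sub>\<Omega> / A < 1"
    and initial: "L2_into (lborel_on \<Omega>) Y H1 \<rho>\<^sub>I D\<rho>\<^sub>I"
    and f_cont: "continuous_on UNIV (\<lambda>(r, s). f r s)"
    and f_deriv: "weak_partial UNIV (\<lambda>(r, s). f r s) (1, 0) D1f"
      "weak_partial UNIV (\<lambda>(r, s). f r s) (0, 1) D2f"
      "AE z in lborel. \<bar>D1f z\<bar> \<le> \<theta>" "AE z in lborel. \<bar>D2f z\<bar> \<le> \<theta>"
    and theta: "\<theta> < 2 * C\<^sub>\<Omega> / A" "\<theta> < 1 / C\<^sub>\<Omega>" "1 + 4 * \<theta>\<^sup>2 < 3 / 2"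
    and f_zero: "\<And>s. f 0 s = 0"
    and f_growth: "C\<^sub>f > 0" "0 < \<alpha>" "\<alpha> < 1"
      "\<And>r s. \<bar>f r s\<bar> \<le> C\<^sub>f * min \<bar>r\<bar> (\<bar>r\<bar> powr \<alpha>)"
    and g_linear: "linear_L2H1_L2 \<Omega> Y g"
    and g_bound: "C\<^sub>g > 0"
      "\<And>u Du. L2_into (lborel_on \<Omega>) Y H1 u Du \<Longrightarrow>
         (LINT x|lborel_on \<Omega>. (g u x)\<^sup>2) \<le>
           C\<^sub>g * (LINT x|lborel_on \<Omega>. LINT y|lborel_on Y. (u x y)\<^sup>2 + (norm (Du x y))\<^sup>2)"
    and solutions: "weak_solution T \<Omega> Y \<Gamma>\<^sub>R A D R p\<^sub>F \<kappa> f g \<rho>\<^sub>I \<pi>1 \<rho>1"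
      "weak_solution T \<Omega> Y \<Gamma>\<^sub>R A D R p\<^sub>F \<kappa> f g \<rho>\<^sub>I \<pi>2 \<rho>2"
  shows "(AE (t, x) in lborel_on {0<..<T} \<Otimes>\<^sub>M lborel_on \<Omega>. \<pi>1 t x = \<pi>2 t x) \<and>
         (AE ((t, x), y) in (lborel_on {0<..<T} \<Otimes>\<^sub>M lborel_on \<Omega>) \<Otimes>\<^sub>M lborel_on Y.
            \<rho>1 t x y = \<rho>2 t x y)"
proof -
  let ?S = "time_interval T" and ?M = "lborel_on \<Omega>" and ?Y = "lborel_on Y"
  interpret S: finite_measure ?S by (rule finite_measure_time_interval)
  interpret M: finite_measure ?M using convex_polytopal_domainD(1)[OF domains(1)] .
  interpret Y: finite_measure ?Y using convex_polytopal_domainD(1)[OF domains(2)] .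
  interpret SM: pair_sigma_finite ?S ?M ..
  note sf = S.sigma_finite_measure_axioms M.sigma_finite_measure_axioms Y.sigma_finite_measure_axioms
  have \<theta>: "\<theta> \<ge> 0" by (rule AE_abs_le_imp_nonneg[OF f_deriv(3)])
  have f_le: "\<bar>f r s\<bar> \<le> \<theta> * \<bar>r\<bar>" for r s
    using weak_partial_bound_imp_lipschitz[OF f_cont f_deriv(1,3), of 0 r s]
      weak_partial_bound_imp_lipschitz[OF f_cont f_deriv(1,3), of r 0 s] f_zero[of s]
    by (cases "r \<ge> 0") auto
  obtain D\<rho>1 \<rho>1' w1 where s1:
    "L2 (?S \<Otimes>\<^sub>M ?M) (\<lambda>(t, x). \<pi>1 t x)"
    "L2 ((?S \<Otimes>\<^sub>M ?M) \<Otimes>\<^sub>M ?Y) (\<lambda>((t, x), y). \<rho>1 t x y)"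
    "L2 ((?S \<Otimes>\<^sub>M ?M) \<Otimes>\<^sub>M ?Y) (\<lambda>((t, x), y). \<rho>1' t x y)"
    "weak_time_deriv {0<..<T} (?M \<Otimes>\<^sub>M ?Y) (\<lambda>t (x, y). \<rho>1 t x y) (\<lambda>t (x, y). \<rho>1' t x y)"
    "AE t in ?S. AE x in ?M. \<pi>1 t x = 0"
    "AE t in ?S. (\<lambda>(x, y). (\<rho>1 t x y, D\<rho>1 t x y), \<lambda>(x, y). w1 t x y) \<in> parabolic_tests \<Omega> Y"
    "AE t in ?S. L2 (?M \<Otimes>\<^sub>M ?Y) (bulk_functional D (\<rho>1' t) (D\<rho>1 t)) \<and>
      L2 (?M \<Otimes>\<^sub>M surface_measure Y) (robin_functional \<Gamma>\<^sub>R \<kappa> p\<^sub>F R (\<pi>1 t) (w1 t))"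
    "AE t in ?S. \<forall>(u, v)\<in>parabolic_tests \<Omega> Y.
      (LINT z|(?M \<Otimes>\<^sub>M ?Y). bulk_functional D (\<rho>1' t) (D\<rho>1 t) z \<bullet> u z) +
      (LINT z|(?M \<Otimes>\<^sub>M surface_measure Y). robin_functional \<Gamma>\<^sub>R \<kappa> p\<^sub>F R (\<pi>1 t) (w1 t) z \<bullet> v z) = 0"
    by (rule weak_solution_tested[OF T domains boundary(3) constants(1) poincare theta(1) \<theta>
        f_cont f_le g_linear solutions(1)])
  obtain D\<rho>2 \<rho>2' w2 where s2:
    "L2 (?S \<Otimes>\<^sub>M ?M) (\<lambda>(t, x). \<pi>2 t x)"
    "L2 ((?S \<Otimes>\<^sub>M ?M) \<Otimes>\<^sub>M ?Y) (\<lambda>((t, x), y). \<rho>2 t x y)"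
    "L2 ((?S \<Otimes>\<^sub>M ?M) \<Otimes>\<^sub>M ?Y) (\<lambda>((t, x), y). \<rho>2' t x y)"
    "weak_time_deriv {0<..<T} (?M \<Otimes>\<^sub>M ?Y) (\<lambda>t (x, y). \<rho>2 t x y) (\<lambda>t (x, y). \<rho>2' t x y)"
    "AE t in ?S. AE x in ?M. \<pi>2 t x = 0"
    "AE t in ?S. (\<lambda>(x, y). (\<rho>2 t x y, D\<rho>2 t x y), \<lambda>(x, y). w2 t x y) \<in> parabolic_tests \<Omega> Y"
    "AE t in ?S. L2 (?M \<Otimes>\<^sub>M ?Y) (bulk_functional D (\<rho>2' t) (D\<rho>2 t)) \<and>
      L2 (?M \<Otimes>\<^sub>M surface_measure Y) (robin_functional \<Gamma>\<^sub>R \<kappa> p\<^sub>F R (\<pi>2 t) (w2 t))"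
    "AE t in ?S. \<forall>(u, v)\<in>parabolic_tests \<Omega> Y.
      (LINT z|(?M \<Otimes>\<^sub>M ?Y). bulk_functional D (\<rho>2' t) (D\<rho>2 t) z \<bullet> u z) +
      (LINT z|(?M \<Otimes>\<^sub>M surface_measure Y). robin_functional \<Gamma>\<^sub>R \<kappa> p\<^sub>F R (\<pi>2 t) (w2 t) z \<bullet> v z) = 0"
    by (rule weak_solution_tested[OF T domains boundary(3) constants(1) poincare theta(1) \<theta>
        f_cont f_le g_linear solutions(2)])
  have init: "has_initial_value T (?M \<Otimes>\<^sub>M ?Y) (\<lambda>t (x, y). \<rho>1 t x y) (\<lambda>(x, y). \<rho>\<^sub>I x y)"
    "has_initial_value T (?M \<Otimes>\<^sub>M ?Y) (\<lambda>t (x, y). \<rho>2 t x y) (\<lambda>(x, y). \<rho>\<^sub>I x y)"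
    using solutions unfolding weak_solution_def by blast+
  have fin: "finite_measure (?M \<Otimes>\<^sub>M ?Y)"
    by (rule finite_measure_pair_measure[OF Y.finite_measure_axioms M.finite_measure_axioms])
  have LA: "L2 (?S \<Otimes>\<^sub>M (?M \<Otimes>\<^sub>M ?Y)) (\<lambda>(t, z). (case z of (x, y) \<Rightarrow> h t x y))"
    if "L2 ((?S \<Otimes>\<^sub>M ?M) \<Otimes>\<^sub>M ?Y) (\<lambda>((t, x), y). h t x y)" for h :: "real \<Rightarrow> 'x \<Rightarrow> 'y \<Rightarrow> real"
    using L2_pair_assoc[OF sf that] by (simp add: split_beta')
  have \<pi>m: "AE t in ?S. \<pi> t \<in> borel_measurable ?M"
    if "L2 (?S \<Otimes>\<^sub>M ?M) (\<lambda>(t, x). \<pi> t x)" for \<pi> :: "real \<Rightarrow> 'x \<Rightarrow> real"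
    using L2_section[OF sf(1,2) that] by (auto simp: L2_def elim!: eventually_mono)
  have "AE t in ?S. (LINT (x, y)|(?M \<Otimes>\<^sub>M ?Y). (\<rho>1' t x y - \<rho>2' t x y) * (\<rho>1 t x y - \<rho>2 t x y)) \<le> 0"
    using \<pi>m[OF s1(1)] \<pi>m[OF s2(1)] L2_section_triple[OF sf s1(3)] L2_section_triple[OF sf s2(3)]
      s1(5-8) s2(5-8)
  proof eventually_elim
    case (elim t)
    from elim(5,9) have "AE x in ?M. \<pi>1 t x = \<pi>2 t x" by eventually_elim simp
    with elim show ?case
      by (intro energy_inequality[OF domains constants(2,3,5), of "\<pi>1 t" "\<pi>2 t" "\<rho>1' t" "\<rho>2' t"
            "D\<rho>1 t" "D\<rho>2 t" \<Gamma>\<^sub>R p\<^sub>F "w1 t" "w2 t" "\<rho>1 t" "\<rho>2 t"]) auto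
  qed
  then have diss: "AE t in ?S. (LINT z|(?M \<Otimes>\<^sub>M ?Y).
      ((case z of (x, y) \<Rightarrow> \<rho>1' t x y) - (case z of (x, y) \<Rightarrow> \<rho>2' t x y)) *
      ((case z of (x, y) \<Rightarrow> \<rho>1 t x y) - (case z of (x, y) \<Rightarrow> \<rho>2 t x y))) \<le> 0"
    by (simp add: split_beta')
  have "AE t in ?S. AE z in ?M \<Otimes>\<^sub>M ?Y. (case z of (x, y) \<Rightarrow> \<rho>1 t x y) = (case z of (x, y) \<Rightarrow> \<rho>2 t x y)"
    by (rule dissipative_difference_vanishes[OF T fin LA[OF s1(2)] LA[OF s1(3)] s1(4) init(1)
          LA[OF s2(2)] LA[OF s2(3)] s2(4) init(2) diss])
  then have \<rho>: "AE t in ?S. AE (x, y) in ?M \<Otimes>\<^sub>M ?Y. \<rho>1 t x y = \<rho>2 t x y"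
    by (simp add: split_beta')
  have "AE ((t, x), y) in (?S \<Otimes>\<^sub>M ?M) \<Otimes>\<^sub>M ?Y. \<rho>1 t x y = \<rho>2 t x y"
  proof (rule AE_pair_assoc[OF sf _ \<rho>])
    have "(\<lambda>z. \<rho>1 (fst (fst z)) (snd (fst z)) (snd z)) \<in> borel_measurable ((?S \<Otimes>\<^sub>M ?M) \<Otimes>\<^sub>M ?Y)"
      "(\<lambda>z. \<rho>2 (fst (fst z)) (snd (fst z)) (snd z)) \<in> borel_measurable ((?S \<Otimes>\<^sub>M ?M) \<Otimes>\<^sub>M ?Y)"
      using s1(2) s2(2) by (simp_all add: L2_def split_beta')
    then show "Measurable.pred ((?S \<Otimes>\<^sub>M ?M) \<Otimes>\<^sub>M ?Y) (\<lambda>((t, x), y). \<rho>1 t x y = \<rho>2 t x y)"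
      unfolding split_beta' by measurable
  qed
  moreover have "AE z in ?S \<Otimes>\<^sub>M ?M. \<pi>1 (fst z) (snd z) = \<pi>2 (fst z) (snd z)"
  proof (rule SM.AE_pair_measure)
    have "(\<lambda>z. \<pi>1 (fst z) (snd z)) \<in> borel_measurable (?S \<Otimes>\<^sub>M ?M)"
      "(\<lambda>z. \<pi>2 (fst z) (snd z)) \<in> borel_measurable (?S \<Otimes>\<^sub>M ?M)"
      using s1(1) s2(1) by (simp_all add: L2_def split_beta')
    then show "{z \<in> space (?S \<Otimes>\<^sub>M ?M). \<pi>1 (fst z) (snd z) = \<pi>2 (fst z) (snd z)} \<in> sets (?S \<Otimes>\<^sub>M ?M)"
      by measurable
    show "AE t in ?S. AE x in ?M. \<pi>1 (fst (t, x)) (snd (t, x)) = \<pi>2 (fst (t, x)) (snd (t, x))"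
      using s1(5) s2(5)
    proof eventually_elim
      case (elim t)
      then show ?case by eventually_elim simp
    qed
  qed
  ultimately show ?thesis by (simp add: split_beta')
qed

end
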